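(* Let $(X,\mu)$ be a $\sigma$-finite measure space, let $\Psi_1,\dots,\Psi_m$ be bounded sets of positive kernel operators on $L^2(X,\mu)$, and let $r\in\{\rho_{ess},\hat\rho_{ess}\}$. If $m$ is even, then $$\gamma(\Psi_1^{(1/m)}\circ\cdots\circ\Psi_m^{(1/m)})\le\left(r(\Psi_1^*\Psi_2\Psi_3^*\Psi_4\cdots\Psi_{m-1}^*\Psi_m)\,r(\Psi_1\Psi_2^*\Psi_3\Psi_4^*\cdots\Psi_{m-1}\Psi_m^* )\right)^{1/(2m)}$$ $$=\left(r(\Psi_1^*\Psi_2\Psi_3^*\Psi_4\cdots\Psi_{m-1}^*\Psi_m)\,r(\Psi_m\Psi_{m-1}^*\cdots\Psi_4\Psi_3^*\Psi_2\Psi_1^* )\right)^{1/(2m)}.$$ If $m$ is odd, then $$\gamma(\Psi_1^{(1/m)}\circ\cdots\circ\Psi_m^{(1/m)})\le r(\Psi_1\Psi_2^*\Psi_3\Psi_4^*\cdots\Psi_{m-2}\Psi_{m-1}^*\Psi_m\Psi_1^*\Psi_2\Psi_3^*\Psi_4\cdots\Psi_{m-2}^*\Psi_{m-1}\Psi_m^* )^{1/(2m)},$$ where the product inside has $2m$ factors $\Psi_1,\dots,\Psi_m,\Psi_1,\dots,\Psi_m$ with adjoints on exactly the even-numbered positions.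
   Context: An operator $A$ on $L^2(X,\mu)$ is a positive kernel operator if $(Af)(x)=\int_X a(x,y)f(y)\,d\mu(y)$ for a measurable kernel $a\ge0$ a.e. on $X\times X$. For positive kernel operators $A_1,\dots,A_m$ with kernels $a_1,\dots,a_m$ and positive $\alpha_j$ with $\sum\alpha_j=1$, the Hadamard weighted geometric mean $A_1^{(\alpha_1)}\circ\cdots\circ A_m^{(\alpha_m)}$ is the (bounded, positive) kernel operator with kernel $a_1^{\alpha_1}\cdots a_m^{\alpha_m}$. $A^*$ is the Hilbert adjoint (kernel $a(y,x)$). For sets: $\Psi_1^{(\alpha_1)}\circ\cdots\circ\Psi_m^{(\alpha_m)}=\{A_1^{(\alpha_1)}\circ\cdots\circ A_m^{(\alpha_m)}:A_j\in\Psi_j\}$, $\Psi^*=\{A^*:A\in\Psi\}$, $\Psi\Sigma=\{AB:A\in\Psi,B\in\Sigma\}$, $\Sigma^m=\{A_1\cdots A_m: A_i\in\Sigma\}$. For a bounded set $\Sigma$: $\gamma(\Sigma)=\sup_{T\in\Sigma}\gamma(T)$ where $\gamma(T)$ is the Hausdorff measure of noncompactness; $\rho_{ess}(\Sigma)=\sup_m[\sup_{A\in\Sigma^m}\rho_{ess}(A)]^{1/m}$, $\hat\rho_{ess}(\Sigma)=\lim_m[\sup_{A\in\Sigma^m}\gamma(A)]^{1/m}$, with $\rho_{ess}$ the essential spectral radius. *)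

theory Defs
  imports "HOL-Analysis.Analysis"
begin

text \<open>Elements of L2(X,mu) are represented by complex-valued measurable square-integrable
functions (a.e.-equal functions represent the same vector). Operators are maps on functions.\<close>

type_synonym 'a op = "('a \<Rightarrow> complex) \<Rightarrow> ('a \<Rightarrow> complex)"
type_synonym 'a kernel = "'a \<Rightarrow> 'a \<Rightarrow> real"

definition L2 :: "'a measure \<Rightarrow> ('a \<Rightarrow> complex) \<Rightarrow> bool" where
  "L2 M f \<longleftrightarrow> f \<in> borel_measurable M \<and> integrable M (\<lambda>x. (cmod (f x))\<^sup>2)"

definition nrm :: "'a measure \<Rightarrow> ('a \<Rightarrow> complex) \<Rightarrow> real" where
  "nrm M f = sqrt (LINT x|M. (cmod (f x))\<^sup>2)"

definition blin :: "'a measure \<Rightarrow> 'a op \<Rightarrow> bool" where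
  "blin M T \<longleftrightarrow>
     (\<forall>f. L2 M f \<longrightarrow> L2 M (T f)) \<and>
     (\<forall>f g. L2 M f \<longrightarrow> L2 M g \<longrightarrow> (AE x in M. f x = g x) \<longrightarrow> (AE x in M. T f x = T g x)) \<and>
     (\<forall>c f g. L2 M f \<longrightarrow> L2 M g \<longrightarrow>
        (AE x in M. T (\<lambda>y. c * f y + g y) x = c * T f x + T g x)) \<and>
     (\<exists>C. \<forall>f. L2 M f \<longrightarrow> nrm M (T f) \<le> C * nrm M f)"

definition compact_op :: "'a measure \<Rightarrow> 'a op \<Rightarrow> bool" where
  "compact_op M K \<longleftrightarrow> blin M K \<and>
     (\<forall>e>0. \<exists>F. finite F \<and> (\<forall>g\<in>F. L2 M g) \<and>
        (\<forall>f. L2 M f \<and> nrm M f \<le> 1 \<longrightarrow> (\<exists>g\<in>F. nrm M (\<lambda>x. K f x - g x) < e)))"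

definition gamma_op :: "'a measure \<Rightarrow> 'a op \<Rightarrow> real" where
  "gamma_op M T = Inf {r. r \<ge> 0 \<and> (\<exists>F. finite F \<and> (\<forall>g\<in>F. L2 M g) \<and>
        (\<forall>f. L2 M f \<and> nrm M f \<le> 1 \<longrightarrow> (\<exists>g\<in>F. nrm M (\<lambda>x. T f x - g x) \<le> r)))}"

text \<open>Essential spectrum: spectrum of the class of A in the Calkin algebra.\<close>
definition ess_spec :: "'a measure \<Rightarrow> 'a op \<Rightarrow> complex set" where
  "ess_spec M A = {l. \<not> (\<exists>B. blin M B \<and>
      compact_op M (\<lambda>f x. l * B f x - A (B f) x - f x) \<and>
      compact_op M (\<lambda>f x. B (\<lambda>y. l * f y - A f y) x - f x))}"

definition rho_ess :: "'a measure \<Rightarrow> 'a op \<Rightarrow> real" where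
  "rho_ess M A = Sup (insert 0 (cmod ` ess_spec M A))"

definition setprod :: "'a op set \<Rightarrow> 'a op set \<Rightarrow> 'a op set" where
  "setprod S T = {A \<circ> B | A B. A \<in> S \<and> B \<in> T}"

fun setpow :: "'a op set \<Rightarrow> nat \<Rightarrow> 'a op set" where
  "setpow S 0 = {id}"
| "setpow S (Suc n) = setprod S (setpow S n)"

definition prodlist :: "'a op set list \<Rightarrow> 'a op set" where
  "prodlist Ss = foldr setprod Ss {id}"

definition gamma_set :: "'a measure \<Rightarrow> 'a op set \<Rightarrow> real" where
  "gamma_set M S = Sup (insert 0 (gamma_op M ` S))"

definition rho_ess_set :: "'a measure \<Rightarrow> 'a op set \<Rightarrow> real" where
  "rho_ess_set M S = Sup (insert 0
     {(Sup (insert 0 (rho_ess M ` setpow S m))) powr (1 / real m) | m. m \<ge> 1})"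

definition rho_hat_ess_set :: "'a measure \<Rightarrow> 'a op set \<Rightarrow> real" where
  "rho_hat_ess_set M S = lim (\<lambda>m. (gamma_set M (setpow S (Suc m))) powr (1 / real (Suc m)))"

definition kop :: "'a measure \<Rightarrow> 'a kernel \<Rightarrow> 'a op" where
  "kop M a f = (\<lambda>x. LINT y|M. complex_of_real (a x y) * f y)"

definition pos_kernel_op :: "'a measure \<Rightarrow> 'a kernel \<Rightarrow> bool" where
  "pos_kernel_op M a \<longleftrightarrow>
     (\<lambda>z. a (fst z) (snd z)) \<in> borel_measurable (M \<Otimes>\<^sub>M M) \<and>
     (AE z in M \<Otimes>\<^sub>M M. 0 \<le> a (fst z) (snd z)) \<and>
     (\<forall>f. L2 M f \<longrightarrow> (AE x in M. integrable M (\<lambda>y. complex_of_real (a x y) * f y))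
                     \<and> L2 M (kop M a f)) \<and>
     (\<exists>C. \<forall>f. L2 M f \<longrightarrow> nrm M (kop M a f) \<le> C * nrm M f)"

definition bdd_pko_set :: "'a measure \<Rightarrow> 'a kernel set \<Rightarrow> bool" where
  "bdd_pko_set M P \<longleftrightarrow> (\<forall>a\<in>P. pos_kernel_op M a) \<and>
     (\<exists>C. \<forall>a\<in>P. \<forall>f. L2 M f \<longrightarrow> nrm M (kop M a f) \<le> C * nrm M f)"

definition ops :: "'a measure \<Rightarrow> 'a kernel set \<Rightarrow> 'a op set" where
  "ops M P = kop M ` P"

definition adj_ops :: "'a measure \<Rightarrow> 'a kernel set \<Rightarrow> 'a op set" where
  "adj_ops M P = (\<lambda>a. kop M (\<lambda>x y. a y x)) ` P"

definition hadamard_mean_set :: "'a measure \<Rightarrow> nat \<Rightarrow> (nat \<Rightarrow> 'a kernel set) \<Rightarrow> 'a op set" where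
  "hadamard_mean_set M m Psi =
     {kop M (\<lambda>x y. \<Prod>j\<in>{1..m}. (a j x y) powr (1 / real m)) | a. \<forall>j\<in>{1..m}. a j \<in> Psi j}"

end

(*
  On a sigma-finite L2 space let T be a positive kernel operator and let S_n be kernels with
  0 <= S_n <= T and S_n -> 0 almost everywhere. If T(ball) has a finite r-net, then for h = S_n |f|
  one has |h|^2 <= <h, T|f|> <= <|f|, S_n* |g|> + r |h| with g in the net, and S_n* |g| -> 0 in norm;
  hence limsup |S_n| <= gamma(T). Cutting kernels off at height n on sets of finite measure leaves
  compact operators, so gamma(T) is the limit of the norms of the tails of T. From this description
  gamma is monotone and log-convex under Hadamard means (Hoelder), invariant under adjoints, and
  satisfies gamma(T)^2 <= gamma(T* T).

  For the mean A of A_1, ..., A_m write A A* A A* ... with the i-th factor listing the letters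
  rotated by i. The product is dominated by the Hadamard mean over the slots s of the words read in
  slot s, which are cyclic shifts of powers of the two (m even) or one (m odd) alternating words in
  the statement. Taking roots, gamma(A) is bounded by the growth rates of gamma along powers of
  these words, and by Gelfand's formula in the Calkin algebra (proved with averages of the
  resolvent over roots of unity) the growth rate is the essential spectral radius.
*)
theory Submission
  imports Defs
begin

text \<open>The exponents come from two periodicities along the alternating product: letters repeat
  after \<open>m\<close> steps, adjoints after 2. For even \<open>m\<close> both return after
  \<open>m\<close> letters and half of the slots read each of the two words, so
  \<open>gamma^m\<close> is at most the square root of the product of the two radii. For odd
  \<open>m\<close> they return together only after \<open>2 * m\<close> letters, and every slot
  reads the same word up to rotation. For one choice of kernels these words are single members of
  the product sets, so it is enough that the radius of a set controls the powers of each member;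
  this settles both radii at once.

  Since \<open>gamma_op\<close> is only a seminorm, vanishing on compact operators, the bound on the
  essential spectrum cannot sum a Neumann series directly. Truncation bridges the gap: it splits a
  positive kernel into a compact part and a part whose operator norm is close to
  \<open>gamma_op\<close>. The other half of Gelfand's formula works with the seminorm alone.

  A self-adjoint product loses nothing under powers: iterating the bound for squares gives
  \<open>gamma(S)^n <= gamma(S^n)\<close>. This turns the single number \<open>gamma(A)\<close> into
  a growth rate.\<close>

section \<open>Square-integrable functions and their seminorm\<close>

lemma L2_measurable [measurable_dest]: "L2 M f \<Longrightarrow> f \<in> borel_measurable M"
  by (simp add: L2_def)

lemma L2_integrable: "L2 M f \<Longrightarrow> integrable M (\<lambda>x. (cmod (f x))\<^sup>2)"
  by (simp add: L2_def)

lemma L2_dominated: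
  assumes "f \<in> borel_measurable M" "L2 M g" "AE x in M. cmod (f x) \<le> cmod (g x)"
  shows "L2 M f"
  unfolding L2_def
proof (intro conjI Bochner_Integration.integrable_bound[OF L2_integrable[OF assms(2)]])
  show "AE x in M. norm ((cmod (f x))\<^sup>2) \<le> norm ((cmod (g x))\<^sup>2)"
    using assms(3) by eventually_elim (simp add: power_mono)
qed (use assms in auto)

lemma L2_zero [simp]: "L2 M (\<lambda>x. 0)"
  by (simp add: L2_def)

lemma L2_scale: "L2 M f \<Longrightarrow> L2 M (\<lambda>x. c * f x)"
  by (auto simp add: L2_def norm_mult power_mult_distrib)

lemma norm_add_sq_le: "(norm (a + b))\<^sup>2 \<le> 2 * (norm a)\<^sup>2 + 2 * (norm b)\<^sup>2"
  for a b :: "'b::real_normed_vector"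
proof -
  have "(norm (a + b))\<^sup>2 \<le> (norm a + norm b)\<^sup>2"
    by (intro power_mono norm_triangle_ineq) auto
  also have "\<dots> \<le> 2 * (norm a)\<^sup>2 + 2 * (norm b)\<^sup>2"
    using zero_le_power2[of "norm a - norm b"] by (simp add: power2_eq_square algebra_simps)
  finally show ?thesis .
qed

lemma L2_add:
  assumes f: "L2 M f" and g: "L2 M g"
  shows "L2 M (\<lambda>x. f x + g x)"
  unfolding L2_def
proof
  note [measurable] = L2_measurable[OF f] L2_measurable[OF g]
  show "(\<lambda>x. f x + g x) \<in> borel_measurable M" by measurable
  show "integrable M (\<lambda>x. (cmod (f x + g x))\<^sup>2)"
  proof (rule Bochner_Integration.integrable_bound)
    show "integrable M (\<lambda>x. 2 * (cmod (f x))\<^sup>2 + 2 * (cmod (g x))\<^sup>2)"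
      using L2_integrable[OF f] L2_integrable[OF g] by simp
    show "AE x in M. norm ((cmod (f x + g x))\<^sup>2) \<le> norm (2 * (cmod (f x))\<^sup>2 + 2 * (cmod (g x))\<^sup>2)"
      using norm_add_sq_le by (intro AE_I2) (simp add: abs_of_nonneg)
  qed measurable
qed

lemma L2_diff: "L2 M f \<Longrightarrow> L2 M g \<Longrightarrow> L2 M (\<lambda>x. f x - g x)"
  using L2_add[of M f "\<lambda>x. (-1) * g x"] L2_scale[of M g "-1"] by simp

lemma L2_cmod: "L2 M f \<Longrightarrow> L2 M (\<lambda>x. complex_of_real (cmod (f x)))"
  by (auto simp add: L2_def)

lemma nrm_nonneg [simp]: "0 \<le> nrm M f"
  by (simp add: nrm_def)

lemma nrm_power2: "(nrm M f)\<^sup>2 = (LINT x|M. (cmod (f x))\<^sup>2)"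
  by (simp add: nrm_def)

lemma nrm_zero [simp]: "nrm M (\<lambda>x. 0) = 0"
  by (simp add: nrm_def)

lemma nrm_scale: "nrm M (\<lambda>x. c * f x) = cmod c * nrm M f"
  by (simp add: nrm_def norm_mult power_mult_distrib real_sqrt_mult)

lemma nrm_minus_commute: "nrm M (\<lambda>x. f x - g x) = nrm M (\<lambda>x. g x - f x)"
  by (simp add: nrm_def norm_minus_commute)

lemma nrm_mono:
  assumes "f \<in> borel_measurable M" "L2 M g" "AE x in M. cmod (f x) \<le> cmod (g x)"
  shows "nrm M f \<le> nrm M g"
  unfolding nrm_def
proof (intro real_sqrt_le_mono integral_mono_AE)
  show "AE x in M. (cmod (f x))\<^sup>2 \<le> (cmod (g x))\<^sup>2"
    using assms(3) by eventually_elim (simp add: power_mono)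
qed (use assms L2_dominated in \<open>auto intro: L2_integrable\<close>)

lemma nrm_cong_AE:
  assumes "L2 M f" "L2 M g" "AE x in M. f x = g x"
  shows "nrm M f = nrm M g"
proof (rule antisym)
  show "nrm M f \<le> nrm M g"
    by (intro nrm_mono) (use assms in \<open>auto intro: L2_measurable\<close>)
  show "nrm M g \<le> nrm M f"
    by (intro nrm_mono) (use assms in \<open>auto intro: L2_measurable\<close>)
qed

lemma nrm_eq_0_AE:
  assumes "L2 M f" "nrm M f = 0"
  shows "AE x in M. f x = 0"
proof -
  have "(LINT x|M. (cmod (f x))\<^sup>2) = 0"
    using assms(2) by (simp add: nrm_def)
  then have "AE x in M. (cmod (f x))\<^sup>2 = 0"
    using integral_nonneg_eq_0_iff_AE[OF L2_integrable[OF assms(1)]] by simp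
  then show ?thesis by eventually_elim simp
qed

lemma nn_integral_L2:
  "L2 M f \<Longrightarrow> (\<integral>\<^sup>+x. (ennreal (cmod (f x)))\<^sup>2 \<partial>M) = ennreal ((nrm M f)\<^sup>2)"
  by (simp add: nrm_power2 ennreal_power nn_integral_eq_integral[OF L2_integrable])

text \<open>The version for nonnegative integrals comes first because it presupposes no
  integrability of the product; the next lemma reads that integrability off it.\<close>

lemma L2_Cauchy_Schwarz_nn:
  assumes f: "L2 M f" and g: "L2 M g"
  shows "(\<integral>\<^sup>+x. ennreal (cmod (f x) * cmod (g x)) \<partial>M) \<le> ennreal (nrm M f * nrm M g)"
proof -
  note [measurable] = L2_measurable[OF f] L2_measurable[OF g]
  let ?I = "\<integral>\<^sup>+x. ennreal (cmod (f x)) * ennreal (cmod (g x)) \<partial>M"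
  have "?I\<^sup>2 \<le> (\<integral>\<^sup>+x. (ennreal (cmod (f x)))\<^sup>2 \<partial>M) * (\<integral>\<^sup>+x. (ennreal (cmod (g x)))\<^sup>2 \<partial>M)"
    by (rule Cauchy_Schwarz_nn_integral) measurable
  also have "\<dots> = (ennreal (nrm M f * nrm M g))\<^sup>2"
    by (simp add: nn_integral_L2[OF f] nn_integral_L2[OF g] ennreal_mult power_mult_distrib
        flip: ennreal_power)
  finally have sq: "?I\<^sup>2 \<le> (ennreal (nrm M f * nrm M g))\<^sup>2" .
  have "?I \<le> ennreal (nrm M f * nrm M g)"
  proof (cases "?I")
    case (real t)
    then show ?thesis using sq by (auto simp: ennreal_power ennreal_le_iff power2_le_iff_abs_le abs_le_square_iff)
  next
    case top
    then show ?thesis using sq by (simp add: ennreal_power top_unique)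
  qed
  then show ?thesis by (simp add: ennreal_mult)
qed

lemma L2_mult_integrable:
  assumes f: "L2 M f" and g: "L2 M g"
  shows "integrable M (\<lambda>x. cmod (f x) * cmod (g x))"
proof (rule integrableI_bounded)
  note [measurable] = L2_measurable[OF f] L2_measurable[OF g]
  show "(\<lambda>x. cmod (f x) * cmod (g x)) \<in> borel_measurable M" by measurable
  show "(\<integral>\<^sup>+x. ennreal (norm (cmod (f x) * cmod (g x))) \<partial>M) < \<infinity>"
    using L2_Cauchy_Schwarz_nn[OF f g] by (simp add: norm_mult le_less_trans)
qed

lemma L2_Cauchy_Schwarz:
  assumes f: "L2 M f" and g: "L2 M g"
  shows "(LINT x|M. cmod (f x) * cmod (g x)) \<le> nrm M f * nrm M g"
proof -
  have "ennreal (LINT x|M. cmod (f x) * cmod (g x)) \<le> ennreal (nrm M f * nrm M g)"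
    using L2_Cauchy_Schwarz_nn[OF f g] nn_integral_eq_integral[OF L2_mult_integrable[OF f g]]
    by simp
  then show ?thesis by (simp add: ennreal_le_iff)
qed

lemma nrm_triangle:
  assumes f: "L2 M f" and g: "L2 M g"
  shows "nrm M (\<lambda>x. f x + g x) \<le> nrm M f + nrm M g"
proof (rule power2_le_imp_le)
  have i: "integrable M (\<lambda>x. cmod (f x) * cmod (g x))"
    by (rule L2_mult_integrable[OF f g])
  have "(nrm M (\<lambda>x. f x + g x))\<^sup>2 \<le> (LINT x|M. (cmod (f x))\<^sup>2 + 2 * (cmod (f x) * cmod (g x)) + (cmod (g x))\<^sup>2)"
    unfolding nrm_power2
  proof (rule integral_mono)
    fix x
    have "(cmod (f x + g x))\<^sup>2 \<le> (cmod (f x) + cmod (g x))\<^sup>2"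
      by (intro power_mono norm_triangle_ineq) auto
    then show "(cmod (f x + g x))\<^sup>2 \<le> (cmod (f x))\<^sup>2 + 2 * (cmod (f x) * cmod (g x)) + (cmod (g x))\<^sup>2"
      by (simp add: power2_eq_square algebra_simps)
  qed (use L2_integrable[OF f] L2_integrable[OF g] i L2_integrable[OF L2_add[OF f g]] in auto)
  also have "\<dots> = (nrm M f)\<^sup>2 + 2 * (LINT x|M. cmod (f x) * cmod (g x)) + (nrm M g)\<^sup>2"
    using L2_integrable[OF f] L2_integrable[OF g] i by (simp add: nrm_power2)
  also have "\<dots> \<le> (nrm M f + nrm M g)\<^sup>2"
    using L2_Cauchy_Schwarz[OF f g] by (simp add: power2_sum)
  finally show "(nrm M (\<lambda>x. f x + g x))\<^sup>2 \<le> (nrm M f + nrm M g)\<^sup>2" .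
qed simp

lemma nrm_triangle_diff:
  assumes "L2 M f" "L2 M g" "L2 M h"
  shows "nrm M (\<lambda>x. f x - h x) \<le> nrm M (\<lambda>x. f x - g x) + nrm M (\<lambda>x. g x - h x)"
  using nrm_triangle[OF L2_diff[OF assms(1,2)] L2_diff[OF assms(2,3)]] by simp

subsection \<open>Bounded operators\<close>

lemma blin_L2: "blin M T \<Longrightarrow> L2 M f \<Longrightarrow> L2 M (T f)"
  by (simp add: blin_def)

lemma blin_cong_AE:
  "blin M T \<Longrightarrow> L2 M f \<Longrightarrow> L2 M g \<Longrightarrow> AE x in M. f x = g x \<Longrightarrow> AE x in M. T f x = T g x"
  by (simp add: blin_def)

lemma blin_linear:
  "blin M T \<Longrightarrow> L2 M f \<Longrightarrow> L2 M g \<Longrightarrow> AE x in M. T (\<lambda>y. c * f y + g y) x = c * T f x + T g x"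
  by (simp add: blin_def)

lemma blin_bounded:
  assumes "blin M T"
  obtains C where "C \<ge> 0" "\<And>f. L2 M f \<Longrightarrow> nrm M (T f) \<le> C * nrm M f"
proof -
  obtain C where C: "\<And>f. L2 M f \<Longrightarrow> nrm M (T f) \<le> C * nrm M f"
    using assms unfolding blin_def by blast
  have "nrm M (T f) \<le> max C 0 * nrm M f" if "L2 M f" for f
    using C[OF that] by (meson max.cobounded1 mult_right_mono nrm_nonneg order_trans)
  then show thesis using that[of "max C 0"] by simp
qed

lemma blin_add_arg:
  "blin M T \<Longrightarrow> L2 M f \<Longrightarrow> L2 M g \<Longrightarrow> AE x in M. T (\<lambda>y. f y + g y) x = T f x + T g x"
  using blin_linear[of M T f g 1] by simp

lemma blin_diff_arg:
  "blin M T \<Longrightarrow> L2 M f \<Longrightarrow> L2 M g \<Longrightarrow> AE x in M. T (\<lambda>y. f y - g y) x = T f x - T g x"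
  using blin_linear[of M T g f "-1"] by simp

lemma blin_zero_arg: "blin M T \<Longrightarrow> AE x in M. T (\<lambda>y. 0) x = 0"
  using blin_linear[of M T "\<lambda>y. 0" "\<lambda>y. 0" 1] by simp

lemma blin_scale_arg: "blin M T \<Longrightarrow> L2 M f \<Longrightarrow> AE x in M. T (\<lambda>y. c * f y) x = c * T f x"
  using blin_linear[of M T f "\<lambda>y. 0" c] blin_zero_arg[of M T] by auto

lemma blin_cong:
  assumes T: "blin M T" and S: "\<And>f. L2 M f \<Longrightarrow> L2 M (S f)"
    and eq: "\<And>f. L2 M f \<Longrightarrow> AE x in M. S f x = T f x"
  shows "blin M S"
  unfolding blin_def
proof (intro conjI allI impI S)
  show "AE x in M. S f x = S g x" if "L2 M f" "L2 M g" "AE x in M. f x = g x" for f g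
    using eq[OF that(1)] eq[OF that(2)] blin_cong_AE[OF T that] by eventually_elim simp
  show "AE x in M. S (\<lambda>y. c * f y + g y) x = c * S f x + S g x" if "L2 M f" "L2 M g" for c f g
    using eq[OF that(1)] eq[OF that(2)] eq[OF L2_add[OF L2_scale[OF that(1), of c] that(2)]]
      blin_linear[OF T that, of c]
    by eventually_elim simp
  obtain C where "\<And>f. L2 M f \<Longrightarrow> nrm M (T f) \<le> C * nrm M f"
    using blin_bounded[OF T] by blast
  then show "\<exists>C. \<forall>f. L2 M f \<longrightarrow> nrm M (S f) \<le> C * nrm M f"
    using nrm_cong_AE[OF S blin_L2[OF T] eq] by metis
qed

lemma blin_id [simp]: "blin M (\<lambda>f. f)"
  by (auto simp: blin_def intro: exI[of _ 1])

lemma blin_zero [simp]: "blin M (\<lambda>f x. 0)"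
  by (auto simp: blin_def intro: exI[of _ 0])

lemma blin_scale: 
  assumes T: "blin M T"
  shows "blin M (\<lambda>f x. c * T f x)"
  unfolding blin_def
proof (intro conjI allI impI)
  show "L2 M (\<lambda>x. c * T f x)" if "L2 M f" for f
    by (intro L2_scale blin_L2[OF T] that)
  show "AE x in M. c * T f x = c * T g x" if "L2 M f" "L2 M g" "AE x in M. f x = g x" for f g
    using blin_cong_AE[OF T that] by eventually_elim simp
  show "AE x in M. c * T (\<lambda>y. d * f y + g y) x = d * (c * T f x) + c * T g x"
    if "L2 M f" "L2 M g" for d f g
    using blin_linear[OF T that, of d] by eventually_elim (simp add: algebra_simps)
  obtain C where "\<And>f. L2 M f \<Longrightarrow> nrm M (T f) \<le> C * nrm M f"
    using blin_bounded[OF T] by blast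
  then show "\<exists>C. \<forall>f. L2 M f \<longrightarrow> nrm M (\<lambda>x. c * T f x) \<le> C * nrm M f"
    by (intro exI[of _ "cmod c * C"]) (simp add: nrm_scale mult.assoc mult_left_mono)
qed

lemma blin_add: 
  assumes S: "blin M S" and T: "blin M T"
  shows "blin M (\<lambda>f x. S f x + T f x)"
  unfolding blin_def
proof (intro conjI allI impI)
  show "L2 M (\<lambda>x. S f x + T f x)" if "L2 M f" for f
    by (intro L2_add blin_L2[OF T] blin_L2[OF S] that)
  show "AE x in M. S f x + T f x = S g x + T g x" if "L2 M f" "L2 M g" "AE x in M. f x = g x" for f g
    using blin_cong_AE[OF T that] blin_cong_AE[OF S that] by eventually_elim simp
  show "AE x in M. S (\<lambda>y. d * f y + g y) x + T (\<lambda>y. d * f y + g y) x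
      = d * (S f x + T f x) + (S g x + T g x)"
    if "L2 M f" "L2 M g" for d f g
    using blin_linear[OF T that, of d] blin_linear[OF S that, of d] 
    by eventually_elim (simp add: algebra_simps)
  obtain C where C: "\<And>f. L2 M f \<Longrightarrow> nrm M (T f) \<le> C * nrm M f"
    using blin_bounded[OF T] by blast
  obtain D where D: "\<And>f. L2 M f \<Longrightarrow> nrm M (S f) \<le> D * nrm M f"
    using blin_bounded[OF S] by blast
  show "\<exists>C. \<forall>f. L2 M f \<longrightarrow> nrm M (\<lambda>x. S f x + T f x) \<le> C * nrm M f"
  proof (intro exI[of _ "D + C"] allI impI)
    fix f assume f: "L2 M f"
    show "nrm M (\<lambda>x. S f x + T f x) \<le> (D + C) * nrm M f"
      using nrm_triangle[OF blin_L2[OF S f] blin_L2[OF T f]] C[OF f] D[OF f]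
      by (simp add: algebra_simps)
  qed
qed

lemma blin_minus: "blin M T \<Longrightarrow> blin M (\<lambda>f x. - T f x)"
  using blin_scale[of M T "-1"] by simp

lemma blin_diff: "blin M S \<Longrightarrow> blin M T \<Longrightarrow> blin M (\<lambda>f x. S f x - T f x)"
  using blin_add[of M S "\<lambda>f x. - T f x"] blin_minus[of M T] by simp

lemma blin_comp: 
  assumes S: "blin M S" and T: "blin M T"
  shows "blin M (\<lambda>f. S (T f))"
  unfolding blin_def
proof (intro conjI allI impI)
  show "L2 M (S (T f))" if "L2 M f" for f
    by (intro blin_L2[OF T] blin_L2[OF S] that)
  show "AE x in M. S (T f) x = S (T g) x" if "L2 M f" "L2 M g" "AE x in M. f x = g x" for f g
    by (intro blin_cong_AE[OF S] blin_cong_AE[OF T] blin_L2[OF T] that)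
  show "AE x in M. S (T (\<lambda>y. d * f y + g y)) x = d * S (T f) x + S (T g) x"
    if f: "L2 M f" and g: "L2 M g" for d f g
  proof -
    have "AE x in M. S (T (\<lambda>y. d * f y + g y)) x = S (\<lambda>y. d * T f y + T g y) x"
      by (intro blin_cong_AE[OF S] blin_linear[OF T] L2_add L2_scale blin_L2[OF T] f g)
    then show ?thesis
      using blin_linear[OF S blin_L2[OF T f] blin_L2[OF T g], of d] by eventually_elim simp
  qed
  obtain C where C: "\<And>f. L2 M f \<Longrightarrow> nrm M (T f) \<le> C * nrm M f"
    using blin_bounded[OF T] by blast
  obtain D where D: "D \<ge> 0" "\<And>f. L2 M f \<Longrightarrow> nrm M (S f) \<le> D * nrm M f"
    using blin_bounded[OF S] by blast
  show "\<exists>C. \<forall>f. L2 M f \<longrightarrow> nrm M (S (T f)) \<le> C * nrm M f"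
  proof (intro exI[of _ "D * C"] allI impI)
    fix f assume f: "L2 M f"
    have "nrm M (S (T f)) \<le> D * nrm M (T f)" by (intro D blin_L2[OF T] f)
    also have "\<dots> \<le> D * (C * nrm M f)" by (intro mult_left_mono C D f)
    finally show "nrm M (S (T f)) \<le> (D * C) * nrm M f" by (simp add: mult.assoc)
  qed
qed

subsection \<open>The Hausdorff measure of noncompactness\<close>

text \<open>Admissible radii get a name so that sums and products can be argued on single radii; the
  infimum itself need not be attained, which is why later estimates carry an extra
  \<open>e\<close>.\<close>

definition net_radius :: "'a measure \<Rightarrow> 'a op \<Rightarrow> real \<Rightarrow> bool" where
  "net_radius M T r \<longleftrightarrow> r \<ge> 0 \<and> (\<exists>F. finite F \<and> (\<forall>g\<in>F. L2 M g) \<and>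
        (\<forall>f. L2 M f \<and> nrm M f \<le> 1 \<longrightarrow> (\<exists>g\<in>F. nrm M (\<lambda>x. T f x - g x) \<le> r)))"

lemma gamma_op_eq_Inf: "gamma_op M T = Inf {r. net_radius M T r}"
  by (simp add: gamma_op_def net_radius_def)

lemma net_radius_nonneg: "net_radius M T r \<Longrightarrow> 0 \<le> r"
  by (simp add: net_radius_def)

lemma net_radius_bound:
  assumes "\<And>f. L2 M f \<Longrightarrow> nrm M (T f) \<le> C * nrm M f" "C \<ge> 0"
  shows "net_radius M T C"
  unfolding net_radius_def
proof (intro conjI exI[of _ "{\<lambda>x. 0}"] allI impI)
  fix f assume f: "L2 M f \<and> nrm M f \<le> 1"
  have "nrm M (T f) \<le> C * nrm M f" using assms f by simp
  also have "\<dots> \<le> C * 1" using f assms by (intro mult_left_mono) auto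
  finally show "\<exists>g\<in>{\<lambda>x. 0}. nrm M (\<lambda>x. T f x - g x) \<le> C" by simp
qed (use assms in auto)

lemma net_radius_ex: "blin M T \<Longrightarrow> \<exists>r. net_radius M T r"
  by (metis blin_bounded net_radius_bound)

lemma gamma_op_le: "net_radius M T r \<Longrightarrow> gamma_op M T \<le> r"
  unfolding gamma_op_eq_Inf by (intro cInf_lower bdd_belowI[of _ 0]) (auto dest: net_radius_nonneg)

lemma gamma_op_nonneg: "blin M T \<Longrightarrow> 0 \<le> gamma_op M T"
  unfolding gamma_op_eq_Inf using net_radius_ex by (intro cInf_greatest) (auto dest: net_radius_nonneg)

lemma gamma_op_less_net:
  assumes "blin M T" "gamma_op M T < c"
  obtains r where "net_radius M T r" "r < c"
  using cInf_lessD[of "{r. net_radius M T r}" c] assms net_radius_ex[OF assms(1)]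
  unfolding gamma_op_eq_Inf by blast

lemma gamma_op_leI:
  assumes "blin M T" "\<And>e. e > 0 \<Longrightarrow> gamma_op M T \<le> c + e"
  shows "gamma_op M T \<le> c"
  using assms(2) by (rule field_le_epsilon)

lemma gamma_op_bound:
  assumes "\<And>f. L2 M f \<Longrightarrow> nrm M (T f) \<le> C * nrm M f" "C \<ge> 0"
  shows "gamma_op M T \<le> C"
  by (intro gamma_op_le net_radius_bound assms)

lemma net_radius_cong:
  assumes S: "blin M S" and T: "blin M T"
    and eq: "\<And>f. L2 M f \<Longrightarrow> AE x in M. S f x = T f x" and r: "net_radius M S r"
  shows "net_radius M T r"
proof -
  obtain F where F: "finite F" "\<And>g. g \<in> F \<Longrightarrow> L2 M g"
    "\<And>f. L2 M f \<Longrightarrow> nrm M f \<le> 1 \<Longrightarrow> \<exists>g\<in>F. nrm M (\<lambda>x. S f x - g x) \<le> r"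
    using r unfolding net_radius_def by blast
  have eq': "nrm M (\<lambda>x. T f x - g x) = nrm M (\<lambda>x. S f x - g x)" if f: "L2 M f" and g: "L2 M g" for f g
  proof (rule nrm_cong_AE)
    show "AE x in M. T f x - g x = S f x - g x"
      using eq[OF f] by eventually_elim simp
  qed (intro L2_diff blin_L2[OF S] blin_L2[OF T] f g)+
  show ?thesis unfolding net_radius_def
  proof (intro conjI exI[of _ F] allI impI)
    fix f assume f: "L2 M f \<and> nrm M f \<le> 1"
    then obtain g where "g \<in> F" "nrm M (\<lambda>x. S f x - g x) \<le> r" using F(3) by blast
    then show "\<exists>g\<in>F. nrm M (\<lambda>x. T f x - g x) \<le> r"
      using eq'[of f g] f F(2) by (intro bexI[of _ g]) auto
  qed (use r F net_radius_nonneg in auto)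
qed

lemma gamma_op_cong:
  assumes "blin M S" "blin M T" "\<And>f. L2 M f \<Longrightarrow> AE x in M. S f x = T f x"
  shows "gamma_op M S = gamma_op M T"
proof -
  have "AE x in M. T f x = S f x" if "L2 M f" for f
    using assms(3)[OF that] by eventually_elim simp
  then have "net_radius M S r \<longleftrightarrow> net_radius M T r" for r
    using net_radius_cong[of M S T r] net_radius_cong[of M T S r] assms by blast
  then show ?thesis by (simp add: gamma_op_eq_Inf)
qed

lemma net_radius_add:
  assumes S: "blin M S" and T: "blin M T" and r: "net_radius M S r" and s: "net_radius M T s"
  shows "net_radius M (\<lambda>f x. S f x + T f x) (r + s)"
proof -
  obtain F where F: "finite F" "\<And>g. g \<in> F \<Longrightarrow> L2 M g"
    "\<And>f. L2 M f \<Longrightarrow> nrm M f \<le> 1 \<Longrightarrow> \<exists>g\<in>F. nrm M (\<lambda>x. S f x - g x) \<le> r"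
    using r unfolding net_radius_def by blast
  obtain G where G: "finite G" "\<And>g. g \<in> G \<Longrightarrow> L2 M g"
    "\<And>f. L2 M f \<Longrightarrow> nrm M f \<le> 1 \<Longrightarrow> \<exists>g\<in>G. nrm M (\<lambda>x. T f x - g x) \<le> s"
    using s unfolding net_radius_def by blast
  show ?thesis unfolding net_radius_def
  proof (intro conjI exI[of _ "(\<lambda>(g,h) x. g x + h x) ` (F \<times> G)"] allI impI)
    show "finite ((\<lambda>(g,h) x. g x + h x) ` (F \<times> G))" using F G by simp
    show "\<forall>g\<in>(\<lambda>(g,h) x. g x + h x) ` (F \<times> G). L2 M g" using F G by (auto intro!: L2_add)
    fix f assume f: "L2 M f \<and> nrm M f \<le> 1"
    obtain g where g: "g \<in> F" "nrm M (\<lambda>x. S f x - g x) \<le> r" using F(3) f by blast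
    obtain h where h: "h \<in> G" "nrm M (\<lambda>x. T f x - h x) \<le> s" using G(3) f by blast
    have "nrm M (\<lambda>x. (S f x - g x) + (T f x - h x)) \<le> nrm M (\<lambda>x. S f x - g x) + nrm M (\<lambda>x. T f x - h x)"
      by (intro nrm_triangle L2_diff blin_L2[OF S] blin_L2[OF T]) (use f g h F G in auto)
    also have "\<dots> \<le> r + s" using g h by simp
    finally have "nrm M (\<lambda>x. S f x + T f x - (g x + h x)) \<le> r + s"
      by (simp add: algebra_simps)
    then show "\<exists>g\<in>(\<lambda>(g,h) x. g x + h x) ` (F \<times> G). nrm M (\<lambda>x. S f x + T f x - g x) \<le> r + s"
      using g(1) h(1) by force
  qed (use r s in \<open>simp add: net_radius_def\<close>)
qed

lemma gamma_op_add:
  assumes S: "blin M S" and T: "blin M T"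
  shows "gamma_op M (\<lambda>f x. S f x + T f x) \<le> gamma_op M S + gamma_op M T"
proof (rule gamma_op_leI[OF blin_add[OF assms]])
  fix e :: real assume e: "e > 0"
  obtain r where r: "net_radius M S r" "r < gamma_op M S + e/2"
    using gamma_op_less_net[OF S, of "gamma_op M S + e/2"] e by auto
  obtain s where s: "net_radius M T s" "s < gamma_op M T + e/2"
    using gamma_op_less_net[OF T, of "gamma_op M T + e/2"] e by auto
  show "gamma_op M (\<lambda>f x. S f x + T f x) \<le> gamma_op M S + gamma_op M T + e"
    using gamma_op_le[OF net_radius_add[OF S T r(1) s(1)]] r s by simp
qed

text \<open>If \<open>T f\<close> is within \<open>s\<close> of \<open>h\<close>, then
  \<open>(T f - h) / s\<close> lies in the unit ball, so \<open>S\<close> maps it to within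
  \<open>r\<close> of some \<open>g\<close>. By linearity \<open>S (T f)\<close> is within
  \<open>r * s\<close> of \<open>S h + s * g\<close>, and there are finitely many such sums.
  Positivity of \<open>s\<close> is for this division.\<close>

lemma net_radius_comp:
  assumes S: "blin M S" and T: "blin M T" and r: "net_radius M S r" and s: "net_radius M T s" "s > 0"
  shows "net_radius M (\<lambda>f. S (T f)) (r * s)"
proof -
  obtain F where F: "finite F" "\<And>g. g \<in> F \<Longrightarrow> L2 M g"
    "\<And>f. L2 M f \<Longrightarrow> nrm M f \<le> 1 \<Longrightarrow> \<exists>g\<in>F. nrm M (\<lambda>x. S f x - g x) \<le> r"
    using r unfolding net_radius_def by blast
  obtain G where G: "finite G" "\<And>g. g \<in> G \<Longrightarrow> L2 M g"
    "\<And>f. L2 M f \<Longrightarrow> nrm M f \<le> 1 \<Longrightarrow> \<exists>g\<in>G. nrm M (\<lambda>x. T f x - g x) \<le> s"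
    using s unfolding net_radius_def by blast
  let ?N = "(\<lambda>(g,h) x. S h x + complex_of_real s * g x) ` (F \<times> G)"
  show ?thesis unfolding net_radius_def
  proof (intro conjI exI[of _ ?N] allI impI)
    show "finite ?N" using F G by simp
    show "\<forall>g\<in>?N. L2 M g" using F G by (auto intro!: L2_add L2_scale blin_L2[OF S])
    fix f assume f: "L2 M f \<and> nrm M f \<le> 1"
    obtain h where h: "h \<in> G" "nrm M (\<lambda>x. T f x - h x) \<le> s" using G(3) f by blast
    have Tf: "L2 M (T f)" and hL: "L2 M h" using f h G blin_L2[OF T] by auto
    define u where "u = (\<lambda>x. complex_of_real (1/s) * (T f x - h x))"
    have u: "L2 M u" unfolding u_def by (intro L2_scale L2_diff Tf hL)
    have "nrm M u = nrm M (\<lambda>x. T f x - h x) / s"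
      unfolding u_def nrm_scale using s by (simp add: norm_divide)
    then have "nrm M u \<le> 1" using h s by (simp add: divide_le_eq_1)
    then obtain g where g: "g \<in> F" "nrm M (\<lambda>x. S u x - g x) \<le> r" using F(3) u by blast
    have gL: "L2 M g" using g F by auto
    have "T f = (\<lambda>x. complex_of_real s * u x + h x)"
      using s by (auto simp: u_def)
    then have "AE x in M. S (T f) x = complex_of_real s * S u x + S h x"
      using blin_linear[OF S u hL] by simp
    then have ae: "AE x in M. S (T f) x - (S h x + complex_of_real s * g x) = complex_of_real s * (S u x - g x)"
      by eventually_elim (simp add: algebra_simps)
    have "nrm M (\<lambda>x. S (T f) x - (S h x + complex_of_real s * g x)) = nrm M (\<lambda>x. complex_of_real s * (S u x - g x))"
      by (intro nrm_cong_AE ae L2_diff L2_add L2_scale blin_L2[OF S] Tf hL gL u)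
    also have "\<dots> \<le> s * r" using g s by (simp add: nrm_scale)
    finally show "\<exists>g\<in>?N. nrm M (\<lambda>x. S (T f) x - g x) \<le> r * s"
      using g(1) h(1) by (force simp: mult.commute)
  qed (use r s in \<open>simp add: net_radius_def\<close>)
qed

lemma net_radius_less:
  assumes "net_radius M T r" "r \<le> s"
  shows "net_radius M T s"
  using assms unfolding net_radius_def by (meson order_trans)

lemma gamma_op_comp:
  assumes S: "blin M S" and T: "blin M T"
  shows "gamma_op M (\<lambda>f. S (T f)) \<le> gamma_op M S * gamma_op M T"
proof -
  have "gamma_op M (\<lambda>f. S (T f)) \<le> (gamma_op M S + e) * (gamma_op M T + e)" if e: "e > 0" for e
  proof -
    obtain r where r: "net_radius M S r" "r < gamma_op M S + e"
      using gamma_op_less_net[OF S, of "gamma_op M S + e"] e by auto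
    obtain s where s: "net_radius M T s" "s < gamma_op M T + e"
      using gamma_op_less_net[OF T, of "gamma_op M T + e"] e by auto
    \<comment> \<open>Enlarging the radii to \<open>gamma + e\<close> also gives the positive second
      radius that \<open>net_radius_comp\<close> divides by.\<close>
    have "net_radius M S (gamma_op M S + e)" "net_radius M T (gamma_op M T + e)"
      using r s by (auto intro: net_radius_less)
    moreover have "gamma_op M T + e > 0" using gamma_op_nonneg[OF T] e by simp
    ultimately show ?thesis by (intro gamma_op_le net_radius_comp S T)
  qed
  then have ev: "\<forall>\<^sub>F e in at_right 0. gamma_op M (\<lambda>f. S (T f)) \<le> (gamma_op M S + e) * (gamma_op M T + e)"
    by (simp add: eventually_at_filter)
  have "((\<lambda>e. (gamma_op M S + e) * (gamma_op M T + e)) \<longlongrightarrow> (gamma_op M S + 0) * (gamma_op M T + 0)) (at_right 0)"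
    by (intro tendsto_intros)
  from tendsto_lowerbound[OF this ev] show ?thesis by simp
qed

lemma gamma_op_id_le: "gamma_op M (\<lambda>f. f) \<le> 1"
  by (rule gamma_op_bound) auto

lemma gamma_op_zero [simp]: "gamma_op M (\<lambda>f x. 0) = 0"
  by (intro antisym gamma_op_nonneg gamma_op_bound) auto

lemma gamma_op_scale_le:
  assumes T: "blin M T"
  shows "gamma_op M (\<lambda>f x. c * T f x) \<le> cmod c * gamma_op M T"
proof -
  have "gamma_op M (\<lambda>f x. c * T f x) \<le> gamma_op M (\<lambda>f x. c * f x) * gamma_op M T"
    using gamma_op_comp[OF blin_scale[OF blin_id] T, of c] by simp
  also have "\<dots> \<le> cmod c * gamma_op M T"
    by (intro mult_right_mono gamma_op_bound gamma_op_nonneg[OF T]) (auto simp: nrm_scale)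
  finally show ?thesis .
qed

lemma gamma_op_minus:
  assumes T: "blin M T"
  shows "gamma_op M (\<lambda>f x. - T f x) = gamma_op M T"
  using gamma_op_scale_le[OF T, of "-1"] gamma_op_scale_le[OF blin_minus[OF T], of "-1"] by simp

lemma gamma_op_diff:
  assumes "blin M S" and T: "blin M T"
  shows "gamma_op M (\<lambda>f x. S f x - T f x) \<le> gamma_op M S + gamma_op M T"
  using gamma_op_add[OF assms(1) blin_minus[OF T]] gamma_op_minus[OF T] by simp

text \<open>This identifies the compact operators with the null space of the seminorm
  \<open>gamma_op\<close>, so the Calkin algebra can be handled through \<open>gamma_op\<close>
  alone.\<close>

lemma compact_op_iff: "compact_op M K \<longleftrightarrow> blin M K \<and> gamma_op M K = 0"
proof (intro iffI conjI)
  assume K: "compact_op M K"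
  then show b: "blin M K" by (simp add: compact_op_def)
  have "gamma_op M K \<le> 0"
  proof (rule gamma_op_leI[OF b])
    fix e :: real assume e: "e > 0"
    then obtain F where F: "finite F" "\<forall>g\<in>F. L2 M g"
      "\<forall>f. L2 M f \<and> nrm M f \<le> 1 \<longrightarrow> (\<exists>g\<in>F. nrm M (\<lambda>x. K f x - g x) < e)"
      using K unfolding compact_op_def by blast
    then have "\<forall>f. L2 M f \<and> nrm M f \<le> 1 \<longrightarrow> (\<exists>g\<in>F. nrm M (\<lambda>x. K f x - g x) \<le> e)"
      using less_imp_le by blast
    then have "net_radius M K e"
      unfolding net_radius_def using e F by auto
    then show "gamma_op M K \<le> 0 + e" using gamma_op_le by simp
  qed
  then show "gamma_op M K = 0" using gamma_op_nonneg[OF b] by simp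
next
  assume K: "blin M K \<and> gamma_op M K = 0"
  show "compact_op M K" unfolding compact_op_def
  proof (intro conjI allI impI)
    fix e :: real assume e: "e > 0"
    then obtain r where r: "net_radius M K r" "r < e"
      using gamma_op_less_net[of M K e] K by auto
    then show "\<exists>F. finite F \<and> (\<forall>g\<in>F. L2 M g) \<and> (\<forall>f. L2 M f \<and> nrm M f \<le> 1 \<longrightarrow> (\<exists>g\<in>F. nrm M (\<lambda>x. K f x - g x) < e))"
      unfolding net_radius_def by (meson le_less_trans)
  qed (use K in auto)
qed

subsection \<open>Gelfand's formula in a seminormed complex algebra\<close>

text \<open>Scalars enter through the central homomorphism \<open>S\<close>. The class \<^class>\<open>ring_1\<close> is
avoided because the Calkin algebra of a finite-dimensional space is the zero ring.\<close>

locale seminormed_algebra =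
  fixes S :: "complex \<Rightarrow> 'b::{ring,monoid_mult}" and p :: "'b \<Rightarrow> real"
  assumes S_add: "S (k + l) = S k + S l"
    and S_mult: "S (k * l) = S k * S l"
    and S_one: "S 1 = 1"
    and S_central: "x * S l = S l * x"
    and p_nonneg: "0 \<le> p x"
    and p_add: "p (x + y) \<le> p x + p y"
    and p_mult: "p (x * y) \<le> p x * p y"
    and p_one: "p 1 \<le> 1"
    and p_scale: "p (S l * x) \<le> cmod l * p x"
begin

lemma S_zero: "S 0 = 0"
  using S_add[of 0 0] by simp

lemma S_minus: "S (- l) = - S l"
  using S_add[of l "-l"] S_zero by (simp add: eq_neg_iff_add_eq_0 add.commute)

lemma S_diff: "S (k - l) = S k - S l"
  using S_add[of k "-l"] S_minus by simp

lemma S_sum: "S (\<Sum>i\<in>A. f i) = (\<Sum>i\<in>A. S (f i))"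
  by (induction A rule: infinite_finite_induct) (auto simp: S_zero S_add)

lemma S_left_commute: "x * (S l * y) = S l * (x * y)"
  by (metis S_central mult.assoc)

lemma S_inverse_cancel: "c \<noteq> 0 \<Longrightarrow> S (1 / c) * (S c * x) = x"
  by (simp add: S_one flip: mult.assoc S_mult)

lemma S_inverse_cancel': "c \<noteq> 0 \<Longrightarrow> S c * (S (1 / c) * x) = x"
  by (simp add: S_one flip: mult.assoc S_mult)

lemma p_zero: "p 0 = 0"
  using p_scale[of 0 0] p_nonneg[of 0] by (simp add: S_zero)

lemma p_minus: "p (- x) = p x"
proof -
  have "p (- x) \<le> p x" for x
    using p_scale[of "-1" x] by (simp add: S_minus S_one)
  from this[of x] this[of "-x"] show ?thesis by simp
qed

lemma p_diff: "p (x - y) \<le> p x + p y"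
  using p_add[of x "-y"] p_minus by simp

lemma p_le_diff: "p x \<le> p y + p (x - y)"
  using p_add[of y "x - y"] by simp

lemma p_sum: "p (\<Sum>i\<in>A. f i) \<le> (\<Sum>i\<in>A. p (f i))"
proof (induction A rule: infinite_finite_induct)
  case (insert x F)
  then show ?case using p_add[of "f x" "\<Sum>i\<in>F. f i"] by simp
qed (auto simp: p_zero)

text \<open>The cofactor of \<open>l - a\<close> in the factorisation of \<open>l^n - a^n\<close>.\<close>
definition cofac :: "complex \<Rightarrow> 'b \<Rightarrow> nat \<Rightarrow> 'b" where
  "cofac l a n = (\<Sum>i<n. S (l ^ (n - 1 - i)) * a ^ i)"

lemma cofac_Suc: "cofac l a (Suc n) = S (l ^ n) + a * cofac l a n"
proof -
  have "cofac l a (Suc n) = S (l ^ n) + (\<Sum>i<n. S (l ^ (n - 1 - i)) * a ^ Suc i)"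
    unfolding cofac_def by (subst sum.lessThan_Suc_shift) simp
  also have "(\<Sum>i<n. S (l ^ (n - 1 - i)) * a ^ Suc i) = a * cofac l a n"
    unfolding cofac_def by (simp add: sum_distrib_left S_left_commute)
  finally show ?thesis .
qed

lemma cofac_commute: "a * cofac l a n = cofac l a n * a"
  unfolding cofac_def
  by (simp add: sum_distrib_left sum_distrib_right S_left_commute mult.assoc power_commutes)

lemma cofac_left: "(S l - a) * cofac l a n = S (l ^ n) - a ^ n"
proof (induction n)
  case 0
  then show ?case by (simp add: cofac_def S_one)
next
  case (Suc n)
  have "(S l - a) * cofac l a (Suc n) = S l * S (l ^ n) - a * S (l ^ n) + (S l - a) * (a * cofac l a n)"
    by (simp add: cofac_Suc algebra_simps)
  also have "(S l - a) * (a * cofac l a n) = a * ((S l - a) * cofac l a n)"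
    by (simp add: left_diff_distrib right_diff_distrib S_left_commute)
  also have "\<dots> = a * S (l ^ n) - a * a ^ n" by (simp add: Suc right_diff_distrib)
  finally show ?case by (simp add: S_mult)
qed

lemma cofac_right: "cofac l a n * (S l - a) = S (l ^ n) - a ^ n"
  using cofac_left[of l a n]
  by (simp add: left_diff_distrib right_diff_distrib S_central cofac_commute)

text \<open>The cofactor times \<open>y\<close> is a right inverse of \<open>l - a\<close> and
  \<open>y\<close> times the cofactor a left inverse; a left and a right inverse always
  agree.\<close>

lemma invertible_power_diff:
  assumes "(S (l ^ n) - a ^ n) * y = 1" "y * (S (l ^ n) - a ^ n) = 1"
  shows "\<exists>r. (S l - a) * r = 1 \<and> r * (S l - a) = 1"
proof -
  have 1: "(S l - a) * (cofac l a n * y) = 1"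
    using assms(1) cofac_left by (simp flip: mult.assoc)
  have 2: "(y * cofac l a n) * (S l - a) = 1"
    using assms(2) cofac_right by (simp add: mult.assoc)
  have "y * cofac l a n = cofac l a n * y"
    using 1 2 by (metis mult.assoc mult.left_neutral mult.right_neutral)
  with 1 2 show ?thesis by metis
qed

lemma sum_roots_of_unity_power:
  assumes "0 < k" "k < n"
  shows "(\<Sum>j<n. (c * exp (2 * of_real pi * \<i> * of_nat j / of_nat n)) ^ k) = 0"
proof -
  let ?w = "exp (2 * of_real pi * \<i> * of_nat k / of_nat n)"
  have w: "?w \<noteq> 1"
    using complex_root_unity_eq_1[of n k] assms by (auto dest: dvd_imp_le)
  have wn: "?w ^ n = 1"
    using complex_root_unity[of n k] assms by simp
  have "(c * exp (2 * of_real pi * \<i> * of_nat j / of_nat n)) ^ k = c ^ k * ?w ^ j" for j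
    by (simp add: power_mult_distrib mult_ac flip: exp_of_nat_mult)
  then have "(\<Sum>j<n. (c * exp (2 * of_real pi * \<i> * of_nat j / of_nat n)) ^ k) = c ^ k * (\<Sum>j<n. ?w ^ j)"
    by (simp add: sum_distrib_left)
  also have "(\<Sum>j<n. ?w ^ j) = 0"
    using geometric_sum[OF w, of n] wn by simp
  finally show ?thesis by simp
qed

text \<open>Averaging \<open>l R(l)\<close> over the \<open>n\<close>-th roots of \<open>\<rho>^n\<close> gives \<open>\<rho>^n (\<rho>^n - a^n)^-1\<close>.\<close>
lemma resolvent_average:
  assumes n: "n > 0"
    and R: "\<And>j. j < n \<Longrightarrow> (S (z j) - a) * R (z j) = 1"
    and z: "\<And>j. z j = c * exp (2 * of_real pi * \<i> * of_nat j / of_nat n)"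
  shows "(S (c ^ n) - a ^ n) * (S (1 / of_nat n) * (\<Sum>j<n. S (z j) * R (z j))) = S (c ^ n)"
proof -
  have zn: "z j ^ n = c ^ n" for j
    using complex_root_unity[of n j] n by (simp add: z power_mult_distrib)
  have *: "(S (c ^ n) - a ^ n) * (S (z j) * R (z j)) = (\<Sum>i<n. S (z j ^ (n - i)) * a ^ i)" if j: "j < n" for j
  proof -
    have "(S (c ^ n) - a ^ n) * (S (z j) * R (z j)) = S (z j) * ((cofac (z j) a n * (S (z j) - a)) * R (z j))"
      by (simp add: cofac_right zn S_left_commute)
    also have "\<dots> = S (z j) * cofac (z j) a n"
      using R[OF j] by (simp add: mult.assoc)
    also have "\<dots> = (\<Sum>i<n. S (z j * z j ^ (n - 1 - i)) * a ^ i)"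
      by (simp add: cofac_def sum_distrib_left S_mult mult.assoc)
    also have "\<dots> = (\<Sum>i<n. S (z j ^ (n - i)) * a ^ i)"
    proof (rule sum.cong[OF refl])
      fix i assume "i \<in> {..<n}"
      then have "n - i = Suc (n - 1 - i)" by auto
      then show "S (z j * z j ^ (n - 1 - i)) * a ^ i = S (z j ^ (n - i)) * a ^ i" by simp
    qed
    finally show ?thesis .
  qed
  have "(S (c ^ n) - a ^ n) * (\<Sum>j<n. S (z j) * R (z j)) = (\<Sum>j<n. \<Sum>i<n. S (z j ^ (n - i)) * a ^ i)"
    using * by (simp add: sum_distrib_left)
  also have "\<dots> = (\<Sum>i<n. S (\<Sum>j<n. z j ^ (n - i)) * a ^ i)"
    by (subst sum.swap) (simp add: S_sum sum_distrib_right)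
  also have "\<dots> = (\<Sum>i<n. if i = 0 then S (of_nat n * c ^ n) else 0)"
  proof (rule sum.cong[OF refl])
    fix i assume i: "i \<in> {..<n}"
    show "S (\<Sum>j<n. z j ^ (n - i)) * a ^ i = (if i = 0 then S (of_nat n * c ^ n) else 0)"
    proof (cases "i = 0")
      case False
      then have "(\<Sum>j<n. z j ^ (n - i)) = 0"
        using sum_roots_of_unity_power[of "n - i" n c] i by (simp add: z)
      with False show ?thesis by (simp add: S_zero)
    qed (simp add: zn)
  qed
  also have "\<dots> = S (of_nat n) * S (c ^ n)"
    using n by (simp add: S_mult)
  finally have "S (1 / of_nat n) * ((S (c ^ n) - a ^ n) * (\<Sum>j<n. S (z j) * R (z j)))
      = S (1 / of_nat n) * (S (of_nat n) * S (c ^ n))" by simp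
  also have "\<dots> = S (c ^ n)"
    using n by (simp add: S_one flip: S_mult mult.assoc)
  finally show ?thesis by (simp only: S_left_commute)
qed

text \<open>The nontrivial half of the spectral radius formula, without holomorphic functions. Let
  \<open>U c n\<close> be the average of \<open>l R(l)\<close> over \<open>n\<close> equally spaced
  points of the circle of radius \<open>c\<close>. By \<open>resolvent_average\<close> it inverts
  \<open>1 - a^n / c^n\<close>. On a circle slightly larger than \<open>g\<close> it tends to 1,
  because \<open>a^n / c^n\<close> does to 0. Since \<open>l R(l)\<close> is Lipschitz, the average
  over a circle slightly smaller than \<open>g\<close> then stays within 1/2 of 1, so
  \<open>a^n\<close> grows at most like the smaller radius, against \<open>lo\<close>. The inverse
  of the inner average is explicit, so no Neumann series and no completeness enter.\<close>

theorem resolvent_set_power_bound: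
  assumes t: "0 < t" "t < g"
    and inv: "\<And>l. t \<le> cmod l \<Longrightarrow> \<exists>r. (S l - a) * r = 1 \<and> r * (S l - a) = 1"
    and lo: "\<And>n. n > 0 \<Longrightarrow> g ^ n \<le> p (a ^ n)"
    and hi: "\<And>u. u > g \<Longrightarrow> \<exists>C. \<forall>n>0. p (a ^ n) \<le> C * u ^ n"
  shows False
proof -
  define R where "R l = (SOME r. (S l - a) * r = 1 \<and> r * (S l - a) = 1)" for l
  have R: "(S l - a) * R l = 1" "R l * (S l - a) = 1" if "t \<le> cmod l" for l
    using someI_ex[OF inv[OF that]] by (auto simp: R_def)
  \<comment> \<open>A compact annulus that will contain both circles; compactness bounds the
    resolvent on it.\<close>
  define A where "A = {l :: complex. t \<le> cmod l \<and> cmod l \<le> g + 1}"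
  have res: "R l - R m = S (m - l) * (R l * R m)" if "l \<in> A" "m \<in> A" for l m
  proof -
    have "R l - R m = R l * ((S m - a) * R m) - (R l * (S l - a)) * R m"
      using R that by (simp add: A_def)
    also have "\<dots> = R l * (S (m - l) * R m)"
      by (simp add: S_diff algebra_simps)
    finally show ?thesis by (simp add: S_left_commute)
  qed
  have lip: "p (R l - R m) \<le> cmod (l - m) * (p (R l) * p (R m))" if "l \<in> A" "m \<in> A" for l m
  proof -
    have "p (R l - R m) \<le> cmod (m - l) * p (R l * R m)"
      using res[OF that] p_scale by simp
    also have "\<dots> \<le> cmod (m - l) * (p (R l) * p (R m))" by (intro mult_left_mono p_mult) auto
    finally show ?thesis by (simp add: norm_minus_commute)
  qed
  have cont: "continuous_on A (\<lambda>l. p (R l))"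
    unfolding continuous_on_iff
  proof (intro ballI allI impI)
    fix l e assume l: "l \<in> A" and e: "(0::real) < e"
    \<comment> \<open>The first entry forces \<open>p (R m) <= 2 * p (R l)\<close> through the
      resolvent identity; with that, the second entry makes the difference at most
      \<open>e / 2\<close>.\<close>
    define d where "d = min (1 / (2 * (p (R l) + 1))) (e / (4 * (p (R l) + 1)\<^sup>2))"
    have pp: "p (R l) + 1 > 0" using p_nonneg[of "R l"] by simp
    have d: "d > 0" using pp e by (simp add: d_def)
    show "\<exists>d>0. \<forall>x'\<in>A. dist x' l < d \<longrightarrow> dist (p (R x')) (p (R l)) < e"
    proof (intro exI[of _ d] conjI ballI impI d)
      fix m assume m: "m \<in> A" "dist m l < d"
      have dm: "cmod (l - m) * (p (R l) + 1) \<le> 1/2"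
      proof -
        have "cmod (l - m) \<le> 1 / (2 * (p (R l) + 1))"
          using m(2) by (simp add: d_def dist_norm norm_minus_commute)
        then show ?thesis using pp by (simp add: field_simps)
      qed
      have "cmod (l - m) * (p (R l) * p (R m)) \<le> (cmod (l - m) * (p (R l) + 1)) * p (R m)"
        by (simp add: algebra_simps p_nonneg)
      also have "\<dots> \<le> 1/2 * p (R m)" using dm by (intro mult_right_mono p_nonneg)
      finally have *: "cmod (l - m) * (p (R l) * p (R m)) \<le> 1/2 * p (R m)" .
      have "p (R m) \<le> p (R l) + p (R l - R m)"
        using p_le_diff[of "R m" "R l"] p_minus[of "R l - R m"] by simp
      then have m2: "p (R m) \<le> 2 * p (R l)" using lip[OF l m(1)] * by simp
      have "p (R l) \<le> p (R m) + p (R l - R m)" by (rule p_le_diff)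
      moreover have "p (R m) \<le> p (R l) + p (R l - R m)"
        using p_le_diff[of "R m" "R l"] p_minus[of "R l - R m"] by simp
      ultimately have "\<bar>p (R m) - p (R l)\<bar> \<le> p (R l - R m)" by simp
      also have "\<dots> \<le> cmod (l - m) * (p (R l) * p (R m))" by (rule lip[OF l m(1)])
      also have "\<dots> \<le> cmod (l - m) * ((p (R l) + 1) * (2 * (p (R l) + 1)))"
        using m2 p_nonneg[of "R l"] p_nonneg[of "R m"] by (intro mult_left_mono mult_mono) auto
      also have "\<dots> \<le> e / (4 * (p (R l) + 1)\<^sup>2) * ((p (R l) + 1) * (2 * (p (R l) + 1)))"
        using m(2) pp by (intro mult_right_mono) (auto simp: d_def dist_norm norm_minus_commute)
      also have "\<dots> = e / 2"
      proof -
        have "e / (4 * P\<^sup>2) * (P * (2 * P)) = e / 2" if "P > 0" for P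
          using that by (simp add: field_simps power2_eq_square)
        from this[OF pp] show ?thesis .
      qed
      finally show "dist (p (R m)) (p (R l)) < e" using e by (simp add: dist_real_def)
    qed
  qed
  have "compact A"
  proof -
    have "A = cball 0 (g + 1) - ball 0 t" by (auto simp: A_def)
    then show ?thesis by (simp add: compact_diff)
  qed
  then have "bounded ((\<lambda>l. p (R l)) ` A)"
    using compact_continuous_image[OF cont] compact_imp_bounded by blast
  then obtain B0 where B0: "\<And>x. x \<in> (\<lambda>l. p (R l)) ` A \<Longrightarrow> norm x \<le> B0"
    by (auto simp: bounded_iff)
  obtain B where B: "B > 0" "\<And>l. l \<in> A \<Longrightarrow> p (R l) \<le> B"
  proof (rule that[of "max B0 1"])
    fix l assume "l \<in> A"
    then have "norm (p (R l)) \<le> B0" by (intro B0 imageI)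
    then show "p (R l) \<le> max B0 1" by simp
  qed simp
  \<comment> \<open>A Lipschitz constant of \<open>l R(l)\<close> on the annulus: \<open>B\<close>
    from moving the factor \<open>l\<close>, and \<open>(g + 1) * (B * B)\<close> from moving
    \<open>R(l)\<close> by the resolvent identity.\<close>
  define K where "K = B + (g + 1) * (B * B)"
  have K: "K > 0" using B t by (simp add: K_def add_pos_pos)
  have lipw: "p (S l * R l - S m * R m) \<le> K * cmod (l - m)" if l: "l \<in> A" and m: "m \<in> A" for l m
  proof -
    have "S l * R l - S m * R m = S (l - m) * R l + S m * (R l - R m)"
      by (simp add: S_diff algebra_simps)
    then have "p (S l * R l - S m * R m) \<le> p (S (l - m) * R l) + p (S m * (R l - R m))"
      using p_add by simp
    also have "\<dots> \<le> cmod (l - m) * p (R l) + cmod m * p (R l - R m)"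
      by (intro add_mono p_scale)
    also have "\<dots> \<le> cmod (l - m) * B + (g + 1) * (cmod (l - m) * (B * B))"
    proof (intro add_mono mult_left_mono mult_mono)
      show "p (R l - R m) \<le> cmod (l - m) * (B * B)"
        by (rule order_trans[OF lip[OF l m]])
           (use B l m p_nonneg in \<open>intro mult_left_mono mult_mono; force\<close>)
    qed (use B l m t p_nonneg in \<open>auto simp: A_def\<close>)
    finally show ?thesis by (simp add: K_def algebra_simps)
  qed
  \<comment> \<open>The entries 1 and \<open>g - t\<close> keep both circles inside the annulus;
    \<open>1 / (8 * K)\<close> makes the averages over them differ by at most 1/4, the circles being
    \<open>2 * \<eta>\<close> apart.\<close>
  define \<eta> where "\<eta> = Min {1, g - t, 1 / (8 * K)}"
  have eta: "\<eta> > 0" "\<eta> \<le> 1" "\<eta> \<le> g - t" "\<eta> \<le> 1 / (8 * K)"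
    using t K by (auto simp: \<eta>_def)
  have etaK: "2 * \<eta> * K \<le> 1/4" using eta(4) K by (simp add: field_simps)
  define z where "z c n j = complex_of_real c * exp (2 * of_real pi * \<i> * of_nat j / of_nat n)"
    for c :: real and n j :: nat
  define U where "U c n = S (1 / of_nat n) * (\<Sum>j<n. S (z c n j) * R (z c n j))" for c n
  have norm_z: "cmod (z c n j) = \<bar>c\<bar>" for c n j
    by (simp add: z_def norm_mult)
  have zA: "z c n j \<in> A" if "g - \<eta> \<le> c" "c \<le> g + \<eta>" for c n j
    using that eta t by (simp add: A_def norm_z)
  have U: "(S (complex_of_real c ^ n) - a ^ n) * U c n = S (complex_of_real c ^ n)"
    if "n > 0" "g - \<eta> \<le> c" "c \<le> g + \<eta>" for c n
    unfolding U_def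
    using zA[OF that(2,3)] by (intro resolvent_average that(1) R) (auto simp: A_def z_def)
  have avg: "p (S (1 / of_nat n) * (\<Sum>j<n. f j)) \<le> c" if "n > 0" "\<And>j. j < n \<Longrightarrow> p (f j) \<le> c" for f c and n :: nat
  proof -
    have "p (S (1 / of_nat n) * (\<Sum>j<n. f j)) \<le> cmod (1 / of_nat n) * p (\<Sum>j<n. f j)" by (rule p_scale)
    also have "\<dots> \<le> cmod (1 / of_nat n) * (\<Sum>j<n. c)"
      by (intro mult_left_mono order_trans[OF p_sum] sum_mono that(2)) auto
    also have "\<dots> = c" using that(1) by (simp add: norm_divide)
    finally show ?thesis .
  qed
  let ?hi = "g + \<eta>" and ?lo = "g - \<eta>"
  have Udiff: "p (U ?lo n - U ?hi n) \<le> 1/4" if n: "n > 0" for n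
  proof -
    have "U ?lo n - U ?hi n = S (1 / of_nat n) * (\<Sum>j<n. S (z ?lo n j) * R (z ?lo n j) - S (z ?hi n j) * R (z ?hi n j))"
      by (simp add: U_def sum_subtractf right_diff_distrib)
    moreover have "p (S (z ?lo n j) * R (z ?lo n j) - S (z ?hi n j) * R (z ?hi n j)) \<le> 1/4" for j
    proof -
      \<comment> \<open>\<open>z\<close> is linear in its radius, and \<open>norm_z\<close> admits
        the negative radius \<open>- 2 * \<eta>\<close>.\<close>
      have "z ?lo n j - z ?hi n j = z (- 2 * \<eta>) n j" by (simp add: z_def algebra_simps)
      then have "cmod (z ?lo n j - z ?hi n j) = 2 * \<eta>" using eta by (simp add: norm_z)
      then show ?thesis
        using lipw[OF zA[of ?lo n j] zA[of ?hi n j]] eta etaK by (simp add: mult_ac)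
    qed
    ultimately show ?thesis using avg[OF n, of _ "1/4"] by simp
  qed
  have Uhi: "p (U ?hi n) \<le> (g + 1) * B" if n: "n > 0" for n
    unfolding U_def
  proof (intro avg[OF n])
    fix j
    have "p (S (z ?hi n j) * R (z ?hi n j)) \<le> cmod (z ?hi n j) * p (R (z ?hi n j))" by (rule p_scale)
    also have "\<dots> \<le> (g + 1) * B"
      using eta t B zA[of ?hi n j] p_nonneg by (intro mult_mono) (auto simp: norm_z)
    finally show "p (S (z ?hi n j) * R (z ?hi n j)) \<le> (g + 1) * B" .
  qed
  \<comment> \<open>A rate strictly between \<open>g\<close> and the outer radius, so that
    \<open>a^n\<close> divided by the outer radius to the \<open>n\<close> decays like
    \<open>q ^ n\<close>.\<close>
  obtain C0 where C0: "\<And>n. n > 0 \<Longrightarrow> p (a ^ n) \<le> C0 * (g + \<eta>/2) ^ n"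
    using hi[of "g + \<eta>/2"] eta by auto
  define q where "q = (g + \<eta>/2) / (g + \<eta>)"
  have q: "0 < q" "q < 1" using eta t by (auto simp: q_def)
  have Uone: "p (U ?hi n - 1) \<le> C0 * ((g + 1) * B) * q ^ n" if n: "n > 0" for n
  proof -
    let ?c = "complex_of_real ?hi ^ n"
    have c0: "?c \<noteq> 0" using eta t by (simp flip: of_real_add)
    \<comment> \<open>Rewriting the inverse relation as \<open>U - 1 = c^-n a^n U\<close> reduces
      the distance to 1 to the decay of \<open>a^n / c^n\<close>.\<close>
    have "S ?c * (U ?hi n - 1) = a ^ n * U ?hi n"
    proof -
      have "S ?c * U ?hi n - a ^ n * U ?hi n = S ?c"
        using U[OF n, of ?hi] eta by (simp only: left_diff_distrib)
      then have "S ?c * U ?hi n = S ?c + a ^ n * U ?hi n"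
        by (simp only: diff_eq_eq)
      then show ?thesis by (simp only: right_diff_distrib mult_1_right add_diff_cancel_left')
    qed
    then have "S (1 / ?c) * (S ?c * (U ?hi n - 1)) = S (1 / ?c) * (a ^ n * U ?hi n)" by simp
    then have "U ?hi n - 1 = S (1 / ?c) * (a ^ n * U ?hi n)"
      by (simp only: S_inverse_cancel[OF c0])
    then have "p (U ?hi n - 1) \<le> cmod (1 / ?c) * p (a ^ n * U ?hi n)"
      using p_scale by simp
    also have "\<dots> \<le> cmod (1 / ?c) * (C0 * (g + \<eta>/2) ^ n * ((g + 1) * B))"
    proof (intro mult_left_mono order_trans[OF p_mult] mult_mono C0 Uhi n)
      show "0 \<le> C0 * (g + \<eta> / 2) ^ n" using C0[OF n] p_nonneg[of "a ^ n"] by linarith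
    qed (use p_nonneg in auto)
    also have "cmod (1 / ?c) = 1 / ?hi ^ n"
      using eta t by (simp add: norm_divide norm_power flip: of_real_add)
    finally show ?thesis by (simp add: q_def power_divide mult_ac)
  qed
  have "(\<lambda>n. C0 * ((g + 1) * B) * q ^ n) \<longlonglongrightarrow> C0 * ((g + 1) * B) * 0"
    using q by (intro tendsto_intros LIMSEQ_realpow_zero) auto
  then have "\<forall>\<^sub>F n in sequentially. C0 * ((g + 1) * B) * q ^ n < 1/4"
    by (rule order_tendstoD) simp
  moreover have "(\<lambda>n. 3 * (?lo / g) ^ n) \<longlonglongrightarrow> 3 * 0"
    using eta t by (intro tendsto_intros LIMSEQ_realpow_zero) auto
  then have "\<forall>\<^sub>F n in sequentially. 3 * (?lo / g) ^ n < 1"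
    by (rule order_tendstoD) simp
  ultimately have "\<forall>\<^sub>F n in sequentially. n > 0 \<and> C0 * ((g + 1) * B) * q ^ n < 1/4 \<and> 3 * (?lo / g) ^ n < 1"
    using eventually_gt_at_top[of 0] by eventually_elim simp
  then obtain n where n: "n > 0" "C0 * ((g + 1) * B) * q ^ n < 1/4" "3 * (?lo / g) ^ n < 1"
    by (metis (mono_tags, lifting) eventually_happens sequentially_bot)
  let ?c = "complex_of_real ?lo ^ n"
  have lo0: "?lo > 0" using eta t by simp
  have c0: "?c \<noteq> 0" using lo0 by (simp flip: of_real_diff)
  have u: "p (U ?lo n - 1) \<le> 1/2"
    using p_add[of "U ?lo n - U ?hi n" "U ?hi n - 1"] Udiff[OF n(1)] Uone[OF n(1)] n(2) by simp
  define v where "v = 1 - S (1 / ?c) * a ^ n"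
  have "v * U ?lo n = S (1 / ?c) * ((S ?c - a ^ n) * U ?lo n)"
    using S_inverse_cancel[OF c0, of "U ?lo n"]
    by (simp only: v_def left_diff_distrib right_diff_distrib mult_1_left mult.assoc)
  also have "\<dots> = S (1 / ?c) * S ?c"
    using U[OF n(1), of ?lo] eta by simp
  also have "\<dots> = 1"
    using S_inverse_cancel[OF c0, of 1] by simp
  finally have vu: "v * U ?lo n = 1" .
  \<comment> \<open>A bound for the inverse of an element within 1/2 of 1: this identity gives
    \<open>p v <= 1 + p v / 2\<close>, hence \<open>p v <= 2\<close>.\<close>
  have "v = 1 - v * (U ?lo n - 1)" using vu by (simp add: right_diff_distrib)
  then have "p v \<le> p 1 + p (v * (U ?lo n - 1))" using p_diff by metis
  also have "\<dots> \<le> 1 + p v * (1/2)"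
    using u p_nonneg by (intro add_mono p_one order_trans[OF p_mult] mult_left_mono)
  finally have v2: "p v \<le> 2" by simp
  have "S ?c * (1 - v) = a ^ n"
    using S_inverse_cancel'[OF c0, of "a ^ n"] by (simp only: v_def diff_diff_eq2 add_diff_cancel_left')
  then have "p (a ^ n) \<le> cmod ?c * p (1 - v)" using p_scale by metis
  also have "\<dots> \<le> cmod ?c * 3"
    using p_diff[of 1 v] p_one v2 by (intro mult_left_mono) auto
  also have "cmod ?c = ?lo ^ n" using lo0 by (simp add: norm_power flip: of_real_diff)
  finally have "g ^ n \<le> 3 * ?lo ^ n" using lo[OF n(1)] by simp
  moreover have "3 * ?lo ^ n < g ^ n" using n(3) t by (simp add: power_divide field_simps)
  ultimately show False by simp
qed

end

subsection \<open>The Calkin algebra\<close>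

text \<open>Boundedness of both sides is part of the relation, so it is reflexive exactly on bounded
  operators; hence the partial quotient below.\<close>

definition calkin_eq :: "'a measure \<Rightarrow> 'a op \<Rightarrow> 'a op \<Rightarrow> bool" where
  "calkin_eq M S T \<longleftrightarrow> blin M S \<and> blin M T \<and> gamma_op M (\<lambda>f x. S f x - T f x) = 0"

lemma calkin_eqI:
  assumes "blin M S" "blin M T" "gamma_op M (\<lambda>f x. S f x - T f x) \<le> 0"
  shows "calkin_eq M S T"
  using assms gamma_op_nonneg[OF blin_diff[OF assms(1,2)]] by (simp add: calkin_eq_def)

lemma calkin_eq_AE:
  assumes "blin M S" "blin M T" "\<And>f. L2 M f \<Longrightarrow> AE x in M. S f x = T f x"
  shows "calkin_eq M S T"
proof (rule calkin_eqI[OF assms(1,2)])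
  have "gamma_op M (\<lambda>f x. S f x - T f x) = gamma_op M (\<lambda>f x. 0)"
    by (intro gamma_op_cong blin_diff assms blin_zero) (use assms(3) in auto)
  then show "gamma_op M (\<lambda>f x. S f x - T f x) \<le> 0" by simp
qed

lemma calkin_eq_refl: "blin M T \<Longrightarrow> calkin_eq M T T"
  by (rule calkin_eq_AE) auto

lemma calkin_eq_sym: "calkin_eq M S T \<Longrightarrow> calkin_eq M T S"
  unfolding calkin_eq_def using gamma_op_minus[OF blin_diff[of M S T]] by auto

lemma calkin_eq_trans:
  assumes "calkin_eq M S T" "calkin_eq M T U"
  shows "calkin_eq M S U"
proof (rule calkin_eqI)
  have "gamma_op M (\<lambda>f x. S f x - U f x) = gamma_op M (\<lambda>f x. (S f x - T f x) + (T f x - U f x))"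
    by (rule arg_cong[where f = "gamma_op M"]) (auto)
  also have "\<dots> \<le> gamma_op M (\<lambda>f x. S f x - T f x) + gamma_op M (\<lambda>f x. T f x - U f x)"
    by (intro gamma_op_add blin_diff) (use assms in \<open>auto simp: calkin_eq_def\<close>)
  finally show "gamma_op M (\<lambda>f x. S f x - U f x) \<le> 0" using assms by (simp add: calkin_eq_def)
qed (use assms in \<open>auto simp: calkin_eq_def\<close>)

lemma calkin_eq_gamma:
  assumes "calkin_eq M S T"
  shows "gamma_op M S = gamma_op M T"
proof -
  have "gamma_op M S \<le> gamma_op M T" if "calkin_eq M S T" for S T
  proof -
    have "S = (\<lambda>f x. T f x + (S f x - T f x))" by auto
    then have "gamma_op M S \<le> gamma_op M T + gamma_op M (\<lambda>f x. S f x - T f x)"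
      using gamma_op_add[of M T "\<lambda>f x. S f x - T f x"] that by (simp add: calkin_eq_def blin_diff)
    then show ?thesis using that by (simp add: calkin_eq_def)
  qed
  with assms calkin_eq_sym[OF assms] show ?thesis by (intro antisym)
qed

lemma calkin_eq_add:
  assumes "calkin_eq M S S'" "calkin_eq M T T'"
  shows "calkin_eq M (\<lambda>f x. S f x + T f x) (\<lambda>f x. S' f x + T' f x)"
proof (rule calkin_eqI)
  have "gamma_op M (\<lambda>f x. (S f x + T f x) - (S' f x + T' f x)) = gamma_op M (\<lambda>f x. (S f x - S' f x) + (T f x - T' f x))"
    by (rule arg_cong[where f = "gamma_op M"]) (auto simp: fun_eq_iff)
  also have "\<dots> \<le> gamma_op M (\<lambda>f x. S f x - S' f x) + gamma_op M (\<lambda>f x. T f x - T' f x)"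
    by (intro gamma_op_add blin_diff) (use assms in \<open>auto simp: calkin_eq_def\<close>)
  finally show "gamma_op M (\<lambda>f x. (S f x + T f x) - (S' f x + T' f x)) \<le> 0" using assms by (simp add: calkin_eq_def)
qed (use assms in \<open>auto simp: calkin_eq_def intro: blin_add\<close>)

lemma calkin_eq_scale:
  assumes "calkin_eq M S T"
  shows "calkin_eq M (\<lambda>f x. c * S f x) (\<lambda>f x. c * T f x)"
proof (rule calkin_eqI)
  have "gamma_op M (\<lambda>f x. c * S f x - c * T f x) = gamma_op M (\<lambda>f x. c * (S f x - T f x))"
    by (rule arg_cong[where f = "gamma_op M"]) (auto simp: algebra_simps)
  also have "\<dots> \<le> cmod c * gamma_op M (\<lambda>f x. S f x - T f x)"
    by (intro gamma_op_scale_le blin_diff) (use assms in \<open>auto simp: calkin_eq_def\<close>)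
  finally show "gamma_op M (\<lambda>f x. c * S f x - c * T f x) \<le> 0" using assms by (simp add: calkin_eq_def)
qed (use assms in \<open>auto simp: calkin_eq_def intro: blin_scale\<close>)

lemma calkin_eq_minus: "calkin_eq M S T \<Longrightarrow> calkin_eq M (\<lambda>f x. - S f x) (\<lambda>f x. - T f x)"
  using calkin_eq_scale[of M S T "-1"] by simp

lemma calkin_eq_diff:
  "calkin_eq M S S' \<Longrightarrow> calkin_eq M T T' \<Longrightarrow>
    calkin_eq M (\<lambda>f x. S f x - T f x) (\<lambda>f x. S' f x - T' f x)"
  using calkin_eq_add[of M S S' "\<lambda>f x. - T f x" "\<lambda>f x. - T' f x"] calkin_eq_minus[of M T T'] by simp

text \<open>Compact operators form a two-sided ideal, by submultiplicativity of
  \<open>gamma_op\<close>; one factor is exchanged at a time. Moving \<open>S\<close> past the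
  difference holds only almost everywhere.\<close>

lemma calkin_eq_comp:
  assumes S: "calkin_eq M S S'" and T: "calkin_eq M T T'"
  shows "calkin_eq M (\<lambda>f. S (T f)) (\<lambda>f. S' (T' f))"
proof (rule calkin_eq_trans)
  have b: "blin M S" "blin M S'" "blin M T" "blin M T'" using assms by (auto simp: calkin_eq_def)
  show "calkin_eq M (\<lambda>f. S (T f)) (\<lambda>f. S (T' f))"
  proof (rule calkin_eqI)
    have "gamma_op M (\<lambda>f x. S (T f) x - S (T' f) x) = gamma_op M (\<lambda>f. S (\<lambda>x. T f x - T' f x))"
    proof (rule gamma_op_cong[OF blin_diff[OF blin_comp[OF b(1,3)] blin_comp[OF b(1,4)]]])
      show "blin M (\<lambda>f. S (\<lambda>x. T f x - T' f x))"
        using blin_comp[OF b(1) blin_diff[OF b(3,4)]] .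
      show "AE x in M. S (T f) x - S (T' f) x = S (\<lambda>x. T f x - T' f x) x" if "L2 M f" for f
        using blin_diff_arg[OF b(1) blin_L2[OF b(3) that] blin_L2[OF b(4) that]]
        by eventually_elim simp
    qed
    also have "\<dots> \<le> gamma_op M S * gamma_op M (\<lambda>f x. T f x - T' f x)"
      by (intro gamma_op_comp[OF b(1) blin_diff[OF b(3,4)]])
    also have "\<dots> = 0" using T by (simp add: calkin_eq_def)
    finally show "gamma_op M (\<lambda>f x. S (T f) x - S (T' f) x) \<le> 0" .
  qed (rule blin_comp[OF b(1,3)] blin_comp[OF b(1,4)])+
  show "calkin_eq M (\<lambda>f. S (T' f)) (\<lambda>f. S' (T' f))"
  proof (rule calkin_eqI)
    have "gamma_op M (\<lambda>f x. S (T' f) x - S' (T' f) x) \<le> gamma_op M (\<lambda>f x. S f x - S' f x) * gamma_op M T'"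
      using gamma_op_comp[OF blin_diff[OF b(1,2)] b(4)] .
    also have "\<dots> = 0" using S by (simp add: calkin_eq_def)
    finally show "gamma_op M (\<lambda>f x. S (T' f) x - S' (T' f) x) \<le> 0" .
  qed (rule blin_comp[OF b(1,4)] blin_comp[OF b(2,4)])+
qed

text \<open>A type cannot depend on the measure \<open>M\<close>, so the type below is the product of the Calkin
algebras over all measures on \<open>'a\<close>; single operators are embedded by padding with zeros.\<close>

definition calkin_rel :: "('a measure \<Rightarrow> 'a op) \<Rightarrow> ('a measure \<Rightarrow> 'a op) \<Rightarrow> bool" where
  "calkin_rel S T \<longleftrightarrow> (\<forall>M. calkin_eq M (S M) (T M))"

quotient_type 'a calkin = "'a measure \<Rightarrow> 'a op" / partial: calkin_rel
proof (rule part_equivpI)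
  show "\<exists>S::'a measure \<Rightarrow> 'a op. calkin_rel S S"
    by (intro exI[of _ "\<lambda>M f. f"]) (simp add: calkin_rel_def calkin_eq_refl)
  show "symp (calkin_rel :: ('a measure \<Rightarrow> 'a op) \<Rightarrow> _)"
    by (intro sympI) (auto simp: calkin_rel_def intro: calkin_eq_sym)
  show "transp (calkin_rel :: ('a measure \<Rightarrow> 'a op) \<Rightarrow> _)"
    by (intro transpI) (meson calkin_rel_def calkin_eq_trans)
qed

text \<open>The coordinate at \<open>M\<close> as a relation to its representatives, so that no
  representative has to be chosen.\<close>

lift_definition calkin_at :: "'a measure \<Rightarrow> 'a calkin \<Rightarrow> 'a op \<Rightarrow> bool"
  is "\<lambda>M S T. calkin_eq M (S M) T"
  unfolding calkin_rel_def using calkin_eq_sym calkin_eq_trans by blast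

lift_definition calkin_norm :: "'a measure \<Rightarrow> 'a calkin \<Rightarrow> real"
  is "\<lambda>M S. gamma_op M (S M)"
  unfolding calkin_rel_def using calkin_eq_gamma by blast

lift_definition calkin_scalar :: "complex \<Rightarrow> 'a calkin"
  is "\<lambda>l M f x. l * f x"
  unfolding calkin_rel_def by (intro allI calkin_eq_refl blin_scale blin_id)

instantiation calkin :: (type) "{ring, monoid_mult}"
begin

lift_definition zero_calkin :: "'a calkin" is "\<lambda>M f x. 0"
  unfolding calkin_rel_def by (intro allI calkin_eq_refl blin_zero)

lift_definition one_calkin :: "'a calkin" is "\<lambda>M f. f"
  unfolding calkin_rel_def by (intro allI calkin_eq_refl blin_id)

lift_definition plus_calkin :: "'a calkin \<Rightarrow> 'a calkin \<Rightarrow> 'a calkin"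
  is "\<lambda>S T M f x. S M f x + T M f x"
  unfolding calkin_rel_def by (blast intro: calkin_eq_add)

lift_definition minus_calkin :: "'a calkin \<Rightarrow> 'a calkin \<Rightarrow> 'a calkin"
  is "\<lambda>S T M f x. S M f x - T M f x"
  unfolding calkin_rel_def by (blast intro: calkin_eq_diff)

lift_definition uminus_calkin :: "'a calkin \<Rightarrow> 'a calkin"
  is "\<lambda>T M f x. - T M f x"
  unfolding calkin_rel_def by (blast intro: calkin_eq_minus)

lift_definition times_calkin :: "'a calkin \<Rightarrow> 'a calkin \<Rightarrow> 'a calkin"
  is "\<lambda>S T M f. S M (T M f)"
  unfolding calkin_rel_def by (blast intro: calkin_eq_comp)

lemma calkin_rel_blin: "calkin_rel S T \<Longrightarrow> blin M (S M)" "calkin_rel S T \<Longrightarrow> blin M (T M)"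
  by (auto simp: calkin_rel_def calkin_eq_def)

lemma calkin_rel_AE:
  assumes "\<And>M. blin M (S M)" "\<And>M. blin M (T M)" "\<And>M f. L2 M f \<Longrightarrow> AE x in M. S M f x = T M f x"
  shows "calkin_rel S T"
  unfolding calkin_rel_def by (intro allI calkin_eq_AE assms)

instance
proof
  fix a b c :: "'a calkin"
  show "a * b * c = a * (b * c)"
  proof transfer
    fix a b c :: "'a measure \<Rightarrow> 'a op"
    assume *: "calkin_rel a a" "calkin_rel b b" "calkin_rel c c"
    have "calkin_eq M (\<lambda>f. a M (b M (c M f))) (\<lambda>f. a M (b M (c M f)))" for M
      using calkin_eq_comp[of M "a M" "a M", OF _ calkin_eq_comp[of M "b M" "b M" "c M" "c M"]] *
      by (simp add: calkin_rel_def)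
    then show "calkin_rel (\<lambda>M f. a M (b M (c M f))) (\<lambda>M f. a M (b M (c M f)))"
      by (simp add: calkin_rel_def)
  qed
  show "1 * a = a" "a * 1 = a"
    by (transfer, simp)+
  show "a + b + c = a + (b + c)"
  proof transfer
    fix a b c :: "'a measure \<Rightarrow> 'a op"
    assume *: "calkin_rel a a" "calkin_rel b b" "calkin_rel c c"
    have "calkin_eq M (\<lambda>f x. a M f x + (b M f x + c M f x)) (\<lambda>f x. a M f x + (b M f x + c M f x))" for M
      using calkin_eq_add[of M "a M" "a M", OF _ calkin_eq_add[of M "b M" "b M" "c M" "c M"]] *
      by (simp add: calkin_rel_def)
    then show "calkin_rel (\<lambda>M f x. a M f x + b M f x + c M f x) (\<lambda>M f x. a M f x + (b M f x + c M f x))"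
      by (simp add: calkin_rel_def add.assoc)
  qed
  show "a + b = b + a"
    by transfer (auto simp: calkin_rel_def add.commute intro: calkin_eq_add)
  show "0 + a = a"
    by transfer simp
  show "- a + a = 0"
    by transfer (auto simp: calkin_rel_def intro: calkin_eq_refl)
  show "a - b = a + - b"
    by transfer (auto simp: calkin_rel_def intro: calkin_eq_diff)
  show "(a + b) * c = a * c + b * c"
  proof transfer
    fix a b c :: "'a measure \<Rightarrow> 'a op"
    assume *: "calkin_rel a a" "calkin_rel b b" "calkin_rel c c"
    have "calkin_eq M (\<lambda>f x. a M (c M f) x + b M (c M f) x) (\<lambda>f x. a M (c M f) x + b M (c M f) x)" for M
      using calkin_eq_add[OF calkin_eq_comp[of M "a M" "a M" "c M" "c M"] calkin_eq_comp[of M "b M" "b M" "c M" "c M"]] *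
      by (simp add: calkin_rel_def)
    then show "calkin_rel (\<lambda>M f x. a M (c M f) x + b M (c M f) x) (\<lambda>M f x. a M (c M f) x + b M (c M f) x)"
      by (simp add: calkin_rel_def)
  qed
  show "a * (b + c) = a * b + a * c"
  proof (transfer, intro calkin_rel_AE)
    fix a b c :: "'a measure \<Rightarrow> 'a op" and M f
    assume *: "calkin_rel a a" "calkin_rel b b" "calkin_rel c c"
    then have bl: "blin M (a M)" "blin M (b M)" "blin M (c M)" by (auto dest: calkin_rel_blin)
    show "blin M (\<lambda>f. a M (\<lambda>x. b M f x + c M f x))"
      using blin_comp[OF bl(1) blin_add[OF bl(2,3)]] .
    show "blin M (\<lambda>f x. a M (b M f) x + a M (c M f) x)"
      using blin_add[OF blin_comp[OF bl(1,2)] blin_comp[OF bl(1,3)]] .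
    show "AE x in M. a M (\<lambda>x. b M f x + c M f x) x = a M (b M f) x + a M (c M f) x" if "L2 M f"
      by (intro blin_add_arg bl blin_L2[OF bl(2)] blin_L2[OF bl(3)] that)
  qed
qed

end

lemma calkin_at_ex: "\<exists>T. calkin_at M x T"
  by transfer (auto simp: calkin_rel_def)

lemma calkin_at_blin: "calkin_at M x T \<Longrightarrow> blin M T"
  by transfer (simp add: calkin_eq_def)

lemma calkin_at_unique: "calkin_at M x S \<Longrightarrow> calkin_at M x T \<Longrightarrow> calkin_eq M S T"
  by transfer (rule calkin_eq_trans[OF calkin_eq_sym])

lemma calkin_at_mult: "calkin_at M x S \<Longrightarrow> calkin_at M y T \<Longrightarrow> calkin_at M (x * y) (\<lambda>f. S (T f))"
  by transfer (rule calkin_eq_comp)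

lemma calkin_at_diff: "calkin_at M x S \<Longrightarrow> calkin_at M y T \<Longrightarrow> calkin_at M (x - y) (\<lambda>f x. S f x - T f x)"
  by transfer (rule calkin_eq_diff)

lemma calkin_at_one: "calkin_at M 1 (\<lambda>f. f)"
  by transfer (simp add: calkin_eq_refl)

lemma calkin_at_scalar: "calkin_at M (calkin_scalar l) (\<lambda>f x. l * f x)"
  by transfer (intro calkin_eq_refl blin_scale blin_id)

lemma calkin_at_power: "calkin_at M x T \<Longrightarrow> calkin_at M (x ^ n) (T ^^ n)"
proof (induction n)
  case (Suc n)
  then show ?case using calkin_at_mult[of M x T "x ^ n" "T ^^ n"] by (simp add: o_def)
qed (simp add: calkin_at_one id_def)

lemma calkin_norm_at: "calkin_at M x T \<Longrightarrow> calkin_norm M x = gamma_op M T"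
  by transfer (rule calkin_eq_gamma)

lemma calkin_eqI_at:
  assumes x: "\<And>M. calkin_at M x (F M)" and y: "\<And>M. calkin_at M y (G M)"
    and eq: "\<And>M. calkin_eq M (F M) (G M)"
  shows "x = y"
  using x y
proof (transfer fixing: F G)
  fix x y :: "'a measure \<Rightarrow> 'a op"
  assume *: "\<And>M. calkin_eq M (x M) (F M)" "\<And>M. calkin_eq M (y M) (G M)"
  show "calkin_rel x y" unfolding calkin_rel_def
    by (rule allI) (rule calkin_eq_trans[OF *(1) calkin_eq_trans[OF eq calkin_eq_sym[OF *(2)]]])
qed

text \<open>The seminorm reads only the coordinate at \<open>M\<close>, whereas invertibility is an
  identity in every coordinate; therefore lifts of a single operator have to be invertible at the
  other measures too.\<close>

interpretation calkin: seminormed_algebra calkin_scalar "calkin_norm M" for M :: "'a measure"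
proof
  fix k l :: complex and x y :: "'a calkin"
  show "calkin_scalar (k + l) = calkin_scalar k + (calkin_scalar l :: 'a calkin)"
    by transfer (intro calkin_rel_AE blin_add blin_scale blin_id AE_I2 distrib_right)
  show "calkin_scalar (k * l) = calkin_scalar k * (calkin_scalar l :: 'a calkin)"
    by transfer (intro calkin_rel_AE blin_scale blin_id AE_I2 mult.assoc)
  show "calkin_scalar 1 = (1 :: 'a calkin)"
    by transfer (intro calkin_rel_AE; auto)
  show "x * calkin_scalar l = calkin_scalar l * x"
  proof (transfer, intro calkin_rel_AE)
    fix l and x :: "'a measure \<Rightarrow> 'a op" and M f
    assume "calkin_rel x x"
    then have bl: "blin M (x M)" by (auto dest: calkin_rel_blin)
    show "blin M (\<lambda>f. x M (\<lambda>x. l * f x))"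
      using blin_comp[OF bl blin_scale[OF blin_id]] .
    show "blin M (\<lambda>f xa. l * x M f xa)"
      by (intro blin_scale bl)
    show "AE xa in M. x M (\<lambda>x. l * f x) xa = l * x M f xa" if "L2 M f"
      by (intro blin_scale_arg bl that)
  qed
  show "0 \<le> calkin_norm M x"
    by transfer (auto intro: gamma_op_nonneg dest: calkin_rel_blin)
  show "calkin_norm M (x + y) \<le> calkin_norm M x + calkin_norm M y"
    by transfer (auto intro: gamma_op_add dest: calkin_rel_blin)
  show "calkin_norm M (x * y) \<le> calkin_norm M x * calkin_norm M y"
    by transfer (auto intro: gamma_op_comp dest: calkin_rel_blin)
  show "calkin_norm M (1::'a calkin) \<le> 1"
    by transfer (rule gamma_op_id_le)
  show "calkin_norm M (calkin_scalar l * x) \<le> cmod l * calkin_norm M x"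
    by transfer (auto intro: gamma_op_scale_le dest: calkin_rel_blin)
qed

lemma blin_power: "blin M T \<Longrightarrow> blin M (T ^^ n)"
proof (induction n)
  case (Suc n)
  then show ?case using blin_comp[of M T "T ^^ n"] by (simp add: o_def)
qed (simp add: id_def)

lemma calkin_abs:
  assumes "\<And>N. blin N (F N)"
  shows "calkin_at N (abs_calkin F) (F N)"
  using assms by (simp add: calkin_at.abs_eq calkin_rel_def calkin_eq_refl)

text \<open>At the other measures the operator is \<open>0\<close>, where \<open>l \<noteq> 0\<close> is invertible.\<close>
lemma calkin_inverse_lift:
  assumes T: "blin M T" and B: "blin M B" and l: "l \<noteq> 0" and n: "n > 0"
    and r: "calkin_eq M (\<lambda>f x. l ^ n * B f x - (T ^^ n) (B f) x) (\<lambda>f. f)"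
    and r': "calkin_eq M (\<lambda>f. B (\<lambda>y. l ^ n * f y - (T ^^ n) f y)) (\<lambda>f. f)"
    and x: "x = abs_calkin (\<lambda>N. if N = M then T else (\<lambda>f x. 0))"
  shows "\<exists>y. (calkin_scalar (l ^ n) - x ^ n) * y = 1 \<and> y * (calkin_scalar (l ^ n) - x ^ n) = 1"
proof -
  define T' where "T' N = (if N = M then T else (\<lambda>f x. 0))" for N
  define B' where "B' N = (if N = M then B else (\<lambda>f x. inverse (l ^ n) * f x))" for N
  define y where "y = abs_calkin B'"
  have xT: "calkin_at N x (T' N)" for N
    unfolding x T'_def by (intro calkin_abs) (use T in auto)
  have yB: "calkin_at N y (B' N)" for N
    unfolding y_def by (intro calkin_abs) (use B in \<open>auto simp: B'_def intro: blin_scale\<close>)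
  have xn: "calkin_at N (calkin_scalar (l ^ n) - x ^ n) (\<lambda>f x. l ^ n * f x - (T' N ^^ n) f x)" for N
    by (intro calkin_at_diff calkin_at_scalar calkin_at_power xT)
  have z: "(((\<lambda>f x. 0) :: 'a op) ^^ n) f = (\<lambda>x. 0)" for f :: "'a \<Rightarrow> complex"
    using n by (cases n) simp_all
  have [simp]: "l ^ n * (inverse (l ^ n) * w) = w" "inverse (l ^ n) * (l ^ n * w) = w" for w
    using l by simp_all
  have "calkin_eq N (\<lambda>f x. l ^ n * B' N f x - (T' N ^^ n) (B' N f) x) (\<lambda>f. f)" for N
    using r l by (cases "N = M") (simp_all add: T'_def B'_def z calkin_eq_refl)
  then have "(calkin_scalar (l ^ n) - x ^ n) * y = 1"
    by (rule calkin_eqI_at[OF calkin_at_mult[OF xn yB] calkin_at_one])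
  moreover have "calkin_eq N (\<lambda>f. B' N (\<lambda>x. l ^ n * f x - (T' N ^^ n) f x)) (\<lambda>f. f)" for N
    using r' l by (cases "N = M") (simp_all add: T'_def B'_def z calkin_eq_refl)
  then have "y * (calkin_scalar (l ^ n) - x ^ n) = 1"
    by (rule calkin_eqI_at[OF calkin_at_mult[OF yB xn] calkin_at_one])
  ultimately show ?thesis by blast
qed

lemma compact_op_diff_iff:
  "blin M S \<Longrightarrow> blin M T \<Longrightarrow> compact_op M (\<lambda>f x. S f x - T f x) \<longleftrightarrow> calkin_eq M S T"
  by (simp add: compact_op_iff calkin_eq_def blin_diff)

lemma not_ess_spec_iff:
  assumes A: "blin M A"
  shows "l \<notin> ess_spec M A \<longleftrightarrow> (\<exists>B. blin M B \<and>
      calkin_eq M (\<lambda>f x. l * B f x - A (B f) x) (\<lambda>f. f) \<and>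
      calkin_eq M (\<lambda>f. B (\<lambda>y. l * f y - A f y)) (\<lambda>f. f))"
proof -
  have eq: "compact_op M (\<lambda>f x. l * B f x - A (B f) x - f x) \<longleftrightarrow> calkin_eq M (\<lambda>f x. l * B f x - A (B f) x) (\<lambda>f. f)"
    if B: "blin M B" for B
    by (rule compact_op_diff_iff[OF blin_diff[OF blin_scale[OF B] blin_comp[OF A B]] blin_id])
  have eq': "compact_op M (\<lambda>f x. B (\<lambda>y. l * f y - A f y) x - f x) \<longleftrightarrow> calkin_eq M (\<lambda>f. B (\<lambda>y. l * f y - A f y)) (\<lambda>f. f)"
    if B: "blin M B" for B
    by (rule compact_op_diff_iff[OF blin_comp[OF B blin_diff[OF blin_scale[OF blin_id] A]] blin_id])
  show ?thesis
    unfolding ess_spec_def mem_Collect_eq not_not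
  proof (rule ex_cong1)
    fix B
    show "(blin M B \<and> compact_op M (\<lambda>f x. l * B f x - A (B f) x - f x) \<and> compact_op M (\<lambda>f x. B (\<lambda>y. l * f y - A f y) x - f x))
      \<longleftrightarrow> (blin M B \<and> calkin_eq M (\<lambda>f x. l * B f x - A (B f) x) (\<lambda>f. f) \<and> calkin_eq M (\<lambda>f. B (\<lambda>y. l * f y - A f y)) (\<lambda>f. f))"
      using eq[of B] eq'[of B] by argo
  qed
qed

text \<open>Otherwise all \<open>l\<close> with \<open>cmod l >= t\<close> would have resolvents
  modulo compacts; these lift to the product algebra, where \<open>resolvent_set_power_bound\<close>
  excludes them. Positivity of \<open>t\<close> keeps \<open>l\<close> nonzero, as the zero padding
  of the lift requires. In the application \<open>g\<close> is the growth rate of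
  \<open>gamma_op\<close> along the powers of \<open>T\<close>.\<close>

theorem ess_spec_not_in_disc:
  assumes T: "blin M T" and t: "0 < t" "t < g"
    and lo: "\<And>n. n > 0 \<Longrightarrow> g ^ n \<le> gamma_op M (T ^^ n)"
    and hi: "\<And>u. u > g \<Longrightarrow> \<exists>C. \<forall>n>0. gamma_op M (T ^^ n) \<le> C * u ^ n"
  shows "\<exists>l\<in>ess_spec M T. t \<le> cmod l"
proof (rule ccontr)
  assume *: "\<not> ?thesis"
  define x where "x = abs_calkin (\<lambda>N. if N = M then T else (\<lambda>f x. 0))"
  have "calkin_at M x T"
    using calkin_abs[of "\<lambda>N. if N = M then T else (\<lambda>f x. 0)" M] T by (auto simp: x_def)
  then have nx: "calkin_norm M (x ^ n) = gamma_op M (T ^^ n)" for n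
    by (intro calkin_norm_at calkin_at_power)
  show False
  proof (rule calkin.resolvent_set_power_bound[OF t, where a = x and M = M])
    fix l assume l: "t \<le> cmod l"
    then have "l \<notin> ess_spec M T" using * by auto
    then obtain B where B: "blin M B" "calkin_eq M (\<lambda>f x. l * B f x - T (B f) x) (\<lambda>f. f)"
      "calkin_eq M (\<lambda>f. B (\<lambda>y. l * f y - T f y)) (\<lambda>f. f)"
      using not_ess_spec_iff[OF T] by blast
    have "l \<noteq> 0" using l t by auto
    then show "\<exists>r. (calkin_scalar l - x) * r = 1 \<and> r * (calkin_scalar l - x) = 1"
      using calkin_inverse_lift[OF T B(1) _ _ _ _ x_def, of l 1] B(2,3) by simp
  qed (use lo hi nx in auto)
qed

text \<open>Inverting \<open>l^n - T^n\<close> modulo compacts suffices, by factoring out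
  \<open>l - T\<close> in the Calkin algebra.\<close>

theorem not_ess_spec_powerI:
  assumes T: "blin M T" and B: "blin M B" and l: "l \<noteq> 0" and n: "n > 0"
    and r: "calkin_eq M (\<lambda>f x. l ^ n * B f x - (T ^^ n) (B f) x) (\<lambda>f. f)"
    and r': "calkin_eq M (\<lambda>f. B (\<lambda>y. l ^ n * f y - (T ^^ n) f y)) (\<lambda>f. f)"
  shows "l \<notin> ess_spec M T"
proof -
  define x where "x = abs_calkin (\<lambda>N. if N = M then T else (\<lambda>f x. 0))"
  have xT: "calkin_at M x T"
    using calkin_abs[of "\<lambda>N. if N = M then T else (\<lambda>f x. 0)" M] T by (auto simp: x_def)
  obtain y where y: "(calkin_scalar l - x) * y = 1" "y * (calkin_scalar l - x) = 1"
    using calkin_inverse_lift[OF assms x_def] calkin.invertible_power_diff by blast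
  obtain Y where Y: "calkin_at M y Y" using calkin_at_ex by blast
  have d: "calkin_at M (calkin_scalar l - x) (\<lambda>f x. l * f x - T f x)"
    by (intro calkin_at_diff calkin_at_scalar xT)
  show ?thesis unfolding not_ess_spec_iff[OF T]
  proof (intro exI conjI)
    show "blin M Y" by (rule calkin_at_blin[OF Y])
    show "calkin_eq M (\<lambda>f x. l * Y f x - T (Y f) x) (\<lambda>f. f)"
      by (rule calkin_at_unique[OF calkin_at_mult[OF d Y, unfolded y(1)] calkin_at_one])
    show "calkin_eq M (\<lambda>f. Y (\<lambda>y. l * f y - T f y)) (\<lambda>f. f)"
      by (rule calkin_at_unique[OF calkin_at_mult[OF Y d, unfolded y(2)] calkin_at_one])
  qed
qed

subsection \<open>Completeness and Neumann series\<close>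

lemma L2_nn_integralI:
  assumes "f \<in> borel_measurable M" "(\<integral>\<^sup>+x. ennreal ((cmod (f x))\<^sup>2) \<partial>M) \<le> ennreal (c\<^sup>2)" "0 \<le> c"
  shows "L2 M f" "nrm M f \<le> c"
proof -
  show L: "L2 M f"
    unfolding L2_def using assms by (auto intro!: integrableI_bounded simp: le_less_trans)
  have "ennreal ((nrm M f)\<^sup>2) \<le> ennreal (c\<^sup>2)"
    using nn_integral_L2[OF L] assms(2) by (simp add: ennreal_power)
  then show "nrm M f \<le> c"
    using assms(3) by (simp add: ennreal_le_iff power2_le_iff_abs_le)
qed

lemma L2_geometric_Cauchy:
  assumes h: "\<And>n. L2 M (h n)"
    and d: "\<And>n. nrm M (\<lambda>x. h (Suc n) x - h n x) \<le> C * q ^ n"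
    and q: "0 < q" "q < 1" and C: "0 \<le> C"
  shows "nrm M (\<lambda>x. h (n + k) x - h n x) \<le> C * q ^ n / (1 - q)"
proof -
  have "nrm M (\<lambda>x. h (n + k) x - h n x) \<le> (\<Sum>i<k. C * q ^ (n + i))"
  proof (induction k)
    case (Suc k)
    have "nrm M (\<lambda>x. h (n + Suc k) x - h n x)
        \<le> nrm M (\<lambda>x. h (Suc (n + k)) x - h (n + k) x) + nrm M (\<lambda>x. h (n + k) x - h n x)"
      using nrm_triangle_diff[OF h[of "Suc (n + k)"] h[of "n + k"] h[of n]] by simp
    also have "\<dots> \<le> C * q ^ (n + k) + (\<Sum>i<k. C * q ^ (n + i))"
      by (intro add_mono d Suc)
    finally show ?case by simp
  qed simp
  also have "(\<Sum>i<k. C * q ^ (n + i)) = C * q ^ n * (\<Sum>i<k. q ^ i)"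
    by (simp add: power_add sum_distrib_left mult.assoc)
  also have "\<dots> \<le> C * q ^ n * (1 / (1 - q))"
  proof (intro mult_left_mono)
    have "(\<Sum>i<k. q ^ i) = (1 - q ^ k) / (1 - q)"
      using q sum_gp_strict[of q k] by simp
    then show "(\<Sum>i<k. q ^ i) \<le> 1 / (1 - q)"
      using q by (simp add: divide_right_mono)
  qed (use q C in auto)
  finally show ?thesis by simp
qed

text \<open>Riesz-Fischer for increments of geometric size, as produced by a Neumann iteration.
  Dividing the squared increments by \<open>q ^ n\<close> leaves an integrable sum, so at almost
  every point the increments are at most a constant times \<open>sqrt q ^ n\<close> and the sequence
  converges there.\<close>

lemma L2_complete:
  assumes h: "\<And>n. L2 M (h n)"
    and d: "\<And>n. nrm M (\<lambda>x. h (Suc n) x - h n x) \<le> C * q ^ n"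
    and q: "0 < q" "q < 1" and C: "0 \<le> C"
  shows "\<exists>u. L2 M u \<and> (\<lambda>n. nrm M (\<lambda>x. h n x - u x)) \<longlonglongrightarrow> 0"
proof -
  note [measurable] = L2_measurable[OF h]
  define D where "D n x = h (Suc n) x - h n x" for n x
  have D: "L2 M (D n)" for n unfolding D_def by (intro L2_diff h)
  note [measurable] = L2_measurable[OF D]
  have "(\<integral>\<^sup>+x. (\<Sum>n. ennreal ((cmod (D n x))\<^sup>2 / q ^ n)) \<partial>M) = (\<Sum>n. \<integral>\<^sup>+x. ennreal ((cmod (D n x))\<^sup>2 / q ^ n) \<partial>M)"
    by (intro nn_integral_suminf) measurable
  also have "\<dots> \<le> (\<Sum>n. ennreal (C\<^sup>2 * q ^ n))"
  proof (intro suminf_le allI)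
    fix n
    have "(\<integral>\<^sup>+x. ennreal ((cmod (D n x))\<^sup>2 / q ^ n) \<partial>M) = ennreal (1 / q ^ n) * (\<integral>\<^sup>+x. (ennreal (cmod (D n x)))\<^sup>2 \<partial>M)"
      using q by (subst nn_integral_cmult[symmetric]) (auto simp: ennreal_power field_simps simp flip: ennreal_mult)
    also have "\<dots> = ennreal ((nrm M (D n))\<^sup>2 / q ^ n)"
      using q by (simp add: nn_integral_L2[OF D] flip: ennreal_mult)
    also have "\<dots> \<le> ennreal ((C * q ^ n)\<^sup>2 / q ^ n)"
      using d[of n] q C by (intro ennreal_leI divide_right_mono power_mono) (auto simp: D_def[abs_def])
    also have "(C * q ^ n)\<^sup>2 / q ^ n = C\<^sup>2 * q ^ n"
      using q by (simp add: power2_eq_square)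
    finally show "(\<integral>\<^sup>+x. ennreal ((cmod (D n x))\<^sup>2 / q ^ n) \<partial>M) \<le> ennreal (C\<^sup>2 * q ^ n)" .
  qed auto
  also have "\<dots> < \<infinity>"
  proof -
    have "summable (\<lambda>n. C\<^sup>2 * q ^ n)" using q by (intro summable_mult summable_geometric) auto
    then show ?thesis using q by (simp add: suminf_ennreal2)
  qed
  finally have "AE x in M. (\<Sum>n. ennreal ((cmod (D n x))\<^sup>2 / q ^ n)) \<noteq> \<infinity>"
    by (intro nn_integral_PInf_AE) (auto simp: less_top)
  then have conv: "AE x in M. (\<lambda>n. h n x) \<longlonglongrightarrow> lim (\<lambda>n. h n x)"
  proof eventually_elim
    fix x assume fin: "(\<Sum>n. ennreal ((cmod (D n x))\<^sup>2 / q ^ n)) \<noteq> \<infinity>"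
    define B where "B = enn2real (\<Sum>n. ennreal ((cmod (D n x))\<^sup>2 / q ^ n))"
    have B0: "B \<ge> 0" by (simp add: B_def)
    have DB: "cmod (D n x) \<le> sqrt B * (sqrt q) ^ n" for n
    proof -
      have "ennreal ((cmod (D n x))\<^sup>2 / q ^ n) \<le> (\<Sum>n. ennreal ((cmod (D n x))\<^sup>2 / q ^ n))"
        using sum_le_suminf[of "\<lambda>n. ennreal ((cmod (D n x))\<^sup>2 / q ^ n)" "{n}"] by simp
      also have "\<dots> = ennreal B" using fin by (simp add: B_def less_top)
      finally have "(cmod (D n x))\<^sup>2 / q ^ n \<le> B" using B0 by (simp add: ennreal_le_iff)
      then have "(cmod (D n x))\<^sup>2 \<le> B * q ^ n" using q by (simp add: divide_le_eq)
      then have "sqrt ((cmod (D n x))\<^sup>2) \<le> sqrt (B * q ^ n)" by (rule real_sqrt_le_mono)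
      then show ?thesis by (simp add: real_sqrt_mult real_sqrt_power)
    qed
    have "summable (\<lambda>n. sqrt B * (sqrt q) ^ n)"
      using q by (intro summable_mult summable_geometric) auto
    then have "summable (\<lambda>n. D n x)"
      by (rule summable_comparison_test') (use DB in auto)
    then have "convergent (\<lambda>n. h 0 x + (\<Sum>i<n. D i x))"
      by (intro convergent_add convergent_const) (simp add: summable_iff_convergent)
    moreover have "h 0 x + (\<Sum>i<n. D i x) = h n x" for n
      unfolding D_def by (subst sum_lessThan_telescope) simp
    ultimately show "(\<lambda>n. h n x) \<longlonglongrightarrow> lim (\<lambda>n. h n x)" by (simp add: convergent_LIMSEQ_iff)
  qed
  define u where "u x = lim (\<lambda>n. h n x)" for x
  have um[measurable]: "u \<in> borel_measurable M"
    unfolding u_def by (intro borel_measurable_lim_metric) measurable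
  have bound: "L2 M (\<lambda>x. h n x - u x)" "nrm M (\<lambda>x. h n x - u x) \<le> C * q ^ n / (1 - q)" for n
  proof -
    let ?c = "C * q ^ n / (1 - q)"
    have c0: "?c \<ge> 0" using C q by simp
    \<comment> \<open>Fatou in the second index carries the uniform Cauchy estimate over to the
      pointwise limit.\<close>
    have "(\<integral>\<^sup>+x. ennreal ((cmod (h n x - u x))\<^sup>2) \<partial>M) = (\<integral>\<^sup>+x. liminf (\<lambda>k. ennreal ((cmod (h n x - h (n + k) x))\<^sup>2)) \<partial>M)"
    proof (rule nn_integral_cong_AE, use conv in eventually_elim)
      fix x assume x: "(\<lambda>n. h n x) \<longlonglongrightarrow> lim (\<lambda>n. h n x)"
      then have "(\<lambda>k. h (k + n) x) \<longlonglongrightarrow> u x" unfolding u_def by (rule LIMSEQ_ignore_initial_segment)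
      then have "(\<lambda>k. ennreal ((cmod (h n x - h (n + k) x))\<^sup>2)) \<longlonglongrightarrow> ennreal ((cmod (h n x - u x))\<^sup>2)"
        by (intro tendsto_intros tendsto_ennrealI) (simp add: add.commute)
      then show "ennreal ((cmod (h n x - u x))\<^sup>2) = liminf (\<lambda>k. ennreal ((cmod (h n x - h (n + k) x))\<^sup>2))"
        by (rule lim_imp_Liminf[OF sequentially_bot, symmetric])
    qed
    also have "\<dots> \<le> liminf (\<lambda>k. \<integral>\<^sup>+x. ennreal ((cmod (h n x - h (n + k) x))\<^sup>2) \<partial>M)"
      by (intro nn_integral_liminf) measurable
    also have "\<dots> \<le> liminf (\<lambda>k::nat. ennreal (?c\<^sup>2))"
    proof (intro Liminf_mono always_eventually allI)
      fix k
      have "(\<integral>\<^sup>+x. ennreal ((cmod (h n x - h (n + k) x))\<^sup>2) \<partial>M) = ennreal ((nrm M (\<lambda>x. h n x - h (n + k) x))\<^sup>2)"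
        using nn_integral_L2[OF L2_diff[OF h h]] by (simp add: ennreal_power)
      also have "\<dots> \<le> ennreal (?c\<^sup>2)"
        using L2_geometric_Cauchy[OF h d q C, of n k]
        by (intro ennreal_leI power_mono) (auto simp: nrm_minus_commute[of M "h n"])
      finally show "(\<integral>\<^sup>+x. ennreal ((cmod (h n x - h (n + k) x))\<^sup>2) \<partial>M) \<le> ennreal (?c\<^sup>2)" .
    qed
    also have "\<dots> = ennreal (?c\<^sup>2)" by (simp add: Liminf_const)
    finally have le: "(\<integral>\<^sup>+x. ennreal ((cmod (h n x - u x))\<^sup>2) \<partial>M) \<le> ennreal (?c\<^sup>2)" .
    have m: "(\<lambda>x. h n x - u x) \<in> borel_measurable M" by measurable
    show "L2 M (\<lambda>x. h n x - u x)" "nrm M (\<lambda>x. h n x - u x) \<le> ?c"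
      using L2_nn_integralI[OF m le c0] by auto
  qed
  have "L2 M u" using L2_diff[OF h[of 0] bound(1)[of 0]] by simp
  moreover have "(\<lambda>n. nrm M (\<lambda>x. h n x - u x)) \<longlonglongrightarrow> 0"
  proof (rule tendsto_sandwich[OF _ _ tendsto_const])
    show "(\<lambda>n. C * q ^ n / (1 - q)) \<longlonglongrightarrow> 0"
      using tendsto_mult[OF tendsto_const[of C] LIMSEQ_realpow_zero[of q]] q
      by (auto intro: tendsto_divide_zero)
  qed (use bound(2) in auto)
  ultimately show ?thesis by blast
qed

text \<open>Fixed point iteration for \<open>u = (f + S u) / l\<close>, a contraction with factor
  \<open>C / cmod l\<close>.\<close>

lemma neumann_solvable:
  assumes S: "blin M S" and C: "0 \<le> C" "C < cmod l" "\<And>f. L2 M f \<Longrightarrow> nrm M (S f) \<le> C * nrm M f"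
    and f: "L2 M f"
  shows "\<exists>u. L2 M u \<and> (AE x in M. l * u x - S u x = f x)"
proof -
  have l: "l \<noteq> 0" "cmod l > 0" using C by auto
  define h where "h = rec_nat (\<lambda>x. 0) (\<lambda>n g x. (1 / l) * (f x + S g x))"
  have h0: "h 0 = (\<lambda>x. 0)" and hS: "h (Suc n) = (\<lambda>x. (1 / l) * (f x + S (h n) x))" for n
    by (auto simp: h_def)
  have hL: "L2 M (h n)" for n
  proof (induction n)
    case (Suc n)
    show ?case unfolding hS by (intro L2_scale L2_add f blin_L2[OF S] Suc)
  qed (simp add: h0)
  \<comment> \<open>The midpoint of the contraction factor and 1: still below 1, and positive even
    if \<open>C = 0\<close>, as geometric convergence asks.\<close>
  define q where "q = (C / cmod l + 1) / 2"
  have q: "0 < q" "q < 1" "C / cmod l \<le> q" using C l by (auto simp: q_def field_simps)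
  have d: "nrm M (\<lambda>x. h (Suc n) x - h n x) \<le> nrm M (h 1) * q ^ n" for n
  proof (induction n)
    case (Suc n)
    have "nrm M (\<lambda>x. h (Suc (Suc n)) x - h (Suc n) x) = nrm M (\<lambda>x. (1 / l) * S (\<lambda>x. h (Suc n) x - h n x) x)"
    proof (rule nrm_cong_AE)
      have "AE x in M. S (\<lambda>x. h (Suc n) x - h n x) x = S (h (Suc n)) x - S (h n) x"
        by (rule blin_diff_arg[OF S hL hL])
      then show "AE x in M. h (Suc (Suc n)) x - h (Suc n) x = (1 / l) * S (\<lambda>x. h (Suc n) x - h n x) x"
      proof eventually_elim
        case (elim x)
        have "h (Suc (Suc n)) x - h (Suc n) x = (1 / l) * (S (h (Suc n)) x - S (h n) x)"
          unfolding hS[of "Suc n"] by (subst (2) hS) (simp add: algebra_simps add_divide_distrib diff_divide_distrib)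
        then show ?case using elim by simp
      qed
    qed (intro L2_diff hL L2_scale blin_L2[OF S])+
    also have "\<dots> \<le> (1 / cmod l) * (C * nrm M (\<lambda>x. h (Suc n) x - h n x))"
      unfolding nrm_scale using l C(3)[OF L2_diff[OF hL hL], of "Suc n" n]
      by (simp add: norm_divide divide_right_mono)
    also have "\<dots> = C / cmod l * nrm M (\<lambda>x. h (Suc n) x - h n x)" by simp
    also have "\<dots> \<le> q * (nrm M (h 1) * q ^ n)"
      using q Suc by (intro mult_mono) auto
    finally show ?case by (simp add: mult_ac)
  qed (simp add: h0)
  obtain u where u: "L2 M u" "(\<lambda>n. nrm M (\<lambda>x. h n x - u x)) \<longlonglongrightarrow> 0"
    using L2_complete[OF hL d q(1,2)] by auto
  let ?w = "\<lambda>x. (l * u x - S u x) - f x"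
  have wL: "L2 M ?w" by (intro L2_diff L2_scale blin_L2[OF S] u f)
  have le: "nrm M ?w \<le> cmod l * nrm M (\<lambda>x. h (Suc n) x - u x) + C * nrm M (\<lambda>x. h n x - u x)" for n
  proof -
    have "nrm M ?w = nrm M (\<lambda>x. (- l) * (h (Suc n) x - u x) + S (\<lambda>x. h n x - u x) x)"
    proof (rule nrm_cong_AE[OF wL])
      have "AE x in M. S (\<lambda>x. h n x - u x) x = S (h n) x - S u x"
        by (rule blin_diff_arg[OF S hL u(1)])
      then show "AE x in M. ?w x = (- l) * (h (Suc n) x - u x) + S (\<lambda>x. h n x - u x) x"
        by eventually_elim (use l in \<open>simp add: hS algebra_simps\<close>)
    qed (intro L2_add L2_scale L2_diff hL u blin_L2[OF S])
    also have "\<dots> \<le> nrm M (\<lambda>x. (- l) * (h (Suc n) x - u x)) + nrm M (S (\<lambda>x. h n x - u x))"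
      by (intro nrm_triangle L2_scale L2_diff hL u blin_L2[OF S])
    also have "\<dots> \<le> cmod l * nrm M (\<lambda>x. h (Suc n) x - u x) + C * nrm M (\<lambda>x. h n x - u x)"
      unfolding nrm_scale using C(3)[OF L2_diff[OF hL u(1)]] by simp
    finally show ?thesis .
  qed
  have "(\<lambda>n. cmod l * nrm M (\<lambda>x. h (Suc n) x - u x) + C * nrm M (\<lambda>x. h n x - u x)) \<longlonglongrightarrow> cmod l * 0 + C * 0"
    by (intro tendsto_intros u LIMSEQ_Suc[OF u(2)])
  then have "nrm M ?w \<le> cmod l * 0 + C * 0"
    by (rule tendsto_lowerbound) (use le in auto)
  then have "nrm M ?w = 0" by (simp add: antisym)
  from nrm_eq_0_AE[OF wL this] have "AE x in M. l * u x - S u x = f x"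
    by eventually_elim simp
  with u(1) show ?thesis by blast
qed

lemma neumann_unique:
  assumes S: "blin M S" and C: "C < cmod l" "\<And>f. L2 M f \<Longrightarrow> nrm M (S f) \<le> C * nrm M f"
    and u: "L2 M u" and v: "L2 M v" and eq: "AE x in M. l * u x - S u x = l * v x - S v x"
  shows "AE x in M. u x = v x"
proof -
  let ?w = "\<lambda>x. u x - v x"
  have wL: "L2 M ?w" by (intro L2_diff u v)
  have "cmod l * nrm M ?w = nrm M (\<lambda>x. l * ?w x)" by (simp add: nrm_scale)
  also have "\<dots> = nrm M (S ?w)"
  proof (rule nrm_cong_AE)
    show "AE x in M. l * (u x - v x) = S ?w x"
      using eq blin_diff_arg[OF S u v] by eventually_elim algebra
  qed (intro L2_scale wL blin_L2[OF S])+
  also have "\<dots> \<le> C * nrm M ?w" by (rule C(2)[OF wL])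
  finally have "(cmod l - C) * nrm M ?w \<le> 0" by (simp add: algebra_simps)
  then have "nrm M ?w = 0"
    using C(1) nrm_nonneg[of M ?w] by (simp add: mult_le_0_iff)
  from nrm_eq_0_AE[OF wL this] show ?thesis by eventually_elim simp
qed

text \<open>Solutions are picked by choice; uniqueness up to null sets then makes the selection
  linear and compatible with almost everywhere equality.\<close>

lemma neumann_inverse:
  assumes S: "blin M S" and C: "0 \<le> C" "C < cmod l" "\<And>f. L2 M f \<Longrightarrow> nrm M (S f) \<le> C * nrm M f"
  shows "\<exists>B. blin M B \<and> (\<forall>f. L2 M f \<longrightarrow> (AE x in M. l * B f x - S (B f) x = f x)) \<and>
    (\<forall>f. L2 M f \<longrightarrow> (AE x in M. B (\<lambda>y. l * f y - S f y) x = f x))"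
proof -
  define B where "B f = (SOME u. L2 M u \<and> (AE x in M. l * u x - S u x = f x))" for f
  have B: "L2 M (B f)" "AE x in M. l * B f x - S (B f) x = f x" if "L2 M f" for f
    using someI_ex[OF neumann_solvable[OF S C(1,2) _ that]] C(3) by (auto simp: B_def)
  have uniq: "AE x in M. u x = v x"
    if "L2 M u" "L2 M v" "AE x in M. l * u x - S u x = l * v x - S v x" for u v
    by (rule neumann_unique[OF S C(2) _ that]) (rule C(3))
  have "blin M B" unfolding blin_def
  proof (intro conjI allI impI)
    show "AE x in M. B f x = B g x" if f: "L2 M f" and g: "L2 M g" and "AE x in M. f x = g x" for f g
    proof (rule uniq[OF B(1)[OF f] B(1)[OF g]])
      show "AE x in M. l * B f x - S (B f) x = l * B g x - S (B g) x"
        using B(2)[OF f] B(2)[OF g] that(3) by eventually_elim simp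
    qed
    show "AE x in M. B (\<lambda>y. c * f y + g y) x = c * B f x + B g x" if f: "L2 M f" and g: "L2 M g" for c f g
    proof (rule uniq)
      have cfg: "L2 M (\<lambda>y. c * f y + g y)" by (intro L2_add L2_scale f g)
      show "L2 M (B (\<lambda>y. c * f y + g y))" by (rule B(1)[OF cfg])
      show "L2 M (\<lambda>x. c * B f x + B g x)" by (intro L2_add L2_scale B f g)
      show "AE x in M. l * B (\<lambda>y. c * f y + g y) x - S (B (\<lambda>y. c * f y + g y)) x
          = l * (c * B f x + B g x) - S (\<lambda>x. c * B f x + B g x) x"
        using B(2)[OF cfg] B(2)[OF f] B(2)[OF g] blin_linear[OF S B(1)[OF f] B(1)[OF g], of c]
      proof eventually_elim
        case (elim x)
        have "l * (c * B f x + B g x) - S (\<lambda>x. c * B f x + B g x) x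
            = c * (l * B f x - S (B f) x) + (l * B g x - S (B g) x)"
          unfolding elim(4) by (simp add: algebra_simps)
        then show ?case using elim(1-3) by simp
      qed
    qed
    show "\<exists>D. \<forall>f. L2 M f \<longrightarrow> nrm M (B f) \<le> D * nrm M f"
    proof (intro exI[of _ "1 / (cmod l - C)"] allI impI)
      fix f assume f: "L2 M f"
      have "cmod l * nrm M (B f) = nrm M (\<lambda>x. l * B f x)" by (simp add: nrm_scale)
      also have "\<dots> = nrm M (\<lambda>x. f x + S (B f) x)"
      proof (rule nrm_cong_AE)
        show "AE x in M. l * B f x = f x + S (B f) x"
          using B(2)[OF f] by eventually_elim (simp add: diff_eq_eq)
      qed (intro L2_add L2_scale B f blin_L2[OF S])+
      also have "\<dots> \<le> nrm M f + nrm M (S (B f))" by (intro nrm_triangle f B blin_L2[OF S])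
      also have "\<dots> \<le> nrm M f + C * nrm M (B f)" using C(3)[OF B(1)[OF f]] by simp
      finally show "nrm M (B f) \<le> 1 / (cmod l - C) * nrm M f"
        using C(2) by (simp add: field_simps)
    qed
  qed (rule B)
  moreover have "AE x in M. B (\<lambda>y. l * f y - S f y) x = f x" if f: "L2 M f" for f
  proof (rule uniq)
    have g: "L2 M (\<lambda>y. l * f y - S f y)" by (intro L2_diff L2_scale f blin_L2[OF S])
    show "L2 M (B (\<lambda>y. l * f y - S f y))" by (rule B(1)[OF g])
    show "AE x in M. l * B (\<lambda>y. l * f y - S f y) x - S (B (\<lambda>y. l * f y - S f y)) x = l * f x - S f x"
      by (rule B(2)[OF g])
  qed (rule f)
  ultimately show ?thesis using B(2) by blast
qed

text \<open>A Neumann series for \<open>l^n - S\<close> needs an operator norm bound, which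
  smallness of \<open>gamma_op\<close> does not give for \<open>T^n\<close> itself; passing to a
  compact perturbation \<open>S\<close> is harmless modulo compacts.\<close>

theorem not_ess_spec_power_bound:
  assumes T: "blin M T" and S: "blin M S" and TS: "calkin_eq M (T ^^ n) S" and n: "n > 0"
    and C: "0 \<le> C" "C < cmod l ^ n" "\<And>f. L2 M f \<Longrightarrow> nrm M (S f) \<le> C * nrm M f"
  shows "l \<notin> ess_spec M T"
proof -
  obtain B where B: "blin M B" "\<And>f. L2 M f \<Longrightarrow> AE x in M. l ^ n * B f x - S (B f) x = f x"
    "\<And>f. L2 M f \<Longrightarrow> AE x in M. B (\<lambda>y. l ^ n * f y - S f y) x = f x"
    using neumann_inverse[OF S C(1), of "l ^ n"] C(2,3) by (auto simp: norm_power)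
  have l: "l \<noteq> 0" using C n by (cases "l = 0") (auto simp: power_0_left)
  note r = calkin_eq_refl[OF B(1)]
  have bS: "blin M (\<lambda>f x. l ^ n * f x - S f x)"
    by (rule blin_diff[OF blin_scale[OF blin_id] S])
  show ?thesis
  proof (rule not_ess_spec_powerI[OF T B(1) l n])
    have "calkin_eq M (\<lambda>f x. l ^ n * B f x - (T ^^ n) (B f) x) (\<lambda>f x. l ^ n * B f x - S (B f) x)"
      by (rule calkin_eq_diff[OF calkin_eq_scale[OF r] calkin_eq_comp[OF TS r]])
    moreover have "calkin_eq M (\<lambda>f x. l ^ n * B f x - S (B f) x) (\<lambda>f. f)"
      by (rule calkin_eq_AE[OF blin_diff[OF blin_scale[OF B(1)] blin_comp[OF S B(1)]] blin_id B(2)])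
    ultimately show "calkin_eq M (\<lambda>f x. l ^ n * B f x - (T ^^ n) (B f) x) (\<lambda>f. f)"
      by (rule calkin_eq_trans)
    have "calkin_eq M (\<lambda>f. B (\<lambda>y. l ^ n * f y - (T ^^ n) f y)) (\<lambda>f. B (\<lambda>y. l ^ n * f y - S f y))"
      by (rule calkin_eq_comp[OF r calkin_eq_diff[OF calkin_eq_scale[OF calkin_eq_refl[OF blin_id]] TS]])
    moreover have "calkin_eq M (\<lambda>f. B (\<lambda>y. l ^ n * f y - S f y)) (\<lambda>f. f)"
      by (rule calkin_eq_AE[OF blin_comp[OF B(1) bS] blin_id B(3)])
    ultimately show "calkin_eq M (\<lambda>f. B (\<lambda>y. l ^ n * f y - (T ^^ n) f y)) (\<lambda>f. f)"
      by (rule calkin_eq_trans)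
  qed
qed

subsection \<open>Nonnegative kernels\<close>

text \<open>Valued in \<open>ennreal\<close>, so it makes sense at every point before any
  integrability is known.\<close>

definition kabs :: "'a measure \<Rightarrow> 'a kernel \<Rightarrow> ('a \<Rightarrow> complex) \<Rightarrow> 'a \<Rightarrow> ennreal" where
  "kabs M a f x = (\<integral>\<^sup>+y. ennreal (a x y * cmod (f y)) \<partial>M)"

text \<open>Nonnegativity is required everywhere and not just almost everywhere;
  \<open>kplus\<close> below arranges this for the given kernels.\<close>

definition kernel :: "'a measure \<Rightarrow> 'a kernel \<Rightarrow> bool" where
  "kernel M a \<longleftrightarrow> case_prod a \<in> borel_measurable (M \<Otimes>\<^sub>M M) \<and> (\<forall>x y. 0 \<le> a x y)"

text \<open>The operator norm bound is put as a bound on the bilinear form of the moduli. This form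
  passes to the transposed kernel by Tonelli and to geometric means by Hoelder.\<close>

definition kbound :: "'a measure \<Rightarrow> 'a kernel \<Rightarrow> real \<Rightarrow> bool" where
  "kbound M a C \<longleftrightarrow> kernel M a \<and> 0 \<le> C \<and>
    (\<forall>f g. L2 M f \<longrightarrow> L2 M g \<longrightarrow> (\<integral>\<^sup>+x. kabs M a f x * ennreal (cmod (g x)) \<partial>M) \<le> ennreal (C * nrm M f * nrm M g))"

definition ktrans :: "'a kernel \<Rightarrow> 'a kernel" where
  "ktrans a = (\<lambda>x y. a y x)"

text \<open>Where the integral is infinite, \<open>enn2real\<close> yields 0;
  \<open>kcomp_finite\<close> shows that this concerns only a null set when both kernels are
  bounded.\<close>

definition kcomp :: "'a measure \<Rightarrow> 'a kernel \<Rightarrow> 'a kernel \<Rightarrow> 'a kernel" where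
  "kcomp M a b = (\<lambda>x z. enn2real (\<integral>\<^sup>+y. ennreal (a x y * b y z) \<partial>M))"

lemma kernel_measurable [measurable_dest]: "kernel M a \<Longrightarrow> case_prod a \<in> borel_measurable (M \<Otimes>\<^sub>M M)"
  by (simp add: kernel_def)

lemma kernel_nonneg: "kernel M a \<Longrightarrow> 0 \<le> a x y"
  by (simp add: kernel_def)

lemma kbound_kernel: "kbound M a C \<Longrightarrow> kernel M a"
  by (simp add: kbound_def)

lemma kbound_nonneg: "kbound M a C \<Longrightarrow> 0 \<le> C"
  by (simp add: kbound_def)

lemma kboundD:
  "kbound M a C \<Longrightarrow> L2 M f \<Longrightarrow> L2 M g \<Longrightarrow>
    (\<integral>\<^sup>+x. kabs M a f x * ennreal (cmod (g x)) \<partial>M) \<le> ennreal (C * nrm M f * nrm M g)"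
  by (simp add: kbound_def)

lemma L2_ennreal_bound:
  assumes [measurable]: "F \<in> borel_measurable M" and le: "(\<integral>\<^sup>+x. (F x)\<^sup>2 \<partial>M) \<le> ennreal (c\<^sup>2)" and c: "0 \<le> c"
  shows "AE x in M. F x < \<infinity>" "L2 M (\<lambda>x. complex_of_real (enn2real (F x)))"
    "nrm M (\<lambda>x. complex_of_real (enn2real (F x))) \<le> c"
proof -
  have "AE x in M. (F x)\<^sup>2 \<noteq> \<infinity>"
    using le by (intro nn_integral_PInf_AE) (auto simp: top_unique)
  then show "AE x in M. F x < \<infinity>"
  proof eventually_elim
    fix x assume "(F x)\<^sup>2 \<noteq> \<infinity>"
    then show "F x < \<infinity>" by (cases "F x") (auto simp: power2_eq_square)
  qed
  have "(\<integral>\<^sup>+x. ennreal ((cmod (complex_of_real (enn2real (F x))))\<^sup>2) \<partial>M) \<le> (\<integral>\<^sup>+x. (F x)\<^sup>2 \<partial>M)"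
  proof (rule nn_integral_mono)
    fix x
    have "ennreal (enn2real (F x)) \<le> F x"
      by (cases "F x") auto
    then have "ennreal (enn2real (F x)) ^ 2 \<le> (F x)\<^sup>2" by (rule power_mono) simp
    then show "ennreal ((cmod (complex_of_real (enn2real (F x))))\<^sup>2) \<le> (F x)\<^sup>2"
      by (simp add: ennreal_power)
  qed
  then have le': "(\<integral>\<^sup>+x. ennreal ((cmod (complex_of_real (enn2real (F x))))\<^sup>2) \<partial>M) \<le> ennreal (c\<^sup>2)"
    using le by (rule order_trans)
  have m: "(\<lambda>x. complex_of_real (enn2real (F x))) \<in> borel_measurable M" by measurable
  show "L2 M (\<lambda>x. complex_of_real (enn2real (F x)))" "nrm M (\<lambda>x. complex_of_real (enn2real (F x))) \<le> c"
    using L2_nn_integralI[OF m le' c] by auto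
qed

lemma cmod_kop_le: "ennreal (cmod (kop M a f x)) \<le> kabs M a f x" if "kernel M a"
proof (cases "integrable M (\<lambda>y. complex_of_real (a x y) * f y)")
  case True
  then have "ennreal (cmod (kop M a f x)) \<le> (\<integral>\<^sup>+y. ennreal (norm (complex_of_real (a x y) * f y)) \<partial>M)"
    unfolding kop_def by (rule integral_norm_bound_ennreal)
  then show ?thesis
    using kernel_nonneg[OF that] by (simp add: kabs_def norm_mult)
qed (simp add: kop_def not_integrable_integral_eq)

context sigma_finite_measure
begin

interpretation MM: pair_sigma_finite M M ..

lemma kabs_measurable:
  assumes "kernel M a" "f \<in> borel_measurable M"
  shows "kabs M a f \<in> borel_measurable M"
proof -
  note [measurable] = kernel_measurable[OF assms(1)] assms(2)
  show ?thesis unfolding kabs_def by measurable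
qed

text \<open>Duality, tested against truncations of \<open>kabs M a f\<close> itself.\<close>
lemma kbound_kabs:
  assumes a: "kbound M a C" and f: "L2 M f"
  shows "(\<integral>\<^sup>+x. (kabs M a f x)\<^sup>2 \<partial>M) \<le> ennreal ((C * nrm M f)\<^sup>2)"
proof -
  let ?F = "kabs M a f" and ?c = "C * nrm M f"
  have [measurable]: "?F \<in> borel_measurable M"
    by (intro kabs_measurable kbound_kernel[OF a] L2_measurable[OF f])
  have c: "?c \<ge> 0" using kbound_nonneg[OF a] by simp
  obtain X :: "nat \<Rightarrow> 'a set" where X: "range X \<subseteq> sets M" "(\<Union>i. X i) = space M"
    "\<And>i. emeasure M (X i) \<noteq> \<infinity>" "incseq X"
    using sigma_finite_incseq by blast
  have [measurable]: "X n \<in> sets M" for n using X by auto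
  define G where "G n x = indicator (X n) x * min (?F x) (of_nat n)" for n x
  have [measurable]: "G n \<in> borel_measurable M" for n unfolding G_def by measurable
  have Gle: "G n x \<le> ?F x" "G n x \<le> of_nat n * indicator (X n) x" for n x
    by (auto simp: G_def indicator_def)
  have Gfin: "G n x < \<infinity>" for n x
    using Gle(2)[of n x] by (rule le_less_trans) (auto simp: indicator_def of_nat_less_top)
  have bound: "(\<integral>\<^sup>+x. (G n x)\<^sup>2 \<partial>M) \<le> ennreal (?c\<^sup>2)" for n
  proof -
    define g where "g x = complex_of_real (enn2real (G n x))" for x
    have gG: "ennreal (cmod (g x)) = G n x" for x
      using Gfin[of n x] by (simp add: g_def)
    have "(\<integral>\<^sup>+x. (G n x)\<^sup>2 \<partial>M) \<le> (\<integral>\<^sup>+x. (of_nat n * indicator (X n) x)\<^sup>2 \<partial>M)"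
      by (intro nn_integral_mono power_mono Gle) auto
    also have "\<dots> = (\<integral>\<^sup>+x. (of_nat n)\<^sup>2 * indicator (X n) x \<partial>M)"
      by (intro nn_integral_cong) (auto simp: indicator_def)
    also have "\<dots> = (of_nat n)\<^sup>2 * emeasure M (X n)"
      by (simp add: nn_integral_cmult_indicator)
    also have "\<dots> < \<infinity>"
      using X(3)[of n] by (simp add: ennreal_mult_less_top less_top power_less_top_ennreal of_nat_less_top)
    finally have fin: "(\<integral>\<^sup>+x. (G n x)\<^sup>2 \<partial>M) < \<infinity>" .
    obtain d where d: "d \<ge> 0" "(\<integral>\<^sup>+x. (G n x)\<^sup>2 \<partial>M) = ennreal d"
      using fin by (cases "\<integral>\<^sup>+x. (G n x)\<^sup>2 \<partial>M") auto
    have gL: "L2 M g"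
    proof -
      have "(\<integral>\<^sup>+x. (G n x)\<^sup>2 \<partial>M) \<le> ennreal ((sqrt d)\<^sup>2)" using d by simp
      from L2_ennreal_bound(2)[OF _ this] d show ?thesis by (simp add: g_def[abs_def])
    qed
    have sq: "(\<integral>\<^sup>+x. (G n x)\<^sup>2 \<partial>M) = ennreal ((nrm M g)\<^sup>2)"
      using nn_integral_L2[OF gL] by (simp add: gG)
    have "(\<integral>\<^sup>+x. (G n x)\<^sup>2 \<partial>M) \<le> (\<integral>\<^sup>+x. ?F x * ennreal (cmod (g x)) \<partial>M)"
      unfolding gG power2_eq_square by (intro nn_integral_mono mult_right_mono Gle) auto
    also have "\<dots> \<le> ennreal (?c * nrm M g)"
      using kboundD[OF a f gL] by simp
    finally have "(nrm M g)\<^sup>2 \<le> ?c * nrm M g"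
      unfolding sq using c by (simp add: ennreal_le_iff)
    then have "nrm M g \<le> ?c"
      using nrm_nonneg[of M g] c by (cases "nrm M g = 0") (auto simp: power2_eq_square)
    then show ?thesis unfolding sq by (intro ennreal_leI power_mono) auto
  qed
  have lim: "(\<lambda>n. (G n x)\<^sup>2) \<longlonglongrightarrow> (?F x)\<^sup>2" if x: "x \<in> space M" for x
  proof -
    obtain N where N: "x \<in> X N" using X(2) x by auto
    have "\<forall>\<^sub>F n in sequentially. G n x = min (?F x) (of_nat n)"
      using eventually_ge_at_top[of N]
    proof eventually_elim
      case (elim n)
      then have "x \<in> X n" using N incseqD[OF X(4)] by auto
      then show ?case by (simp add: G_def)
    qed
    moreover have "(\<lambda>n. min (?F x) (of_nat n)) \<longlonglongrightarrow> min (?F x) top"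
      by (intro tendsto_min tendsto_const of_nat_tendsto_top_ennreal)
    ultimately have "(\<lambda>n. G n x) \<longlonglongrightarrow> min (?F x) top"
      using tendsto_cong by fast
    then have "(\<lambda>n. G n x) \<longlonglongrightarrow> ?F x" by (simp add: min_absorb1)
    then show ?thesis unfolding power2_eq_square
      by (intro tendsto_mult_ennreal) auto
  qed
  have "(\<integral>\<^sup>+x. (?F x)\<^sup>2 \<partial>M) = (\<integral>\<^sup>+x. liminf (\<lambda>n. (G n x)\<^sup>2) \<partial>M)"
    by (intro nn_integral_cong lim_imp_Liminf[OF sequentially_bot, symmetric] lim)
  also have "\<dots> \<le> liminf (\<lambda>n. \<integral>\<^sup>+x. (G n x)\<^sup>2 \<partial>M)"
    by (intro nn_integral_liminf) measurable
  also have "\<dots> \<le> liminf (\<lambda>n::nat. ennreal (?c\<^sup>2))"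
    by (intro Liminf_mono always_eventually allI bound)
  also have "\<dots> = ennreal (?c\<^sup>2)" by (simp add: Liminf_const)
  finally show ?thesis .
qed

lemma kboundI_kabs:
  assumes a: "kernel M a" and C: "0 \<le> C"
    and le: "\<And>f. L2 M f \<Longrightarrow> (\<integral>\<^sup>+x. (kabs M a f x)\<^sup>2 \<partial>M) \<le> ennreal ((C * nrm M f)\<^sup>2)"
  shows "kbound M a C"
  unfolding kbound_def
proof (intro conjI allI impI a C)
  fix f g assume f: "L2 M f" and g: "L2 M g"
  let ?h = "\<lambda>x. complex_of_real (enn2real (kabs M a f x))"
  have m: "kabs M a f \<in> borel_measurable M"
    by (intro kabs_measurable a L2_measurable[OF f])
  have c: "0 \<le> C * nrm M f" using C by simp
  note h = L2_ennreal_bound[OF m le[OF f] c]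
  have "(\<integral>\<^sup>+x. kabs M a f x * ennreal (cmod (g x)) \<partial>M) = (\<integral>\<^sup>+x. ennreal (cmod (?h x) * cmod (g x)) \<partial>M)"
    using h(1) by (intro nn_integral_cong_AE) (auto simp: ennreal_mult elim!: eventually_mono)
  also have "\<dots> \<le> ennreal (nrm M ?h * nrm M g)" by (rule L2_Cauchy_Schwarz_nn[OF h(2) g])
  also have "\<dots> \<le> ennreal (C * nrm M f * nrm M g)"
    using h(3) by (intro ennreal_leI mult_right_mono) auto
  finally show "(\<integral>\<^sup>+x. kabs M a f x * ennreal (cmod (g x)) \<partial>M) \<le> ennreal (C * nrm M f * nrm M g)" .
qed

text \<open>\<open>kabs\<close> as a vector of L2, with value 0 on the null set where
  \<open>kabs\<close> is infinite.\<close>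

definition kmap :: "'a kernel \<Rightarrow> ('a \<Rightarrow> complex) \<Rightarrow> 'a \<Rightarrow> complex" where
  "kmap a f x = complex_of_real (enn2real (kabs M a f x))"

lemma kmap:
  assumes a: "kbound M a C" and f: "L2 M f"
  shows "AE x in M. kabs M a f x < \<infinity>" "L2 M (kmap a f)" "nrm M (kmap a f) \<le> C * nrm M f"
    "AE x in M. ennreal (cmod (kmap a f x)) = kabs M a f x"
proof -
  have m: "kabs M a f \<in> borel_measurable M"
    by (intro kabs_measurable kbound_kernel[OF a] L2_measurable[OF f])
  have c: "0 \<le> C * nrm M f" using kbound_nonneg[OF a] by simp
  note h = L2_ennreal_bound[OF m kbound_kabs[OF a f] c]
  show "AE x in M. kabs M a f x < \<infinity>" by (rule h)
  then show "AE x in M. ennreal (cmod (kmap a f x)) = kabs M a f x"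
    by eventually_elim (simp add: kmap_def)
  show "L2 M (kmap a f)" "nrm M (kmap a f) \<le> C * nrm M f"
    using h(2,3) by (simp_all add: kmap_def[abs_def])
qed

lemma kbound_integrable:
  assumes a: "kbound M a C" and f: "L2 M f"
  shows "AE x in M. integrable M (\<lambda>y. complex_of_real (a x y) * f y)"
  using kmap(1)[OF a f] AE_space
proof eventually_elim
  fix x assume x: "kabs M a f x < \<infinity>" "x \<in> space M"
  note [measurable] = kernel_measurable[OF kbound_kernel[OF a]] L2_measurable[OF f]
  show "integrable M (\<lambda>y. complex_of_real (a x y) * f y)"
  proof (rule integrableI_bounded)
    show "(\<lambda>y. complex_of_real (a x y) * f y) \<in> borel_measurable M"
      using x by measurable
    show "(\<integral>\<^sup>+y. ennreal (norm (complex_of_real (a x y) * f y)) \<partial>M) < \<infinity>"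
      using x kernel_nonneg[OF kbound_kernel[OF a]] by (simp add: kabs_def norm_mult)
  qed
qed

lemma kop_measurable:
  assumes "case_prod a \<in> borel_measurable (M \<Otimes>\<^sub>M M)" "f \<in> borel_measurable M"
  shows "kop M a f \<in> borel_measurable M"
proof -
  note [measurable] = assms
  show ?thesis unfolding kop_def by measurable
qed

lemma kop_bound:
  assumes a: "kbound M a C" and f: "L2 M f"
  shows "L2 M (kop M a f)" "nrm M (kop M a f) \<le> C * nrm M f"
    "AE x in M. cmod (kop M a f x) \<le> cmod (kmap a f x)"
proof -
  show ae: "AE x in M. cmod (kop M a f x) \<le> cmod (kmap a f x)"
    using kmap(4)[OF a f]
  proof eventually_elim
    fix x assume "ennreal (cmod (kmap a f x)) = kabs M a f x"
    then have "ennreal (cmod (kop M a f x)) \<le> ennreal (cmod (kmap a f x))"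
      using cmod_kop_le[OF kbound_kernel[OF a], of f x] by simp
    then show "cmod (kop M a f x) \<le> cmod (kmap a f x)" by (simp add: ennreal_le_iff)
  qed
  have m: "kop M a f \<in> borel_measurable M"
    by (intro kop_measurable kernel_measurable[OF kbound_kernel[OF a]] L2_measurable[OF f])
  show "L2 M (kop M a f)" by (rule L2_dominated[OF m kmap(2)[OF a f] ae])
  show "nrm M (kop M a f) \<le> C * nrm M f"
    using nrm_mono[OF m kmap(2)[OF a f] ae] kmap(3)[OF a f] by simp
qed

lemma kop_cong_arg:
  assumes a: "case_prod a \<in> borel_measurable (M \<Otimes>\<^sub>M M)"
    and "f \<in> borel_measurable M" "g \<in> borel_measurable M" "AE x in M. f x = g x" "x \<in> space M"
  shows "kop M a f x = kop M a g x"
proof -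
  note [measurable] = a assms(2,3)
  show ?thesis unfolding kop_def
    by (intro integral_cong_AE) (use assms(4,5) in \<open>auto elim: eventually_mono\<close>)
qed

lemma blin_kop:
  assumes a: "kbound M a C"
  shows "blin M (kop M a)"
  unfolding blin_def
proof (intro conjI allI impI)
  show "AE x in M. kop M a f x = kop M a g x" if "L2 M f" "L2 M g" "AE x in M. f x = g x" for f g
    by (intro AE_I2 kop_cong_arg kernel_measurable[OF kbound_kernel[OF a]] L2_measurable that)
  show "AE x in M. kop M a (\<lambda>y. c * f y + g y) x = c * kop M a f x + kop M a g x"
    if f: "L2 M f" and g: "L2 M g" for c f g
    using kbound_integrable[OF a f] kbound_integrable[OF a g]
  proof eventually_elim
    fix x assume i: "integrable M (\<lambda>y. complex_of_real (a x y) * f y)" "integrable M (\<lambda>y. complex_of_real (a x y) * g y)"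
    have "kop M a (\<lambda>y. c * f y + g y) x = (LINT y|M. c * (complex_of_real (a x y) * f y) + complex_of_real (a x y) * g y)"
      by (simp add: kop_def algebra_simps)
    also have "\<dots> = c * kop M a f x + kop M a g x"
      using i by (simp add: kop_def)
    finally show "kop M a (\<lambda>y. c * f y + g y) x = c * kop M a f x + kop M a g x" .
  qed
qed (use kop_bound[OF a] in auto)

text \<open>Testing on the modulus of \<open>f\<close> suffices: on nonnegative functions the
  Bochner integral and \<open>kabs\<close> agree, and the modulus has the same norm.\<close>

lemma kboundI_kop:
  assumes a: "kernel M a"
    and i: "\<And>f. L2 M f \<Longrightarrow> AE x in M. integrable M (\<lambda>y. complex_of_real (a x y) * f y)"
    and L: "\<And>f. L2 M f \<Longrightarrow> L2 M (kop M a f)"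
    and le: "\<And>f. L2 M f \<Longrightarrow> nrm M (kop M a f) \<le> C * nrm M f"
    and C: "0 \<le> C"
  shows "kbound M a C"
proof (rule kboundI_kabs[OF a C])
  fix f assume f: "L2 M f"
  let ?f = "\<lambda>x. complex_of_real (cmod (f x))"
  have f': "L2 M ?f" by (rule L2_cmod[OF f])
  have "AE x in M. kabs M a f x = ennreal (cmod (kop M a ?f x))"
    using i[OF f']
  proof eventually_elim
    fix x assume "integrable M (\<lambda>y. complex_of_real (a x y) * ?f y)"
    then have "integrable M (\<lambda>y. complex_of_real (a x y * cmod (f y)))" by simp
    then have int: "integrable M (\<lambda>y. a x y * cmod (f y))"
      by (simp only: complex_of_real_integrable_eq)
    have "kop M a ?f x = complex_of_real (LINT y|M. a x y * cmod (f y))"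
      unfolding kop_def by (simp flip: of_real_mult)
    moreover have "0 \<le> (LINT y|M. a x y * cmod (f y))"
      using kernel_nonneg[OF a] by (intro integral_nonneg_AE) auto
    ultimately show "kabs M a f x = ennreal (cmod (kop M a ?f x))"
      unfolding kabs_def using nn_integral_eq_integral[OF int] kernel_nonneg[OF a] by simp
  qed
  then have "(\<integral>\<^sup>+x. (kabs M a f x)\<^sup>2 \<partial>M) = (\<integral>\<^sup>+x. (ennreal (cmod (kop M a ?f x)))\<^sup>2 \<partial>M)"
    by (intro nn_integral_cong_AE) (auto elim: eventually_mono)
  also have "\<dots> = ennreal ((nrm M (kop M a ?f))\<^sup>2)" by (rule nn_integral_L2[OF L[OF f']])
  also have "\<dots> \<le> ennreal ((C * nrm M ?f)\<^sup>2)"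
    by (intro ennreal_leI power_mono le f') simp
  also have "nrm M ?f = nrm M f" by (simp add: nrm_def)
  finally show "(\<integral>\<^sup>+x. (kabs M a f x)\<^sup>2 \<partial>M) \<le> ennreal ((C * nrm M f)\<^sup>2)" .
qed

lemma kernel_ktrans: "kernel M a \<Longrightarrow> kernel M (ktrans a)"
  unfolding kernel_def ktrans_def using measurable_pair_swap[of "case_prod a" M M borel]
  by (simp add: case_prod_beta')

lemma kform_ktrans:
  assumes a: "kernel M a" and f: "f \<in> borel_measurable M" and g: "g \<in> borel_measurable M"
  shows "(\<integral>\<^sup>+x. kabs M (ktrans a) g x * ennreal (cmod (f x)) \<partial>M) = (\<integral>\<^sup>+x. kabs M a f x * ennreal (cmod (g x)) \<partial>M)"
proof -
  note [measurable] = kernel_measurable[OF a] f g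
  have nn: "0 \<le> a x y" for x y using kernel_nonneg[OF a] .
  have "(\<integral>\<^sup>+x. kabs M (ktrans a) g x * ennreal (cmod (f x)) \<partial>M)
      = (\<integral>\<^sup>+x. \<integral>\<^sup>+y. ennreal (a y x * cmod (g y) * cmod (f x)) \<partial>M \<partial>M)"
    unfolding kabs_def ktrans_def
    by (intro nn_integral_cong) (simp add: ennreal_mult nn nn_integral_multc)
  also have "\<dots> = (\<integral>\<^sup>+y. \<integral>\<^sup>+x. ennreal (a y x * cmod (g y) * cmod (f x)) \<partial>M \<partial>M)"
    by (rule MM.Fubini') measurable
  also have "\<dots> = (\<integral>\<^sup>+y. \<integral>\<^sup>+x. ennreal (a y x * cmod (f x)) * ennreal (cmod (g y)) \<partial>M \<partial>M)"
    by (intro nn_integral_cong) (simp add: ennreal_mult nn mult_ac)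
  also have "\<dots> = (\<integral>\<^sup>+y. kabs M a f y * ennreal (cmod (g y)) \<partial>M)"
    unfolding kabs_def by (intro nn_integral_cong) (simp add: nn_integral_multc)
  finally show ?thesis .
qed

lemma kbound_ktrans:
  assumes a: "kbound M a C"
  shows "kbound M (ktrans a) C"
  unfolding kbound_def
proof (intro conjI allI impI kernel_ktrans kbound_kernel[OF a] kbound_nonneg[OF a])
  fix f g assume f: "L2 M f" and g: "L2 M g"
  show "(\<integral>\<^sup>+x. kabs M (ktrans a) f x * ennreal (cmod (g x)) \<partial>M) \<le> ennreal (C * nrm M f * nrm M g)"
    using kboundD[OF a g f] kform_ktrans[OF kbound_kernel[OF a] L2_measurable[OF g] L2_measurable[OF f]]
    by (simp add: mult_ac)
qed

lemma AE_AE_pair: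
  assumes "AE z in M \<Otimes>\<^sub>M M. P (fst z) (snd z)"
  shows "AE x in M. AE y in M. P x y"
  using MM.AE_pair[OF assms] by simp

lemma kbound_mono:
  assumes b: "kbound M b C" and a: "kernel M a" and le: "AE x in M. AE y in M. a x y \<le> b x y"
  shows "kbound M a C"
proof (rule kboundI_kabs[OF a kbound_nonneg[OF b]])
  fix f assume f: "L2 M f"
  have "AE x in M. kabs M a f x \<le> kabs M b f x"
    using le
  proof eventually_elim
    fix x assume "AE y in M. a x y \<le> b x y"
    then show "kabs M a f x \<le> kabs M b f x"
      unfolding kabs_def
      by (intro nn_integral_mono_AE) (auto elim!: eventually_mono intro!: ennreal_leI mult_right_mono)
  qed
  then have "(\<integral>\<^sup>+x. (kabs M a f x)\<^sup>2 \<partial>M) \<le> (\<integral>\<^sup>+x. (kabs M b f x)\<^sup>2 \<partial>M)"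
    by (intro nn_integral_mono_AE) (auto elim!: eventually_mono intro!: power_mono)
  also have "\<dots> \<le> ennreal ((C * nrm M f)\<^sup>2)" by (rule kbound_kabs[OF b f])
  finally show "(\<integral>\<^sup>+x. (kabs M a f x)\<^sup>2 \<partial>M) \<le> ennreal ((C * nrm M f)\<^sup>2)" .
qed

lemma kop_cong_kernel:
  assumes "case_prod a \<in> borel_measurable (M \<Otimes>\<^sub>M M)" "case_prod b \<in> borel_measurable (M \<Otimes>\<^sub>M M)"
    and ae: "AE x in M. AE y in M. a x y = b x y" and f: "f \<in> borel_measurable M"
  shows "AE x in M. kop M a f x = kop M b f x"
  using ae AE_space
proof eventually_elim
  fix x assume x: "AE y in M. a x y = b x y" "x \<in> space M"
  note [measurable] = assms(1,2) f
  show "kop M a f x = kop M b f x"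
    unfolding kop_def by (intro integral_cong_AE) (use x in \<open>auto elim: eventually_mono\<close>)
qed

text \<open>Sigma-finiteness provides a test vector vanishing nowhere; integrating a kernel against
  it detects where the kernel is infinite.\<close>

lemma L2_positive_ex: "\<exists>f. L2 M f \<and> (\<forall>x\<in>space M. f x \<noteq> 0)"
proof -
  obtain h where h[measurable]: "h \<in> borel_measurable M" and hi: "integral\<^sup>N M h \<noteq> \<infinity>"
    and hp: "\<And>x. x \<in> space M \<Longrightarrow> 0 < h x \<and> h x < \<infinity>"
    using Ex_finite_integrable_function by blast
  define f where "f x = complex_of_real (sqrt (enn2real (h x)))" for x
  have fm: "f \<in> borel_measurable M" unfolding f_def by measurable
  have "(\<integral>\<^sup>+x. ennreal ((cmod (f x))\<^sup>2) \<partial>M) = integral\<^sup>N M h"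
    using hp by (intro nn_integral_cong) (simp add: f_def)
  also have "\<dots> = ennreal ((sqrt (enn2real (integral\<^sup>N M h)))\<^sup>2)"
    using hi by (simp add: less_top)
  finally have "L2 M f" using L2_nn_integralI(1)[OF fm, of "sqrt (enn2real (integral\<^sup>N M h))"] by simp
  moreover have "f x \<noteq> 0" if "x \<in> space M" for x
    using hp[OF that] by (auto simp: f_def enn2real_eq_0_iff less_top)
  ultimately show ?thesis by blast
qed

end

lemma L2_cong_AE:
  assumes "f \<in> borel_measurable M" "L2 M g" "AE x in M. f x = g x"
  shows "L2 M f"
  by (rule L2_dominated[OF assms(1,2)]) (use assms(3) in \<open>auto elim: eventually_mono\<close>)

context sigma_finite_measure
begin

interpretation MM: pair_sigma_finite M M ..

subsection \<open>Composition of kernels\<close>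

lemma kernel_kcomp:
  assumes "kernel M a" "kernel M b"
  shows "kernel M (kcomp M a b)"
proof -
  note [measurable] = kernel_measurable[OF assms(1)] kernel_measurable[OF assms(2)]
  have "(\<lambda>(x, z). enn2real (\<integral>\<^sup>+y. ennreal (a x y * b y z) \<partial>M)) \<in> borel_measurable (M \<Otimes>\<^sub>M M)"
    by measurable
  then show ?thesis by (simp add: kernel_def kcomp_def)
qed

lemma kcomp_Tonelli:
  assumes a: "kernel M a" and b: "kbound M b D" and f: "L2 M f" and x: "x \<in> space M"
  shows "(\<integral>\<^sup>+z. (\<integral>\<^sup>+y. ennreal (a x y * b y z) \<partial>M) * ennreal (cmod (f z)) \<partial>M) = kabs M a (kmap b f) x"
    and "(\<integral>\<^sup>+y. \<integral>\<^sup>+z. ennreal (a x y * b y z * cmod (f z)) \<partial>M \<partial>M) = kabs M a (kmap b f) x"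
proof -
  note [measurable] = kernel_measurable[OF a] kernel_measurable[OF kbound_kernel[OF b]] L2_measurable[OF f] x
  have nn: "0 \<le> a x y" "0 \<le> b x y" for x y
    using kernel_nonneg[OF a] kernel_nonneg[OF kbound_kernel[OF b]] by auto
  have "(\<integral>\<^sup>+z. (\<integral>\<^sup>+y. ennreal (a x y * b y z) \<partial>M) * ennreal (cmod (f z)) \<partial>M)
      = (\<integral>\<^sup>+z. \<integral>\<^sup>+y. ennreal (a x y * b y z * cmod (f z)) \<partial>M \<partial>M)"
    by (intro nn_integral_cong) (simp add: nn ennreal_mult nn_integral_multc)
  also have "\<dots> = (\<integral>\<^sup>+y. \<integral>\<^sup>+z. ennreal (a x y * b y z * cmod (f z)) \<partial>M \<partial>M)"
    by (rule MM.Fubini') measurable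
  finally have 1: "(\<integral>\<^sup>+z. (\<integral>\<^sup>+y. ennreal (a x y * b y z) \<partial>M) * ennreal (cmod (f z)) \<partial>M)
      = (\<integral>\<^sup>+y. \<integral>\<^sup>+z. ennreal (a x y * b y z * cmod (f z)) \<partial>M \<partial>M)" .
  have "(\<integral>\<^sup>+y. \<integral>\<^sup>+z. ennreal (a x y * b y z * cmod (f z)) \<partial>M \<partial>M) = (\<integral>\<^sup>+y. ennreal (a x y) * kabs M b f y \<partial>M)"
    unfolding kabs_def
    by (intro nn_integral_cong) (simp add: nn ennreal_mult mult.assoc nn_integral_cmult)
  also have "\<dots> = kabs M a (kmap b f) x"
    unfolding kabs_def[of M a] using kmap(4)[OF b f]
    by (intro nn_integral_cong_AE) (auto elim!: eventually_mono simp: ennreal_mult nn)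
  finally show 2: "(\<integral>\<^sup>+y. \<integral>\<^sup>+z. ennreal (a x y * b y z * cmod (f z)) \<partial>M \<partial>M) = kabs M a (kmap b f) x" .
  show "(\<integral>\<^sup>+z. (\<integral>\<^sup>+y. ennreal (a x y * b y z) \<partial>M) * ennreal (cmod (f z)) \<partial>M) = kabs M a (kmap b f) x"
    using 1 2 by simp
qed

text \<open>Tonelli turns the composite kernel, integrated against a nowhere vanishing vector
  \<open>f\<close>, into the action of \<open>a\<close> on \<open>kmap b f\<close>, which is finite
  almost everywhere; so the composite kernel is finite almost everywhere too.\<close>

lemma kcomp_finite:
  assumes a: "kbound M a C" and b: "kbound M b D"
  shows "AE x in M. AE z in M. (\<integral>\<^sup>+y. ennreal (a x y * b y z) \<partial>M) < \<infinity>"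
proof -
  note [measurable] = kernel_measurable[OF kbound_kernel[OF a]] kernel_measurable[OF kbound_kernel[OF b]]
  obtain f where f: "L2 M f" "\<And>x. x \<in> space M \<Longrightarrow> f x \<noteq> 0" using L2_positive_ex by blast
  note [measurable] = L2_measurable[OF f(1)]
  show ?thesis
    using kmap(1)[OF a kmap(2)[OF b f(1)]] AE_space
  proof eventually_elim
    fix x assume x: "kabs M a (kmap b f) x < \<infinity>" "x \<in> space M"
    note [measurable] = x(2)
    have "AE z in M. (\<integral>\<^sup>+y. ennreal (a x y * b y z) \<partial>M) * ennreal (cmod (f z)) \<noteq> \<infinity>"
      by (intro nn_integral_PInf_AE)
        (use x kcomp_Tonelli(1)[OF kbound_kernel[OF a] b f(1) x(2)] in \<open>auto simp: less_top\<close>)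
    then show "AE z in M. (\<integral>\<^sup>+y. ennreal (a x y * b y z) \<partial>M) < \<infinity>"
      using AE_space
    proof eventually_elim
      fix z assume *: "(\<integral>\<^sup>+y. ennreal (a x y * b y z) \<partial>M) * ennreal (cmod (f z)) \<noteq> \<infinity>" "z \<in> space M"
      have "ennreal (cmod (f z)) \<noteq> 0" using f(2)[OF *(2)] by simp
      with *(1) show "(\<integral>\<^sup>+y. ennreal (a x y * b y z) \<partial>M) < \<infinity>"
        by (auto simp: less_top ennreal_mult_eq_top_iff)
    qed
  qed
qed

lemma kbound_kcomp:
  assumes a: "kbound M a C" and b: "kbound M b D"
  shows "kbound M (kcomp M a b) (C * D)"
proof (rule kboundI_kabs)
  note ka = kbound_kernel[OF a] and kb = kbound_kernel[OF b]
  show "kernel M (kcomp M a b)" by (rule kernel_kcomp[OF ka kb])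
  show "0 \<le> C * D" using kbound_nonneg[OF a] kbound_nonneg[OF b] by simp
  fix f assume f: "L2 M f"
  have "(\<integral>\<^sup>+x. (kabs M (kcomp M a b) f x)\<^sup>2 \<partial>M) \<le> (\<integral>\<^sup>+x. (kabs M a (kmap b f) x)\<^sup>2 \<partial>M)"
  proof (intro nn_integral_mono power_mono)
    fix x assume x: "x \<in> space M"
    have "kabs M (kcomp M a b) f x \<le> (\<integral>\<^sup>+z. (\<integral>\<^sup>+y. ennreal (a x y * b y z) \<partial>M) * ennreal (cmod (f z)) \<partial>M)"
      unfolding kabs_def
    proof (intro nn_integral_mono)
      fix z
      have "ennreal (enn2real u) \<le> u" for u by (cases u) auto
      then show "ennreal (kcomp M a b x z * cmod (f z)) \<le> (\<integral>\<^sup>+y. ennreal (a x y * b y z) \<partial>M) * ennreal (cmod (f z))"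
        by (simp add: kcomp_def ennreal_mult mult_right_mono)
    qed
    then show "kabs M (kcomp M a b) f x \<le> kabs M a (kmap b f) x"
      using kcomp_Tonelli(1)[OF ka b f x] by simp
  qed simp
  also have "\<dots> \<le> ennreal ((C * nrm M (kmap b f))\<^sup>2)"
    by (rule kbound_kabs[OF a kmap(2)[OF b f]])
  also have "\<dots> \<le> ennreal ((C * D * nrm M f)\<^sup>2)"
    using kmap(3)[OF b f] kbound_nonneg[OF a]
    by (intro ennreal_leI power_mono) (auto simp: mult.assoc intro!: mult_left_mono)
  finally show "(\<integral>\<^sup>+x. (kabs M (kcomp M a b) f x)\<^sup>2 \<partial>M) \<le> ennreal ((C * D * nrm M f)\<^sup>2)" .
qed

lemma kop_kcomp:
  assumes a: "kbound M a C" and b: "kbound M b D" and f: "L2 M f"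
  shows "AE x in M. kop M (kcomp M a b) f x = kop M a (kop M b f) x"
  using kmap(1)[OF a kmap(2)[OF b f]] AE_space
proof eventually_elim
  fix x assume x: "kabs M a (kmap b f) x < \<infinity>" "x \<in> space M"
  note ka = kbound_kernel[OF a] and kb = kbound_kernel[OF b]
  note [measurable] = kernel_measurable[OF ka] kernel_measurable[OF kb] L2_measurable[OF f] x(2)
  have nn: "0 \<le> a x y" "0 \<le> b x y" for x y
    using kernel_nonneg[OF ka] kernel_nonneg[OF kb] by auto
  let ?G = "\<lambda>y z. complex_of_real (a x y * b y z) * f z"
  have int: "integrable (M \<Otimes>\<^sub>M M) (\<lambda>(y, z). ?G y z)"
  proof (rule integrableI_bounded)
    show "(\<lambda>(y, z). ?G y z) \<in> borel_measurable (M \<Otimes>\<^sub>M M)" by measurable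
    have "(\<integral>\<^sup>+p. ennreal (norm (case p of (y, z) \<Rightarrow> ?G y z)) \<partial>(M \<Otimes>\<^sub>M M))
        = (\<integral>\<^sup>+y. \<integral>\<^sup>+z. ennreal (a x y * b y z * cmod (f z)) \<partial>M \<partial>M)"
      by (subst nn_integral_fst[symmetric]) (auto simp: norm_mult nn)
    also have "\<dots> < \<infinity>" using kcomp_Tonelli(2)[OF ka b f x(2)] x by simp
    finally show "(\<integral>\<^sup>+p. ennreal (norm (case p of (y, z) \<Rightarrow> ?G y z)) \<partial>(M \<Otimes>\<^sub>M M)) < \<infinity>" .
  qed
  have "kop M (kcomp M a b) f x = (LINT z|M. LINT y|M. ?G y z)"
    unfolding kop_def
  proof (intro Bochner_Integration.integral_cong refl)
    fix z assume [measurable]: "z \<in> space M"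
    \<comment> \<open>True without finiteness: where the nonnegative integral is infinite,
      \<open>enn2real\<close> and the Bochner integral both return 0.\<close>
    have "kcomp M a b x z = (LINT y|M. a x y * b y z)"
      unfolding kcomp_def by (rule integral_eq_nn_integral[symmetric]) (auto simp: nn)
    then show "complex_of_real (kcomp M a b x z) * f z = (LINT y|M. ?G y z)"
      by (simp flip: of_real_mult)
  qed
  also have "\<dots> = (LINT y|M. LINT z|M. ?G y z)"
    by (rule MM.Fubini_integral[OF int])
  also have "\<dots> = kop M a (kop M b f) x"
    unfolding kop_def by (simp add: mult.assoc)
  finally show "kop M (kcomp M a b) f x = kop M a (kop M b f) x" .
qed

lemma ktrans_kcomp: "ktrans (kcomp M a b) = kcomp M (ktrans b) (ktrans a)"
  by (simp add: ktrans_def kcomp_def mult.commute)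

lemma ktrans_ktrans [simp]: "ktrans (ktrans a) = a"
  by (simp add: ktrans_def)

subsection \<open>Operators represented by a nonnegative kernel\<close>

text \<open>The operators in the product sets are compositions of maps on functions and not
  literally of the form \<open>kop M a\<close>. They agree with such an operator almost everywhere
  on L2, which is enough for \<open>gamma_op\<close>.\<close>

definition represents :: "'a op \<Rightarrow> 'a kernel \<Rightarrow> bool" where
  "represents T a \<longleftrightarrow> blin M T \<and> (\<exists>C. kbound M a C) \<and> (\<forall>f. L2 M f \<longrightarrow> (AE x in M. T f x = kop M a f x))"

lemma represents_blin: "represents T a \<Longrightarrow> blin M T"
  by (simp add: represents_def)

lemma represents_gamma:
  assumes "represents T a"
  shows "gamma_op M T = gamma_op M (kop M a)"
  using assms blin_kop by (intro gamma_op_cong) (auto simp: represents_def)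

lemma represents_kop: "kbound M a C \<Longrightarrow> represents (kop M a) a"
  by (auto simp: represents_def blin_kop)

lemma represents_comp:
  assumes S: "represents S a" and T: "represents T b"
  shows "represents (S \<circ> T) (kcomp M a b)"
proof -
  obtain C D where a: "kbound M a C" and b: "kbound M b D"
    using S T by (auto simp: represents_def)
  have bl: "blin M S" "blin M T" using S T by (auto simp: represents_def)
  show ?thesis unfolding represents_def
  proof (intro conjI exI allI impI)
    show "blin M (S \<circ> T)" using blin_comp[OF bl] by (simp add: o_def)
    show "kbound M (kcomp M a b) (C * D)" by (rule kbound_kcomp[OF a b])
    fix f assume f: "L2 M f"
    have Tf: "L2 M (T f)" and bf: "L2 M (kop M b f)"
      using blin_L2[OF bl(2) f] kop_bound(1)[OF b f] by auto
    have "AE x in M. T f x = kop M b f x" using T f by (simp add: represents_def)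
    then have "AE x in M. S (T f) x = S (kop M b f) x"
      by (rule blin_cong_AE[OF bl(1) Tf bf])
    moreover have "AE x in M. S (kop M b f) x = kop M a (kop M b f) x"
      using S bf by (simp add: represents_def)
    ultimately show "AE x in M. (S \<circ> T) f x = kop M (kcomp M a b) f x"
      using kop_kcomp[OF a b f] by eventually_elim simp
  qed
qed

lemma represents_cong_kernel:
  assumes "kbound M b C" "case_prod a \<in> borel_measurable (M \<Otimes>\<^sub>M M)" "AE x in M. AE y in M. a x y = b x y"
  shows "represents (kop M a) b"
proof -
  have eq: "AE x in M. kop M a f x = kop M b f x" if f: "L2 M f" for f
    by (rule kop_cong_kernel[OF assms(2) kernel_measurable[OF kbound_kernel[OF assms(1)]] assms(3) L2_measurable[OF f]])
  have L: "L2 M (kop M a f)" if f: "L2 M f" for f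
    by (rule L2_cong_AE[OF kop_measurable[OF assms(2) L2_measurable[OF f]] kop_bound(1)[OF assms(1) f] eq[OF f]])
  have "blin M (kop M a)" by (rule blin_cong[OF blin_kop[OF assms(1)] L eq])
  then show ?thesis using eq assms(1) by (auto simp: represents_def)
qed

text \<open>Changes a kernel of a positive kernel operator only on a null set and makes it fit
  \<open>kernel\<close>.\<close>

definition kplus :: "'a kernel \<Rightarrow> 'a kernel" where
  "kplus a = (\<lambda>x y. max 0 (a x y))"

lemma pos_kernel_op_measurable: "pos_kernel_op M a \<Longrightarrow> case_prod a \<in> borel_measurable (M \<Otimes>\<^sub>M M)"
  by (simp add: pos_kernel_op_def case_prod_beta')

lemma kernel_kplus:
  assumes "case_prod a \<in> borel_measurable (M \<Otimes>\<^sub>M M)"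
  shows "kernel M (kplus a)"
proof -
  note [measurable] = assms
  have "(\<lambda>(x, y). max 0 (a x y)) \<in> borel_measurable (M \<Otimes>\<^sub>M M)" by measurable
  then show ?thesis by (simp add: kernel_def kplus_def)
qed

lemma pos_kernel_op_AE:
  assumes "pos_kernel_op M a"
  shows "AE x in M. AE y in M. a x y = kplus a x y" "AE x in M. AE y in M. a y x = kplus a y x"
proof -
  have ae: "AE z in M \<Otimes>\<^sub>M M. 0 \<le> a (fst z) (snd z)"
    using assms by (simp add: pos_kernel_op_def)
  have 1: "AE x in M. AE y in M. 0 \<le> a x y"
    by (rule AE_AE_pair) (use ae in simp)
  then show "AE x in M. AE y in M. a x y = kplus a x y"
    by (auto simp: kplus_def max_def elim!: eventually_mono)
  note [measurable] = pos_kernel_op_measurable[OF assms]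
  have "AE y in M. AE x in M. 0 \<le> a x y"
    using 1 by (subst MM.AE_commute[symmetric]) auto
  then show "AE x in M. AE y in M. a y x = kplus a y x"
    by (auto simp: kplus_def max_def elim!: eventually_mono)
qed

lemma pos_kernel_op_kbound:
  assumes a: "pos_kernel_op M a" and C: "0 \<le> C" "\<And>f. L2 M f \<Longrightarrow> nrm M (kop M a f) \<le> C * nrm M f"
  shows "kbound M (kplus a) C"
proof (rule kboundI_kop)
  have m: "case_prod a \<in> borel_measurable (M \<Otimes>\<^sub>M M)" by (rule pos_kernel_op_measurable[OF a])
  show k: "kernel M (kplus a)" by (rule kernel_kplus[OF m])
  note [measurable] = m kernel_measurable[OF k]
  fix f assume f: "L2 M f"
  note [measurable] = L2_measurable[OF f]
  have "AE x in M. integrable M (\<lambda>y. complex_of_real (a x y) * f y)"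
    using a f by (simp add: pos_kernel_op_def)
  then show "AE x in M. integrable M (\<lambda>y. complex_of_real (kplus a x y) * f y)"
    using pos_kernel_op_AE(1)[OF a] AE_space
  proof eventually_elim
    fix x assume x: "integrable M (\<lambda>y. complex_of_real (a x y) * f y)" "AE y in M. a x y = kplus a x y" "x \<in> space M"
    show "integrable M (\<lambda>y. complex_of_real (kplus a x y) * f y)"
      using x(1)
      by (rule integrable_cong_AE_imp) (use x(2,3) in \<open>auto elim: eventually_mono\<close>)
  qed
  have eq: "AE x in M. kop M (kplus a) f x = kop M a f x"
    using kop_cong_kernel[OF m kernel_measurable[OF k] pos_kernel_op_AE(1)[OF a] L2_measurable[OF f]]
    by eventually_elim simp
  have La: "L2 M (kop M a f)" using a f by (simp add: pos_kernel_op_def)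
  show L: "L2 M (kop M (kplus a) f)"
    by (rule L2_cong_AE[OF kop_measurable[OF kernel_measurable[OF k] L2_measurable[OF f]] La eq])
  show "nrm M (kop M (kplus a) f) \<le> C * nrm M f"
    using nrm_cong_AE[OF L La eq] C(2)[OF f] by simp
qed (rule C)

lemma pos_kernel_op_represents:
  assumes a: "pos_kernel_op M a" and C: "0 \<le> C" "\<And>f. L2 M f \<Longrightarrow> nrm M (kop M a f) \<le> C * nrm M f"
  shows "represents (kop M a) (kplus a)" "represents (kop M (\<lambda>x y. a y x)) (ktrans (kplus a))"
proof -
  note k = pos_kernel_op_kbound[OF a C]
  have m: "case_prod a \<in> borel_measurable (M \<Otimes>\<^sub>M M)" by (rule pos_kernel_op_measurable[OF a])
  show "represents (kop M a) (kplus a)"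
    by (rule represents_cong_kernel[OF k m pos_kernel_op_AE(1)[OF a]])
  have m': "case_prod (\<lambda>x y. a y x) \<in> borel_measurable (M \<Otimes>\<^sub>M M)"
    using m by measurable
  show "represents (kop M (\<lambda>x y. a y x)) (ktrans (kplus a))"
  proof (rule represents_cong_kernel[OF kbound_ktrans[OF k] m'])
    show "AE x in M. AE y in M. a y x = ktrans (kplus a) x y"
      unfolding ktrans_def by (rule pos_kernel_op_AE(2)[OF a])
  qed
qed

end

section \<open>Kernels dominated by a fixed kernel and tending to zero\<close>

context sigma_finite_measure
begin

interpretation MM: pair_sigma_finite M M ..

lemma kernel_le_kabs:
  assumes "AE y in M. a x y \<le> b x y"
  shows "kabs M a f x \<le> kabs M b f x"
  unfolding kabs_def
  using assms by (intro nn_integral_mono_AE) (auto elim!: eventually_mono intro!: ennreal_leI mult_right_mono)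

lemma kabs_kop_nonneg:
  assumes a: "kbound M a C" and f: "L2 M f" and pos: "\<And>x. f x = complex_of_real (cmod (f x))"
  shows "AE x in M. kop M a f x = kmap a f x"
  using kbound_integrable[OF a f]
proof eventually_elim
  fix x assume i: "integrable M (\<lambda>y. complex_of_real (a x y) * f y)"
  have eq: "complex_of_real (a x y) * f y = complex_of_real (a x y * cmod (f y))" for y
    by (subst pos) simp
  have i': "integrable M (\<lambda>y. a x y * cmod (f y))"
    using i unfolding eq by (simp only: complex_of_real_integrable_eq)
  have nn: "0 \<le> a x y * cmod (f y)" for y
    using kernel_nonneg[OF kbound_kernel[OF a]] by simp
  have "kop M a f x = complex_of_real (LINT y|M. a x y * cmod (f y))"
    unfolding kop_def eq by (simp flip: of_real_mult)
  also have "\<dots> = kmap a f x"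
    unfolding kmap_def kabs_def using nn_integral_eq_integral[OF i'] nn
    by (simp add: integral_nonneg)
  finally show "kop M a f x = kmap a f x" .
qed

text \<open>Dominated convergence twice: in \<open>x\<close> for fixed \<open>y\<close>, dominated
  by the integrand of the adjoint of \<open>t\<close> on the modulus of \<open>g\<close>, and then
  in \<open>y\<close>, dominated by the square of that function.\<close>

lemma kabs_adjoint_tendsto_0:
  assumes t: "kbound M t C" and s: "\<And>n. kernel M (s n)"
    and le: "\<And>n. AE y in M. AE x in M. s n x y \<le> t x y"
    and lim: "AE y in M. AE x in M. (\<lambda>n. s n x y) \<longlonglongrightarrow> 0" and g: "L2 M g"
  shows "(\<lambda>n. \<integral>\<^sup>+y. (kabs M (ktrans (s n)) g y)\<^sup>2 \<partial>M) \<longlonglongrightarrow> 0"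
proof -
  note [measurable] = L2_measurable[OF g] kernel_measurable[OF s] kernel_measurable[OF kbound_kernel[OF t]]
  note t' = kbound_ktrans[OF t]
  have [measurable]: "kabs M (ktrans (s n)) g \<in> borel_measurable M" "kabs M (ktrans t) g \<in> borel_measurable M" for n
    by (intro kabs_measurable kernel_ktrans s kbound_kernel[OF t] L2_measurable[OF g])+
  have ae_le: "AE y in M. kabs M (ktrans (s n)) g y \<le> kabs M (ktrans t) g y" for n
    using le[of n] by eventually_elim (auto intro: kernel_le_kabs simp: ktrans_def)
  have le_all: "AE y in M. \<forall>n. AE x in M. s n x y \<le> t x y"
    using le by (simp add: AE_all_countable)
  have "(\<lambda>n. \<integral>\<^sup>+y. (kabs M (ktrans (s n)) g y)\<^sup>2 \<partial>M) \<longlonglongrightarrow> (\<integral>\<^sup>+y. 0 \<partial>M)"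
  proof (rule nn_integral_dominated_convergence[where w = "\<lambda>y. (kabs M (ktrans t) g y)\<^sup>2"])
    show "AE y in M. (kabs M (ktrans (s n)) g y)\<^sup>2 \<le> (kabs M (ktrans t) g y)\<^sup>2" for n
      using ae_le[of n] by eventually_elim (simp add: power_mono)
    show "(\<integral>\<^sup>+y. (kabs M (ktrans t) g y)\<^sup>2 \<partial>M) < \<infinity>"
      using kbound_kabs[OF t' g] by (rule le_less_trans) simp
    show "AE y in M. (\<lambda>n. (kabs M (ktrans (s n)) g y)\<^sup>2) \<longlonglongrightarrow> 0"
      using lim le_all kmap(1)[OF t' g] AE_space
    proof eventually_elim
      fix y assume y: "AE x in M. (\<lambda>n. s n x y) \<longlonglongrightarrow> 0" "\<forall>n. AE x in M. s n x y \<le> t x y"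
        "kabs M (ktrans t) g y < \<infinity>" "y \<in> space M"
      note [measurable] = y(4)
      have "(\<lambda>n. kabs M (ktrans (s n)) g y) \<longlonglongrightarrow> (\<integral>\<^sup>+x. 0 \<partial>M)"
        unfolding kabs_def ktrans_def
      proof (rule nn_integral_dominated_convergence[where w = "\<lambda>x. ennreal (t x y * cmod (g x))"])
        show "AE x in M. ennreal (s n x y * cmod (g x)) \<le> ennreal (t x y * cmod (g x))" for n
          using y(2)[rule_format, of n] by eventually_elim (intro ennreal_leI mult_right_mono; simp)
        show "(\<integral>\<^sup>+x. ennreal (t x y * cmod (g x)) \<partial>M) < \<infinity>"
          using y(3) by (simp add: kabs_def ktrans_def)
        show "AE x in M. (\<lambda>n. ennreal (s n x y * cmod (g x))) \<longlonglongrightarrow> 0"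
          using y(1)
        proof eventually_elim
          fix x assume "(\<lambda>n. s n x y) \<longlonglongrightarrow> 0"
          then have "(\<lambda>n. s n x y * cmod (g x)) \<longlonglongrightarrow> 0" by (rule tendsto_mult_left_zero)
          then show "(\<lambda>n. ennreal (s n x y * cmod (g x))) \<longlonglongrightarrow> 0"
            using tendsto_ennrealI by fastforce
        qed
      qed measurable
      then have "(\<lambda>n. kabs M (ktrans (s n)) g y) \<longlonglongrightarrow> 0" by simp
      then have "(\<lambda>n. kabs M (ktrans (s n)) g y * kabs M (ktrans (s n)) g y) \<longlonglongrightarrow> 0 * 0"
        by (intro tendsto_mult_ennreal) auto
      then show "(\<lambda>n. (kabs M (ktrans (s n)) g y)\<^sup>2) \<longlonglongrightarrow> 0" by (simp add: power2_eq_square)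
    qed
  qed measurable
  then show ?thesis by simp
qed

text \<open>With \<open>h = s n |f|\<close> one has \<open>|h|^2 \<le> <h, t |f|>\<close>, and \<open>t |f|\<close> is within \<open>r\<close> of some
member \<open>g\<close> of a fixed finite net, while \<open><h, g> = <|f|, s n* g>\<close> is uniformly small.\<close>
theorem kbound_dominated_null:
  assumes t: "kbound M t C" and s: "\<And>n. kernel M (s n)"
    and le: "\<And>n. AE x in M. AE y in M. s n x y \<le> t x y"
    and le': "\<And>n. AE y in M. AE x in M. s n x y \<le> t x y"
    and lim: "AE y in M. AE x in M. (\<lambda>n. s n x y) \<longlonglongrightarrow> 0"
    and e: "e > 0"
  shows "\<forall>\<^sub>F n in sequentially. kbound M (s n) (gamma_op M (kop M t) + e)"
proof -
  define c where "c = gamma_op M (kop M t)"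
  have c0: "0 \<le> c" unfolding c_def by (rule gamma_op_nonneg[OF blin_kop[OF t]])
  obtain r where r: "net_radius M (kop M t) r" "r < c + e/2"
    using gamma_op_less_net[OF blin_kop[OF t], of "c + e/2"] e by (auto simp: c_def)
  obtain F where F: "finite F" "\<And>g. g \<in> F \<Longrightarrow> L2 M g"
    "\<And>f. L2 M f \<Longrightarrow> nrm M f \<le> 1 \<Longrightarrow> \<exists>g\<in>F. nrm M (\<lambda>x. kop M t f x - g x) \<le> r"
    using r unfolding net_radius_def by blast
  \<comment> \<open>If the norm \<open>h\<close> exceeded \<open>c + e\<close>, then
    \<open>h - r > e / 2\<close> because \<open>r < c + e / 2\<close>, so
    \<open>h * (h - r) > d\<close>. That contradicts \<open>h^2 <= d + h * r\<close> below.\<close>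
  define d where "d = (c + e) * (e / 2)"
  have d: "d > 0" using c0 e by (simp add: d_def)
  have "\<forall>\<^sub>F n in sequentially. \<forall>g\<in>F. (\<integral>\<^sup>+y. (kabs M (ktrans (s n)) g y)\<^sup>2 \<partial>M) < ennreal (d\<^sup>2)"
    using F(1)
  proof (rule eventually_ball_finite, intro ballI)
    fix g assume "g \<in> F"
    from kabs_adjoint_tendsto_0[OF t s le' lim F(2)[OF this]]
    show "\<forall>\<^sub>F n in sequentially. (\<integral>\<^sup>+y. (kabs M (ktrans (s n)) g y)\<^sup>2 \<partial>M) < ennreal (d\<^sup>2)"
      by (rule order_tendstoD) (use d in simp)
  qed
  then show ?thesis
  proof eventually_elim
    fix n assume n: "\<forall>g\<in>F. (\<integral>\<^sup>+y. (kabs M (ktrans (s n)) g y)\<^sup>2 \<partial>M) < ennreal (d\<^sup>2)"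
    have sC: "kbound M (s n) C" by (rule kbound_mono[OF t s le])
    \<comment> \<open>For nonnegative \<open>f\<close> the vector \<open>kop M t f\<close> is
      \<open>kmap t f\<close>, which dominates \<open>kmap (s n) f\<close>; without that,
      cancellation in \<open>kop M t f\<close> would spoil the comparison.\<close>
    have main: "nrm M (kmap (s n) f) \<le> c + e"
      if f: "L2 M f" "nrm M f \<le> 1" and pos: "\<And>x. f x = complex_of_real (cmod (f x))" for f
    proof -
      let ?h = "kmap (s n) f" and ?T = "kop M t f"
      have hL: "L2 M ?h" by (rule kmap(2)[OF sC f(1)])
      have TL: "L2 M ?T" by (rule kop_bound(1)[OF t f(1)])
      obtain g where g: "g \<in> F" "nrm M (\<lambda>x. ?T x - g x) \<le> r" using F(3)[OF f] by blast
      have gL: "L2 M g" by (rule F(2)[OF g(1)])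
      note [measurable] = L2_measurable[OF hL] L2_measurable[OF TL] L2_measurable[OF gL]
      have hT: "AE x in M. cmod (?h x) \<le> cmod (?T x)"
        using le[of n] kabs_kop_nonneg[OF t f(1) pos] kmap(1,4)[OF t f(1)] kmap(4)[OF sC f(1)]
      proof eventually_elim
        case (elim x)
        have "ennreal (cmod (?h x)) \<le> ennreal (cmod (kmap t f x))"
          using kernel_le_kabs[of "s n" x t f, OF elim(1)] elim(4,5) by simp
        then show ?case using elim(2) by (simp add: ennreal_le_iff)
      qed
      have "ennreal ((nrm M ?h)\<^sup>2) = (\<integral>\<^sup>+x. (ennreal (cmod (?h x)))\<^sup>2 \<partial>M)"
        using nn_integral_L2[OF hL] by simp
      also have "\<dots> \<le> (\<integral>\<^sup>+x. ennreal (cmod (?h x) * cmod (g x)) + ennreal (cmod (?h x) * cmod (?T x - g x)) \<partial>M)"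
      proof (rule nn_integral_mono_AE, use hT in eventually_elim)
        fix x assume x: "cmod (?h x) \<le> cmod (?T x)"
        have "(cmod (?h x))\<^sup>2 \<le> cmod (?h x) * cmod (?T x)"
          using x by (simp add: power2_eq_square mult_left_mono)
        also have "\<dots> \<le> cmod (?h x) * (cmod (g x) + cmod (?T x - g x))"
          using norm_triangle_ineq[of "g x" "?T x - g x"] by (intro mult_left_mono) auto
        finally show "(ennreal (cmod (?h x)))\<^sup>2 \<le> ennreal (cmod (?h x) * cmod (g x)) + ennreal (cmod (?h x) * cmod (?T x - g x))"
          by (simp add: ennreal_power ennreal_leI algebra_simps flip: ennreal_plus)
      qed
      also have "\<dots> = (\<integral>\<^sup>+x. ennreal (cmod (?h x) * cmod (g x)) \<partial>M) + (\<integral>\<^sup>+x. ennreal (cmod (?h x) * cmod (?T x - g x)) \<partial>M)"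
        by (rule nn_integral_add) measurable
      also have "(\<integral>\<^sup>+x. ennreal (cmod (?h x) * cmod (?T x - g x)) \<partial>M) \<le> ennreal (nrm M ?h * r)"
        by (rule order_trans[OF L2_Cauchy_Schwarz_nn[OF hL L2_diff[OF TL gL]]])
          (use g(2) in \<open>intro ennreal_leI mult_left_mono; simp\<close>)
      also have "(\<integral>\<^sup>+x. ennreal (cmod (?h x) * cmod (g x)) \<partial>M) = (\<integral>\<^sup>+x. kabs M (s n) f x * ennreal (cmod (g x)) \<partial>M)"
        using kmap(4)[OF sC f(1)]
        by (intro nn_integral_cong_AE) (auto elim!: eventually_mono simp: ennreal_mult)
      also have "\<dots> = (\<integral>\<^sup>+y. kabs M (ktrans (s n)) g y * ennreal (cmod (f y)) \<partial>M)"
        by (rule kform_ktrans[OF s L2_measurable[OF f(1)] L2_measurable[OF gL], symmetric])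
      also have "\<dots> \<le> ennreal d"
      proof -
        note sg = kbound_ktrans[OF sC]
        have m: "kabs M (ktrans (s n)) g \<in> borel_measurable M"
          by (intro kabs_measurable kernel_ktrans s L2_measurable[OF gL])
        have "(\<integral>\<^sup>+y. (kabs M (ktrans (s n)) g y)\<^sup>2 \<partial>M) \<le> ennreal (d\<^sup>2)" using n g(1) by (simp add: less_imp_le)
        from L2_ennreal_bound(3)[OF m this] d
        have nd: "nrm M (kmap (ktrans (s n)) g) \<le> d" by (simp add: kmap_def[abs_def])
        have "(\<integral>\<^sup>+y. kabs M (ktrans (s n)) g y * ennreal (cmod (f y)) \<partial>M)
            = (\<integral>\<^sup>+y. ennreal (cmod (kmap (ktrans (s n)) g y) * cmod (f y)) \<partial>M)"
          using kmap(4)[OF sg gL]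
          by (intro nn_integral_cong_AE) (auto elim!: eventually_mono simp: ennreal_mult)
        also have "\<dots> \<le> ennreal (nrm M (kmap (ktrans (s n)) g) * nrm M f)"
          by (rule L2_Cauchy_Schwarz_nn[OF kmap(2)[OF sg gL] f(1)])
        also have "\<dots> \<le> ennreal (d * 1)"
          using nd f(2) d by (intro ennreal_leI mult_mono) auto
        finally show ?thesis by simp
      qed
      finally have "ennreal ((nrm M ?h)\<^sup>2) \<le> ennreal d + ennreal (nrm M ?h * r)"
        by (simp add: add_right_mono)
      also have "\<dots> = ennreal (d + nrm M ?h * r)"
        using d net_radius_nonneg[OF r(1)] by (intro ennreal_plus[symmetric]) auto
      finally have "ennreal ((nrm M ?h)\<^sup>2) \<le> ennreal (d + nrm M ?h * r)" .
      then have le2: "(nrm M ?h)\<^sup>2 \<le> d + nrm M ?h * r"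
        using d net_radius_nonneg[OF r(1)] by (subst (asm) ennreal_le_iff) auto
      show ?thesis
      proof (rule ccontr)
        assume "\<not> nrm M ?h \<le> c + e"
        then have h: "nrm M ?h > c + e" by simp
        have "d < nrm M ?h * (nrm M ?h - r)"
          unfolding d_def using h r(2) c0 e by (intro mult_strict_mono) auto
        with le2 show False by (simp add: power2_eq_square algebra_simps)
      qed
    qed
    show "kbound M (s n) (gamma_op M (kop M t) + e)"
      unfolding c_def[symmetric]
    proof (rule kboundI_kabs[OF s])
      show "0 \<le> c + e" using c0 e by simp
      fix f assume f: "L2 M f"
      show "(\<integral>\<^sup>+x. (kabs M (s n) f x)\<^sup>2 \<partial>M) \<le> ennreal (((c + e) * nrm M f)\<^sup>2)"
      proof (cases "nrm M f = 0")
        case True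
        then show ?thesis using kbound_kabs[OF sC f] by simp
      next
        case False
        then have p: "nrm M f > 0" using nrm_nonneg[of M f] by linarith
        \<comment> \<open>\<open>kabs\<close> sees only the modulus of \<open>f\<close>, so the
          general case reduces to the normalised modulus.\<close>
        define u where "u x = complex_of_real (1 / nrm M f) * complex_of_real (cmod (f x))" for x
        have uL: "L2 M u" unfolding u_def by (intro L2_scale L2_cmod f)
        have "nrm M u = 1 / nrm M f * nrm M (\<lambda>x. complex_of_real (cmod (f x)))"
          unfolding u_def nrm_scale using p by (simp add: norm_divide)
        also have "nrm M (\<lambda>x. complex_of_real (cmod (f x))) = nrm M f" by (simp add: nrm_def)
        finally have u1: "nrm M u = 1" using p by simp
        have cu: "cmod (u x) = cmod (f x) / nrm M f" for x
          using p by (simp add: u_def norm_mult norm_divide)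
        have pos: "u x = complex_of_real (cmod (u x))" for x
          unfolding cu by (simp add: u_def)
        have m: "kabs M (s n) u \<in> borel_measurable M"
          by (intro kabs_measurable s L2_measurable[OF uL])
        have ks: "kabs M (s n) f x = ennreal (nrm M f) * kabs M (s n) u x" if "x \<in> space M" for x
        proof -
          note [measurable] = that kernel_measurable[OF s] L2_measurable[OF uL]
          have "kabs M (s n) f x = (\<integral>\<^sup>+y. ennreal (nrm M f) * ennreal (s n x y * cmod (u y)) \<partial>M)"
            unfolding kabs_def cu using p kernel_nonneg[OF s]
            by (intro nn_integral_cong) (simp flip: ennreal_mult)
          then show ?thesis unfolding kabs_def by (simp add: nn_integral_cmult)
        qed
        have "(\<integral>\<^sup>+x. (kabs M (s n) f x)\<^sup>2 \<partial>M) = (\<integral>\<^sup>+x. (ennreal (nrm M f))\<^sup>2 * (kabs M (s n) u x)\<^sup>2 \<partial>M)"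
          by (intro nn_integral_cong) (simp add: ks power_mult_distrib)
        also have "\<dots> = (ennreal (nrm M f))\<^sup>2 * (\<integral>\<^sup>+x. (kabs M (s n) u x)\<^sup>2 \<partial>M)"
          using m by (simp add: nn_integral_cmult)
        also have "(\<integral>\<^sup>+x. (kabs M (s n) u x)\<^sup>2 \<partial>M) = (\<integral>\<^sup>+x. (ennreal (cmod (kmap (s n) u x)))\<^sup>2 \<partial>M)"
          using kmap(4)[OF sC uL] by (intro nn_integral_cong_AE) (auto elim!: eventually_mono)
        also have "\<dots> = ennreal ((nrm M (kmap (s n) u))\<^sup>2)" by (rule nn_integral_L2[OF kmap(2)[OF sC uL]])
        also have "\<dots> \<le> ennreal ((c + e)\<^sup>2)"
          using main[OF uL _ pos] u1 by (intro ennreal_leI power_mono) auto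
        finally have "(\<integral>\<^sup>+x. (kabs M (s n) f x)\<^sup>2 \<partial>M) \<le> (ennreal (nrm M f))\<^sup>2 * ennreal ((c + e)\<^sup>2)"
          by (simp add: mult_left_mono)
        also have "\<dots> = ennreal (((c + e) * nrm M f)\<^sup>2)"
          by (simp add: ennreal_power power_mult_distrib mult.commute flip: ennreal_mult)
        finally show ?thesis .
      qed
    qed
  qed
qed

end

context sigma_finite_measure
begin

interpretation MM: pair_sigma_finite M M ..

subsection \<open>Compactness of bounded kernels on sets of finite measure\<close>

definition kcompact :: "'a kernel \<Rightarrow> bool" where
  "kcompact a \<longleftrightarrow> (\<exists>C. kbound M a C) \<and> gamma_op M (kop M a) = 0"

lemma gamma_kop_le: "kbound M a C \<Longrightarrow> gamma_op M (kop M a) \<le> C"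
  using kop_bound(2) kbound_nonneg by (intro gamma_op_bound)

lemma gamma_kop_nonneg: "kbound M a C \<Longrightarrow> 0 \<le> gamma_op M (kop M a)"
  by (intro gamma_op_nonneg blin_kop)

lemma kbound_weaken:
  assumes "kbound M a C" "C \<le> D"
  shows "kbound M a D"
  unfolding kbound_def
proof (intro conjI allI impI kbound_kernel[OF assms(1)])
  show "0 \<le> D" using kbound_nonneg[OF assms(1)] assms(2) by simp
  fix f g assume "L2 M f" "L2 M g"
  from kboundD[OF assms(1) this]
  show "(\<integral>\<^sup>+x. kabs M a f x * ennreal (cmod (g x)) \<partial>M) \<le> ennreal (D * nrm M f * nrm M g)"
    by (rule order_trans) (intro ennreal_leI mult_right_mono assms(2) nrm_nonneg)
qed

lemma kernel_add:
  assumes "kernel M p" "kernel M q"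
  shows "kernel M (\<lambda>x y. p x y + q x y)"
proof -
  note [measurable] = assms[THEN kernel_measurable]
  have "(\<lambda>(x, y). p x y + q x y) \<in> borel_measurable (M \<Otimes>\<^sub>M M)" by measurable
  then show ?thesis using assms[THEN kernel_nonneg] by (simp add: kernel_def)
qed

lemma kbound_add:
  assumes p: "kbound M p C" and q: "kbound M q D"
  shows "kbound M (\<lambda>x y. p x y + q x y) (C + D)"
  unfolding kbound_def
proof (intro conjI allI impI)
  note k = kbound_kernel[OF p] kbound_kernel[OF q]
  show "kernel M (\<lambda>x y. p x y + q x y)" by (rule kernel_add[OF k])
  show "0 \<le> C + D" using kbound_nonneg[OF p] kbound_nonneg[OF q] by simp
  fix f g assume f: "L2 M f" and g: "L2 M g"
  note [measurable] = k[THEN kernel_measurable] L2_measurable[OF f] L2_measurable[OF g]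
  have nn: "0 \<le> p x y" "0 \<le> q x y" for x y using k[THEN kernel_nonneg] by auto
  have m: "kabs M p f \<in> borel_measurable M" "kabs M q f \<in> borel_measurable M"
    by (intro kabs_measurable k L2_measurable[OF f])+
  have "kabs M (\<lambda>x y. p x y + q x y) f x = kabs M p f x + kabs M q f x" if [measurable]: "x \<in> space M" for x
  proof -
    have "kabs M (\<lambda>x y. p x y + q x y) f x = (\<integral>\<^sup>+y. ennreal (p x y * cmod (f y)) + ennreal (q x y * cmod (f y)) \<partial>M)"
      unfolding kabs_def by (intro nn_integral_cong) (simp add: nn distrib_right)
    also have "\<dots> = kabs M p f x + kabs M q f x"
      unfolding kabs_def by (rule nn_integral_add) measurable
    finally show ?thesis .
  qed
  then have "(\<integral>\<^sup>+x. kabs M (\<lambda>x y. p x y + q x y) f x * ennreal (cmod (g x)) \<partial>M)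
      = (\<integral>\<^sup>+x. kabs M p f x * ennreal (cmod (g x)) + kabs M q f x * ennreal (cmod (g x)) \<partial>M)"
    by (intro nn_integral_cong) (simp add: distrib_right)
  also have "\<dots> = (\<integral>\<^sup>+x. kabs M p f x * ennreal (cmod (g x)) \<partial>M) + (\<integral>\<^sup>+x. kabs M q f x * ennreal (cmod (g x)) \<partial>M)"
    by (rule nn_integral_add) (use m in measurable)
  also have "\<dots> \<le> ennreal (C * nrm M f * nrm M g) + ennreal (D * nrm M f * nrm M g)"
    by (intro add_mono kboundD[OF p f g] kboundD[OF q f g])
  also have "\<dots> = ennreal ((C + D) * nrm M f * nrm M g)"
    using kbound_nonneg[OF p] kbound_nonneg[OF q]
    by (subst ennreal_plus[symmetric]) (auto simp: algebra_simps)
  finally show "(\<integral>\<^sup>+x. kabs M (\<lambda>x y. p x y + q x y) f x * ennreal (cmod (g x)) \<partial>M) \<le> ennreal ((C + D) * nrm M f * nrm M g)" .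
qed

lemma kop_add:
  assumes p: "kbound M p C" and q: "kbound M q D" and f: "L2 M f"
  shows "AE x in M. kop M (\<lambda>x y. p x y + q x y) f x = kop M p f x + kop M q f x"
  using kbound_integrable[OF p f] kbound_integrable[OF q f]
  by eventually_elim (simp add: kop_def distrib_right)

lemma gamma_kop_add:
  assumes p: "kbound M p C" and q: "kbound M q D"
  shows "gamma_op M (kop M (\<lambda>x y. p x y + q x y)) \<le> gamma_op M (kop M p) + gamma_op M (kop M q)"
proof -
  have "gamma_op M (kop M (\<lambda>x y. p x y + q x y)) = gamma_op M (\<lambda>f x. kop M p f x + kop M q f x)"
    by (rule gamma_op_cong[OF blin_kop[OF kbound_add[OF p q]] blin_add[OF blin_kop[OF p] blin_kop[OF q]] kop_add[OF p q]])
  also have "\<dots> \<le> gamma_op M (kop M p) + gamma_op M (kop M q)"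
    by (rule gamma_op_add[OF blin_kop[OF p] blin_kop[OF q]])
  finally show ?thesis .
qed

lemma kcompact_add: "kcompact p \<Longrightarrow> kcompact q \<Longrightarrow> kcompact (\<lambda>x y. p x y + q x y)"
proof -
  assume p: "kcompact p" and q: "kcompact q"
  then obtain C D where C: "kbound M p C" and D: "kbound M q D" by (auto simp: kcompact_def)
  have "gamma_op M (kop M (\<lambda>x y. p x y + q x y)) \<le> 0"
    using gamma_kop_add[OF C D] p q by (simp add: kcompact_def)
  then show ?thesis
    using gamma_kop_nonneg[OF kbound_add[OF C D]] kbound_add[OF C D] by (auto simp: kcompact_def)
qed

lemma kbound_zero: "kbound M (\<lambda>x y. 0) 0"
  by (simp add: kbound_def kernel_def kabs_def case_prod_beta')

lemma kcompact_zero: "kcompact (\<lambda>x y. 0)"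
  unfolding kcompact_def using gamma_kop_le[OF kbound_zero] gamma_kop_nonneg[OF kbound_zero] kbound_zero
  by (auto intro: antisym)

lemma kcompact_sum: "(\<And>i. i \<in> I \<Longrightarrow> kcompact (p i)) \<Longrightarrow> kcompact (\<lambda>x y. \<Sum>i\<in>I. p i x y)"
proof (induction I rule: infinite_finite_induct)
  case (insert i I)
  then show ?case using kcompact_add[of "p i" "\<lambda>x y. \<Sum>i\<in>I. p i x y"] by simp
qed (simp_all add: kcompact_zero)

text \<open>Provides the complement step in the induction over measurable sets.\<close>

lemma kcompact_diff:
  assumes s: "kcompact s" and p: "kcompact p" and q: "kernel M q" and eq: "\<And>x y. s x y = p x y + q x y"
  shows "kcompact q"
proof -
  obtain C D where sC: "kbound M s C" and pD: "kbound M p D" using s p by (auto simp: kcompact_def)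
  have qC: "kbound M q C"
    by (rule kbound_mono[OF sC q]) (use kernel_nonneg[OF kbound_kernel[OF pD]] in \<open>simp add: eq\<close>)
  have "gamma_op M (kop M q) = gamma_op M (\<lambda>f x. kop M s f x - kop M p f x)"
  proof (rule gamma_op_cong[OF blin_kop[OF qC] blin_diff[OF blin_kop[OF sC] blin_kop[OF pD]]])
    fix f assume f: "L2 M f"
    have "s = (\<lambda>x y. p x y + q x y)" using eq by (intro ext)
    with kop_add[OF pD qC f] show "AE x in M. kop M q f x = kop M s f x - kop M p f x"
      by (auto elim: eventually_mono)
  qed
  also have "\<dots> \<le> gamma_op M (kop M s) + gamma_op M (kop M p)"
    by (rule gamma_op_diff[OF blin_kop[OF sC] blin_kop[OF pD]])
  also have "\<dots> = 0" using s p by (simp add: kcompact_def)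
  finally show ?thesis using gamma_kop_nonneg[OF qC] qC by (auto simp: kcompact_def)
qed

lemma kcompact_limit:
  assumes "\<And>e. e > 0 \<Longrightarrow> \<exists>p q. kcompact p \<and> kbound M q e \<and> a = (\<lambda>x y. p x y + q x y)"
  shows "kcompact a"
proof -
  obtain C where C: "kbound M a C"
    using assms[of 1] kbound_add unfolding kcompact_def by (metis zero_less_one)
  have "gamma_op M (kop M a) \<le> 0 + e" if e: "e > 0" for e
  proof -
    obtain p q where pq: "kcompact p" "kbound M q e" "a = (\<lambda>x y. p x y + q x y)"
      using assms[OF e] by blast
    obtain D where D: "kbound M p D" using pq(1) by (auto simp: kcompact_def)
    show ?thesis
      using gamma_kop_add[OF D pq(2)] gamma_kop_le[OF pq(2)] pq(1,3) by (simp add: kcompact_def)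
  qed
  then have "gamma_op M (kop M a) \<le> 0" by (rule field_le_epsilon)
  with gamma_kop_nonneg[OF C] C show ?thesis by (auto simp: kcompact_def)
qed

lemma kbound_Hilbert_Schmidt:
  assumes k: "kernel M k" and c: "0 \<le> c"
    and le: "(\<integral>\<^sup>+x. \<integral>\<^sup>+y. (ennreal (k x y))\<^sup>2 \<partial>M \<partial>M) \<le> ennreal (c\<^sup>2)"
  shows "kbound M k c"
proof (rule kboundI_kabs[OF k c])
  fix f assume f: "L2 M f"
  note [measurable] = kernel_measurable[OF k] L2_measurable[OF f]
  have "(\<integral>\<^sup>+x. (kabs M k f x)\<^sup>2 \<partial>M) \<le> (\<integral>\<^sup>+x. (\<integral>\<^sup>+y. (ennreal (k x y))\<^sup>2 \<partial>M) * ennreal ((nrm M f)\<^sup>2) \<partial>M)"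
  proof (rule nn_integral_mono)
    fix x assume [measurable]: "x \<in> space M"
    have "(kabs M k f x)\<^sup>2 = (\<integral>\<^sup>+y. ennreal (k x y) * ennreal (cmod (f y)) \<partial>M)\<^sup>2"
      unfolding kabs_def using kernel_nonneg[OF k] by (simp add: ennreal_mult)
    also have "\<dots> \<le> (\<integral>\<^sup>+y. (ennreal (k x y))\<^sup>2 \<partial>M) * (\<integral>\<^sup>+y. (ennreal (cmod (f y)))\<^sup>2 \<partial>M)"
      by (rule Cauchy_Schwarz_nn_integral) measurable
    finally show "(kabs M k f x)\<^sup>2 \<le> (\<integral>\<^sup>+y. (ennreal (k x y))\<^sup>2 \<partial>M) * ennreal ((nrm M f)\<^sup>2)"
      by (simp add: nn_integral_L2[OF f])
  qed
  also have "\<dots> = (\<integral>\<^sup>+x. \<integral>\<^sup>+y. (ennreal (k x y))\<^sup>2 \<partial>M \<partial>M) * ennreal ((nrm M f)\<^sup>2)"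
    by (rule nn_integral_multc) measurable
  also have "\<dots> \<le> ennreal (c\<^sup>2) * ennreal ((nrm M f)\<^sup>2)" by (intro mult_right_mono le) simp
  finally show "(\<integral>\<^sup>+x. (kabs M k f x)\<^sup>2 \<partial>M) \<le> ennreal ((c * nrm M f)\<^sup>2)"
    by (simp add: power_mult_distrib flip: ennreal_mult)
qed

lemma L2_indicator:
  assumes "A \<in> sets M" "emeasure M A < \<infinity>"
  shows "L2 M (\<lambda>x. complex_of_real (indicator A x))"
proof -
  have "(\<lambda>x. (cmod (complex_of_real (indicator A x)))\<^sup>2) = indicat_real A"
    by (auto simp: indicator_def)
  then show ?thesis using assms by (auto simp: L2_def)
qed

lemma finite_net_complex: "e > 0 \<Longrightarrow> \<exists>D. finite D \<and> (\<forall>c. cmod c \<le> K \<longrightarrow> (\<exists>w\<in>D. cmod (c - w) < e))"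
proof -
  assume e: "e > 0"
  have "compact (cball (0::complex) K)" by simp
  then obtain D where D: "finite D" "cball (0::complex) K \<subseteq> (\<Union>x\<in>D. ball x e)"
    unfolding compact_eq_totally_bounded using e by blast
  have "\<exists>w\<in>D. cmod (c - w) < e" if "cmod c \<le> K" for c
  proof -
    have "c \<in> cball 0 K" using that by simp
    then obtain w where "w \<in> D" "c \<in> ball w e" using D(2) by blast
    then show ?thesis by (auto simp: dist_norm norm_minus_commute)
  qed
  with D(1) show ?thesis by blast
qed

text \<open>The operator has rank one: the unit ball goes to multiples of \<open>?u\<close> with
  coefficients in a fixed disc, and a finite net of the disc gives a finite net of the
  image.\<close>

lemma kcompact_rectangle:
  assumes [measurable]: "A \<in> sets M" "B \<in> sets M" and fin: "emeasure M A < \<infinity>" "emeasure M B < \<infinity>"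
  shows "kcompact (\<lambda>x y. indicator A x * indicator B y)"
proof -
  let ?k = "\<lambda>x y. indicat_real A x * indicator B y"
  let ?u = "\<lambda>x. complex_of_real (indicator A x)" and ?v = "\<lambda>x. complex_of_real (indicator B x)"
  have u: "L2 M ?u" and v: "L2 M ?v" using fin by (auto intro: L2_indicator)
  have k: "kernel M ?k"
  proof -
    have "(\<lambda>(x, y). ?k x y) \<in> borel_measurable (M \<Otimes>\<^sub>M M)" by measurable
    then show ?thesis by (simp add: kernel_def)
  qed
  have "(\<integral>\<^sup>+x. \<integral>\<^sup>+y. (ennreal (?k x y))\<^sup>2 \<partial>M \<partial>M) = (\<integral>\<^sup>+x. \<integral>\<^sup>+y. indicator A x * indicator B y \<partial>M \<partial>M)"
    by (intro nn_integral_cong) (auto simp: indicator_def)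
  also have "\<dots> = emeasure M A * emeasure M B"
    by (simp add: nn_integral_cmult nn_integral_multc)
  also have "\<dots> = ennreal ((sqrt (measure M A * measure M B))\<^sup>2)"
    using fin by (simp add: emeasure_eq_ennreal_measure ennreal_mult)
  finally have kb: "kbound M ?k (sqrt (measure M A * measure M B))"
    by (intro kbound_Hilbert_Schmidt k) auto
  have kop: "kop M ?k f = (\<lambda>x. (LINT y|M. ?v y * f y) * ?u x)" for f
    by (auto simp: kop_def mult.assoc fun_eq_iff indicator_def)
  have "gamma_op M (kop M ?k) \<le> 0 + e" if e: "e > 0" for e
  proof (simp only: add_0_left, rule gamma_op_le)
    \<comment> \<open>The summand 1 keeps the denominator positive when \<open>A\<close> is a null
      set.\<close>
    define e' where "e' = e / (nrm M ?u + 1)"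
    have u0: "nrm M ?u + 1 > 0" using nrm_nonneg[of M ?u] by linarith
    have e': "e' > 0" using e u0 by (simp add: e'_def)
    obtain D where D: "finite D" "\<And>c. cmod c \<le> nrm M ?v \<Longrightarrow> \<exists>w\<in>D. cmod (c - w) < e'"
      using finite_net_complex[OF e', of "nrm M ?v"] by blast
    show "net_radius M (kop M ?k) e"
      unfolding net_radius_def
    proof (intro conjI exI[of _ "(\<lambda>w x. w * ?u x) ` D"] allI impI)
      fix f assume f: "L2 M f \<and> nrm M f \<le> 1"
      let ?c = "LINT y|M. ?v y * f y"
      have "cmod ?c \<le> (LINT y|M. cmod (?v y) * cmod (f y))"
        using integral_norm_bound[of M "\<lambda>y. ?v y * f y"] by (simp add: norm_mult)
      also have "\<dots> \<le> nrm M ?v * nrm M f" by (rule L2_Cauchy_Schwarz[OF v]) (use f in simp)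
      also have "\<dots> \<le> nrm M ?v * 1" using f by (intro mult_left_mono) auto
      finally obtain w where w: "w \<in> D" "cmod (?c - w) < e'" using D(2)[of ?c] by auto
      have "nrm M (\<lambda>x. kop M ?k f x - w * ?u x) = nrm M (\<lambda>x. (?c - w) * ?u x)"
        by (simp add: kop left_diff_distrib)
      also have "\<dots> \<le> e' * (nrm M ?u + 1)"
        unfolding nrm_scale using w(2) e' by (intro mult_mono) auto
      also have "\<dots> = e" using u0 by (simp add: e'_def)
      finally show "\<exists>g\<in>(\<lambda>w x. w * ?u x) ` D. nrm M (\<lambda>x. kop M ?k f x - g x) \<le> e"
        unfolding bex_simps by (rule bexI[OF _ w(1)])
    qed (use e D(1) u in \<open>auto intro: L2_scale\<close>)
  qed
  then have "gamma_op M (kop M ?k) \<le> 0" by (rule field_le_epsilon)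
  with gamma_kop_nonneg[OF kb] kb show ?thesis by (auto simp: kcompact_def)
qed

lemma kernel_indicator:
  assumes [measurable]: "A \<in> sets (M \<Otimes>\<^sub>M M)"
  shows "kernel M (\<lambda>x y. indicator A (x, y))"
proof -
  have "(\<lambda>(x, y). indicat_real A (x, y)) \<in> borel_measurable (M \<Otimes>\<^sub>M M)" by measurable
  then show ?thesis by (simp add: kernel_def)
qed

lemma kbound_indicator:
  assumes A: "A \<in> sets (M \<Otimes>\<^sub>M M)" and fin: "emeasure (M \<Otimes>\<^sub>M M) A \<le> ennreal (e\<^sup>2)" and e: "0 \<le> e"
  shows "kbound M (\<lambda>x y. indicator A (x, y)) e"
proof (rule kbound_Hilbert_Schmidt[OF kernel_indicator[OF A] e])
  have "(\<integral>\<^sup>+x. \<integral>\<^sup>+y. (ennreal (indicator A (x, y)))\<^sup>2 \<partial>M \<partial>M) = emeasure (M \<Otimes>\<^sub>M M) A"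
    by (subst emeasure_pair_measure[OF A]) (intro nn_integral_cong, auto simp: indicator_def)
  then show "(\<integral>\<^sup>+x. \<integral>\<^sup>+y. (ennreal (indicator A (x, y)))\<^sup>2 \<partial>M \<partial>M) \<le> ennreal (e\<^sup>2)"
    using fin by simp
qed

text \<open>Induction over the sigma-algebra generated by rectangles, inside a fixed box of finite
  measure. For a disjoint union the part not covered by the first \<open>n\<close> sets has measure
  tending to 0, hence so does its Hilbert-Schmidt norm, and a norm limit of compact kernels is
  compact.\<close>

lemma kcompact_indicator:
  assumes A: "A \<in> sets (M \<Otimes>\<^sub>M M)" and E: "E \<in> sets M" and fin: "emeasure M E < \<infinity>"
  shows "kcompact (\<lambda>x y. indicator (A \<inter> E \<times> E) (x, y))"
  using Int_stable_pair_measure_generator pair_measure_closed A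
  unfolding sets_pair_measure
proof (induct rule: sigma_sets_induct_disjoint)
  case (basic A)
  then obtain a b where ab: "a \<in> sets M" "b \<in> sets M" "A = a \<times> b" by auto
  have "emeasure M (a \<inter> E) \<le> emeasure M E" "emeasure M (b \<inter> E) \<le> emeasure M E"
    using ab E by (auto intro: emeasure_mono)
  then have "kcompact (\<lambda>x y. indicator (a \<inter> E) x * indicator (b \<inter> E) y)"
    by (intro kcompact_rectangle) (use ab E fin in \<open>auto intro: le_less_trans\<close>)
  moreover have "(\<lambda>x y. indicat_real (A \<inter> E \<times> E) (x, y)) = (\<lambda>x y. indicator (a \<inter> E) x * indicator (b \<inter> E) y)"
    using ab by (auto simp: indicator_def fun_eq_iff)
  ultimately show ?case by simp
next
  case empty
  then show ?case by (simp add: kcompact_zero)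
next
  case (compl A)
  then have A: "A \<in> sets (M \<Otimes>\<^sub>M M)" by (simp add: sets_pair_measure)
  have EE: "E \<times> E \<in> sets (M \<Otimes>\<^sub>M M)" using E by simp
  have sp: "E \<times> E \<subseteq> space M \<times> space M" using sets.sets_into_space[OF E] by auto
  have "kcompact (\<lambda>x y. indicator E x * indicator E y)"
    by (rule kcompact_rectangle[OF E E fin fin])
  moreover have "kcompact (\<lambda>x y. indicator (A \<inter> E \<times> E) (x, y))" by (rule compl)
  moreover have "kernel M (\<lambda>x y. indicator ((space M \<times> space M - A) \<inter> E \<times> E) (x, y))"
  proof (rule kernel_indicator)
    have "(space M \<times> space M - A) \<inter> E \<times> E = E \<times> E - A" using sp by auto
    then show "(space M \<times> space M - A) \<inter> E \<times> E \<in> sets (M \<Otimes>\<^sub>M M)" using A EE by auto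
  qed
  ultimately show ?case
    by (rule kcompact_diff) (use sp in \<open>auto simp: indicator_def\<close>)
next
  case (union F)
  then have F: "F i \<in> sets (M \<Otimes>\<^sub>M M)" for i by (auto simp: sets_pair_measure)
  have EE: "E \<times> E \<in> sets (M \<Otimes>\<^sub>M M)" using E by simp
  define U where "U = (\<Union>i. F i) \<inter> E \<times> E"
  define R where "R n = U - (\<Union>i<n. F i)" for n :: nat
  have Rs: "R n \<in> sets (M \<Otimes>\<^sub>M M)" for n using F EE by (auto simp: R_def U_def)
  have "(\<lambda>n. emeasure (M \<Otimes>\<^sub>M M) (R n)) \<longlonglongrightarrow> emeasure (M \<Otimes>\<^sub>M M) (\<Inter>n. R n)"
  proof (rule Lim_emeasure_decseq)
    show "range R \<subseteq> sets (M \<Otimes>\<^sub>M M)" using Rs by auto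
    show "decseq R" by (auto simp: decseq_def R_def)
    fix n
    have "emeasure (M \<Otimes>\<^sub>M M) (R n) \<le> emeasure (M \<Otimes>\<^sub>M M) (E \<times> E)"
      using EE by (intro emeasure_mono) (auto simp: R_def U_def)
    also have "\<dots> < \<infinity>" using E fin by (simp add: emeasure_pair_measure_Times ennreal_mult_less_top)
    finally show "emeasure (M \<Otimes>\<^sub>M M) (R n) \<noteq> \<infinity>" by simp
  qed
  moreover have "(\<Inter>n. R n) = {}"
  proof (rule equals0I)
    fix z assume z: "z \<in> (\<Inter>n. R n)"
    then have "z \<in> R 0" by (rule INT_D) simp
    then obtain i where i: "z \<in> F i" by (auto simp: R_def U_def)
    have "z \<in> R (Suc i)" using z by (rule INT_D) simp
    then show False using i by (simp add: R_def)
  qed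
  ultimately have lim: "(\<lambda>n. emeasure (M \<Otimes>\<^sub>M M) (R n)) \<longlonglongrightarrow> 0" by simp
  have "kcompact (\<lambda>x y. indicator U (x, y))"
  proof (rule kcompact_limit)
    fix e :: real assume e: "e > 0"
    have "\<forall>\<^sub>F n in sequentially. emeasure (M \<Otimes>\<^sub>M M) (R n) < ennreal (e\<^sup>2)"
      using lim by (rule order_tendstoD) (use e in simp)
    then obtain n where n: "emeasure (M \<Otimes>\<^sub>M M) (R n) < ennreal (e\<^sup>2)"
      using eventually_happens'[OF sequentially_bot] by blast
    have "kcompact (\<lambda>x y. \<Sum>i<n. indicator (F i \<inter> E \<times> E) (x, y))"
      using union(3) by (intro kcompact_sum) simp
    moreover have "kbound M (\<lambda>x y. indicator (R n) (x, y)) e"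
      by (rule kbound_indicator[OF Rs]) (use n e in auto)
    moreover have "indicat_real U z = (\<Sum>i<n. indicator (F i \<inter> E \<times> E) z) + indicator (R n) z" for z
    proof -
      have "disjoint_family_on (\<lambda>i. F i \<inter> E \<times> E) {..<n}"
        using union(1) by (auto simp: disjoint_family_on_def)
      then have "(\<Sum>i<n. indicat_real (F i \<inter> E \<times> E) z) = indicator (\<Union>i<n. F i \<inter> E \<times> E) z"
        by (intro indicator_UN_disjoint[symmetric]) auto
      then show ?thesis by (auto simp: R_def U_def indicator_def)
    qed
    then have "(\<lambda>x y. indicat_real U (x, y)) = (\<lambda>x y. (\<Sum>i<n. indicator (F i \<inter> E \<times> E) (x, y)) + indicator (R n) (x, y))"
      by (intro ext)
    ultimately show "\<exists>p q. kcompact p \<and> kbound M q e \<and> (\<lambda>x y. indicat_real U (x, y)) = (\<lambda>x y. p x y + q x y)"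
      by blast
  qed
  then show ?case by (simp add: U_def)
qed

lemma kbound_box:
  assumes k: "kernel M k" and E: "E \<in> sets M" "emeasure M E < \<infinity>" and c: "0 \<le> c"
    and le: "\<And>x y. x \<in> space M \<Longrightarrow> y \<in> space M \<Longrightarrow> k x y \<le> c * indicator (E \<times> E) (x, y)"
  shows "kbound M k (c * measure M E)"
proof (rule kbound_Hilbert_Schmidt[OF k])
  have "(\<integral>\<^sup>+x. \<integral>\<^sup>+y. (ennreal (k x y))\<^sup>2 \<partial>M \<partial>M) \<le> (\<integral>\<^sup>+x. \<integral>\<^sup>+y. ennreal (c\<^sup>2) * (indicator E x * indicator E y) \<partial>M \<partial>M)"
  proof (intro nn_integral_mono)
    fix x y assume xy: "x \<in> space M" "y \<in> space M"
    have "(ennreal (k x y))\<^sup>2 \<le> (ennreal (c * indicator (E \<times> E) (x, y)))\<^sup>2"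
      by (intro power_mono ennreal_leI le xy) simp
    also have "\<dots> = ennreal (c\<^sup>2) * (indicator E x * indicator E y)"
      using c by (auto simp: indicator_def ennreal_power)
    finally show "(ennreal (k x y))\<^sup>2 \<le> ennreal (c\<^sup>2) * (indicator E x * indicator E y)" .
  qed
  also have "\<dots> = ennreal (c\<^sup>2) * (emeasure M E * emeasure M E)"
    using E by (simp add: nn_integral_cmult nn_integral_multc)
  also have "\<dots> = ennreal ((c * measure M E)\<^sup>2)"
    using E by (simp add: emeasure_eq_ennreal_measure power_mult_distrib power2_eq_square ennreal_mult flip: ennreal_mult)
  finally show "(\<integral>\<^sup>+x. \<integral>\<^sup>+y. (ennreal (k x y))\<^sup>2 \<partial>M \<partial>M) \<le> ennreal ((c * measure M E)\<^sup>2)" .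
qed (use c in simp)

text \<open>The sum rounds \<open>t\<close> down to a multiple of \<open>1 / N\<close>. Written
  level by level it becomes a combination of indicators of superlevel sets when \<open>t\<close> is
  a value of a kernel.\<close>

lemma sum_levels:
  assumes "0 \<le> t" "t \<le> real K" "N > 0"
  shows "(\<Sum>j\<in>{1..K * N}. if real j \<le> t * N then 1 / real N else 0) \<le> t"
    "t \<le> (\<Sum>j\<in>{1..K * N}. if real j \<le> t * N then 1 / real N else 0) + 1 / N"
proof -
  define m where "m = nat \<lfloor>t * N\<rfloor>"
  have m: "real m \<le> t * N" "t * N < real m + 1"
    using assms by (auto simp: m_def)
  have "t * N \<le> real (K * N)" using assms by (simp add: mult_right_mono)
  then have mK: "m \<le> K * N" using m(1) by linarith
  have "{j \<in> {1..K * N}. real j \<le> t * N} = {1..m}"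
  proof (rule set_eqI)
    fix j
    have "real j \<le> t * N \<longleftrightarrow> j \<le> m" using m by linarith
    then show "j \<in> {j \<in> {1..K * N}. real j \<le> t * N} \<longleftrightarrow> j \<in> {1..m}"
      using mK by (simp del: of_nat_mult) linarith
  qed
  then have eq: "(\<Sum>j\<in>{1..K * N}. if real j \<le> t * N then 1 / real N else 0) = real m / N"
    by (simp add: sum.If_cases Int_def)
  show "(\<Sum>j\<in>{1..K * N}. if real j \<le> t * N then 1 / real N else 0) \<le> t"
    "t \<le> (\<Sum>j\<in>{1..K * N}. if real j \<le> t * N then 1 / real N else 0) + 1 / N"
    unfolding eq using m assms(3) by (auto simp: field_simps)
qed

lemma kcompact_scale:
  assumes p: "kcompact p" and c: "0 \<le> c"
  shows "kcompact (\<lambda>x y. c * p x y)"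
proof -
  obtain C where C: "kbound M p C" using p by (auto simp: kcompact_def)
  note [measurable] = kernel_measurable[OF kbound_kernel[OF C]]
  have nn: "0 \<le> p x y" for x y using kernel_nonneg[OF kbound_kernel[OF C]] .
  have "(\<lambda>(x, y). c * p x y) \<in> borel_measurable (M \<Otimes>\<^sub>M M)" by measurable
  then have k: "kernel M (\<lambda>x y. c * p x y)" using nn c by (simp add: kernel_def)
  have kop: "kop M (\<lambda>x y. c * p x y) f = (\<lambda>x. complex_of_real c * kop M p f x)" for f
    by (simp add: kop_def mult.assoc fun_eq_iff)
  have kb: "kbound M (\<lambda>x y. c * p x y) (c * C)"
  proof (rule kboundI_kop[OF k])
    fix f assume f: "L2 M f"
    show "AE x in M. integrable M (\<lambda>y. complex_of_real (c * p x y) * f y)"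
      using kbound_integrable[OF C f] by eventually_elim (simp add: mult.assoc)
    show "L2 M (kop M (\<lambda>x y. c * p x y) f)" unfolding kop by (intro L2_scale kop_bound(1)[OF C f])
    show "nrm M (kop M (\<lambda>x y. c * p x y) f) \<le> c * C * nrm M f"
      unfolding kop nrm_scale using kop_bound(2)[OF C f] c by (simp add: mult.assoc mult_left_mono)
  qed (use c kbound_nonneg[OF C] in simp)
  have "gamma_op M (kop M (\<lambda>x y. c * p x y)) \<le> cmod (complex_of_real c) * gamma_op M (kop M p)"
    using gamma_op_scale_le[OF blin_kop[OF C], of "complex_of_real c"] kop by presburger
  with p have "gamma_op M (kop M (\<lambda>x y. c * p x y)) \<le> 0" by (simp add: kcompact_def)
  with gamma_kop_nonneg[OF kb] kb show ?thesis by (auto simp: kcompact_def)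
qed

text \<open>Rounding the kernel down to multiples of \<open>1 / N\<close> gives a finite combination
  of compact indicator kernels; the error is at most \<open>1 / N\<close> on the box, so its norm is
  at most \<open>measure M E / N\<close>.\<close>

theorem kcompact_box:
  assumes k: "kernel M k" and E: "E \<in> sets M" "emeasure M E < \<infinity>"
    and le: "\<And>x y. k x y \<le> real K * indicator (E \<times> E) (x, y)"
  shows "kcompact k"
proof (rule kcompact_limit)
  fix e :: real assume e: "e > 0"
  obtain N :: nat where N: "N > 0" "measure M E / N < e"
  proof -
    obtain n :: nat where n: "real n > measure M E / e" using reals_Archimedean2 by blast
    have "measure M E / (n + 1) < e" using n e by (simp add: field_simps)
    then show ?thesis using that[of "n + 1"] by simp
  qed
  define A where "A j = {z \<in> space (M \<Otimes>\<^sub>M M). real j \<le> k (fst z) (snd z) * N}" for j :: nat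
  note [measurable] = kernel_measurable[OF k] E(1)
  have A: "A j \<in> sets (M \<Otimes>\<^sub>M M)" for j unfolding A_def by measurable
  define p where "p = (\<lambda>x y. \<Sum>j\<in>{1..K * N}. (1 / real N) * indicator (A j \<inter> E \<times> E) (x, y))"
  define q where "q = (\<lambda>x y. k x y - p x y)"
  have k0: "k x y = 0" if "(x, y) \<notin> E \<times> E" for x y
  proof -
    have "indicat_real (E \<times> E) (x, y) = 0" using that by simp
    then show ?thesis using le[of x y] kernel_nonneg[OF k, of x y] by simp
  qed
  have ksp: "(x, y) \<in> space (M \<Otimes>\<^sub>M M)" if "(x, y) \<in> E \<times> E" for x y
    using that sets.sets_into_space[OF E(1)] by (auto simp: space_pair_measure)
  have pc: "kcompact p"
    unfolding p_def by (intro kcompact_sum kcompact_scale kcompact_indicator A E) simp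
  have bnd: "0 \<le> q x y \<and> q x y \<le> (1 / N) * indicator (E \<times> E) (x, y)" for x y
  proof (cases "(x, y) \<in> E \<times> E")
    case True
    have "k x y \<le> real K" using le[of x y] True by simp
    moreover have "p x y = (\<Sum>j\<in>{1..K * N}. if real j \<le> k x y * N then 1 / real N else 0)"
      unfolding p_def using True ksp[OF True] by (intro sum.cong) (auto simp: A_def indicator_def)
    ultimately show ?thesis
      using sum_levels[of "k x y" K N] kernel_nonneg[OF k, of x y] N(1) True by (auto simp: q_def)
  next
    case False
    have "p x y = 0"
      unfolding p_def using False by (intro sum.neutral) (auto simp: indicator_def)
    moreover have "indicat_real (E \<times> E) (x, y) = 0" using False by simp
    ultimately show ?thesis using k0[OF False] by (simp add: q_def)
  qed
  have "case_prod p \<in> borel_measurable (M \<Otimes>\<^sub>M M)"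
  proof -
    obtain D where "kbound M p D" using pc by (auto simp: kcompact_def)
    then show ?thesis by (intro kernel_measurable kbound_kernel)
  qed
  note [measurable] = this
  have "(\<lambda>(x, y). k x y - p x y) \<in> borel_measurable (M \<Otimes>\<^sub>M M)" by measurable
  then have qk: "kernel M q" using bnd by (simp add: kernel_def q_def)
  have "kbound M q (1 / N * measure M E)"
    by (rule kbound_box[OF qk E]) (use bnd in auto)
  then have "kbound M q e"
    by (rule kbound_weaken) (use N(2) in simp)
  moreover have "k = (\<lambda>x y. p x y + q x y)" by (simp add: q_def)
  ultimately show "\<exists>p q. kcompact p \<and> kbound M q e \<and> k = (\<lambda>x y. p x y + q x y)" using pc by blast
qed

end

subsection \<open>Hoelder's inequality for geometric means\<close>

definition gmean :: "'i set \<Rightarrow> ('i \<Rightarrow> real) \<Rightarrow> real" where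
  "gmean J t = (\<Prod>j\<in>J. t j powr (1 / real (card J)))"

lemma gmean_nonneg: "0 \<le> gmean J t"
  by (simp add: gmean_def prod_nonneg)

lemma gmean_mono:
  assumes "\<And>j. j \<in> J \<Longrightarrow> 0 \<le> s j" "\<And>j. j \<in> J \<Longrightarrow> s j \<le> t j"
  shows "gmean J s \<le> gmean J t"
  unfolding gmean_def by (intro prod_mono) (auto intro!: powr_mono2 assms)

lemma gmean_mult:
  assumes "\<And>j. j \<in> J \<Longrightarrow> 0 \<le> s j" "\<And>j. j \<in> J \<Longrightarrow> 0 \<le> t j"
  shows "gmean J (\<lambda>j. s j * t j) = gmean J s * gmean J t"
  unfolding gmean_def prod.distrib[symmetric] by (intro prod.cong) (auto simp: powr_mult assms)

lemma gmean_zero: "finite J \<Longrightarrow> J \<noteq> {} \<Longrightarrow> gmean J (\<lambda>j. 0) = 0"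
  by (simp add: gmean_def card_gt_0_iff)

lemma gmean_const:
  assumes "finite J" "J \<noteq> {}" "0 \<le> c"
  shows "gmean J (\<lambda>j. c) = c"
proof (cases "c = 0")
  case False
  have "gmean J (\<lambda>j. c) = (c powr (1 / card J)) powr real (card J)"
    using False assms by (simp add: gmean_def powr_realpow)
  then show ?thesis using assms by (simp add: powr_powr)
qed (use assms gmean_zero in simp)

lemma gmean_le_sum:
  assumes "finite J" "J \<noteq> {}" "\<And>j. j \<in> J \<Longrightarrow> 0 \<le> t j"
  shows "gmean J t \<le> (\<Sum>j\<in>J. t j / card J)"
proof -
  have "(\<Prod>j\<in>J. t j powr p) = (\<Prod>j\<in>J. t j) powr p" for p
    using assms(1,3) by (induction J rule: finite_induct) (auto simp: powr_mult prod_nonneg)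
  then have "gmean J t = (\<Prod>j\<in>J. t j) powr (1 / card J)" by (simp add: gmean_def)
  with arith_geom_mean[OF assms] show ?thesis by simp
qed

lemma tendsto_gmean_add:
  assumes J: "finite J" "J \<noteq> {}" and c: "\<And>j. j \<in> J \<Longrightarrow> 0 \<le> c j"
  shows "((\<lambda>e. gmean J (\<lambda>j. c j + e)) \<longlongrightarrow> gmean J c) (at_right 0)"
proof -
  have "((\<lambda>e. (c j + e) powr (1 / card J)) \<longlongrightarrow> (c j + 0) powr (1 / card J)) (at_right 0)" if j: "j \<in> J" for j
  proof (rule tendsto_powr')
    show "((\<lambda>e. c j + e) \<longlongrightarrow> c j + 0) (at_right 0)" by (intro tendsto_intros)
    have "card J > 0" using J by (simp add: card_gt_0_iff)
    moreover have "\<forall>\<^sub>F e in at_right 0. 0 \<le> c j + e"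
      using c[OF j] by (auto simp: eventually_at_filter)
    ultimately show "c j + 0 \<noteq> 0 \<or> 0 < 1 / real (card J) \<and> (\<forall>\<^sub>F e in at_right 0. 0 \<le> c j + e)" by simp
  qed (rule tendsto_const)
  then show ?thesis unfolding gmean_def by (intro tendsto_prod) simp
qed

text \<open>Hoelder with equal weights: normalise each factor by its bound and apply the inequality
  of arithmetic and geometric means pointwise. The shift by \<open>e\<close> avoids dividing by a
  zero bound and is removed in the limit.\<close>

lemma nn_integral_gmean_le:
  assumes J: "finite J" "J \<noteq> {}" and u: "\<And>j. j \<in> J \<Longrightarrow> u j \<in> borel_measurable N"
    and nn: "\<And>j x. j \<in> J \<Longrightarrow> 0 \<le> u j x" and c: "\<And>j. j \<in> J \<Longrightarrow> 0 \<le> c j"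
    and le: "\<And>j. j \<in> J \<Longrightarrow> (\<integral>\<^sup>+x. ennreal (u j x) \<partial>N) \<le> ennreal (c j)"
  shows "(\<integral>\<^sup>+x. ennreal (gmean J (\<lambda>j. u j x)) \<partial>N) \<le> ennreal (gmean J c)"
proof -
  have *: "(\<integral>\<^sup>+x. ennreal (gmean J (\<lambda>j. u j x)) \<partial>N) \<le> ennreal (gmean J (\<lambda>j. c j + e))" if e: "e > 0" for e
  proof -
    let ?d = "\<lambda>j. c j + e"
    have d: "0 < ?d j" if "j \<in> J" for j using c[OF that] e by simp
    have cJ: "real (card J) > 0" using J by (simp add: card_gt_0_iff)
    have "(\<integral>\<^sup>+x. ennreal (gmean J (\<lambda>j. u j x)) \<partial>N)
        \<le> (\<integral>\<^sup>+x. (\<Sum>j\<in>J. ennreal (gmean J ?d / (card J * ?d j)) * ennreal (u j x)) \<partial>N)"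
    proof (rule nn_integral_mono)
      fix x
      have "gmean J (\<lambda>j. u j x) = gmean J (\<lambda>j. ?d j * (u j x / ?d j))"
        unfolding gmean_def by (intro prod.cong) (use d in force)+
      also have "\<dots> = gmean J ?d * gmean J (\<lambda>j. u j x / ?d j)"
        by (rule gmean_mult) (use d nn in \<open>auto simp: less_imp_le\<close>)
      also have "\<dots> \<le> gmean J ?d * (\<Sum>j\<in>J. u j x / ?d j / card J)"
        by (intro mult_left_mono gmean_le_sum J gmean_nonneg) (use d nn in \<open>auto simp: less_imp_le\<close>)
      also have "\<dots> = (\<Sum>j\<in>J. gmean J ?d / (card J * ?d j) * u j x)"
        by (simp add: sum_distrib_left mult.commute)
      finally have "ennreal (gmean J (\<lambda>j. u j x)) \<le> ennreal (\<Sum>j\<in>J. gmean J ?d / (card J * ?d j) * u j x)"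
        by (rule ennreal_leI)
      also have "\<dots> = (\<Sum>j\<in>J. ennreal (gmean J ?d / (card J * ?d j) * u j x))"
        using d nn cJ gmean_nonneg[of J ?d]
        by (intro sum_ennreal[symmetric] mult_nonneg_nonneg divide_nonneg_nonneg) (auto simp: less_imp_le)
      also have "\<dots> = (\<Sum>j\<in>J. ennreal (gmean J ?d / (card J * ?d j)) * ennreal (u j x))"
        using d cJ gmean_nonneg[of J ?d] nn
        by (intro sum.cong ennreal_mult refl divide_nonneg_nonneg) (auto simp: less_imp_le)
      finally show "ennreal (gmean J (\<lambda>j. u j x)) \<le> (\<Sum>j\<in>J. ennreal (gmean J ?d / (card J * ?d j)) * ennreal (u j x))" .
    qed
    also have "\<dots> = (\<Sum>j\<in>J. ennreal (gmean J ?d / (card J * ?d j)) * (\<integral>\<^sup>+x. ennreal (u j x) \<partial>N))"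
      using u by (subst nn_integral_sum) (auto simp: nn_integral_cmult intro!: sum.cong)
    also have "\<dots> \<le> (\<Sum>j\<in>J. ennreal (gmean J ?d / card J))"
    proof (rule sum_mono)
      fix j assume j: "j \<in> J"
      have "ennreal (gmean J ?d / (card J * ?d j)) * (\<integral>\<^sup>+x. ennreal (u j x) \<partial>N)
          \<le> ennreal (gmean J ?d / (card J * ?d j)) * ennreal (?d j)"
        using e by (intro mult_left_mono order_trans[OF le[OF j]] ennreal_leI) auto
      also have "\<dots> = ennreal (gmean J ?d / card J)"
        using d[OF j] cJ gmean_nonneg[of J ?d] by (simp flip: ennreal_mult)
      finally show "ennreal (gmean J ?d / (card J * ?d j)) * (\<integral>\<^sup>+x. ennreal (u j x) \<partial>N) \<le> ennreal (gmean J ?d / card J)" .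
    qed
    also have "\<dots> = ennreal (gmean J ?d)"
      using cJ gmean_nonneg[of J ?d] by (simp add: ennreal_of_nat_eq_real_of_nat flip: ennreal_mult)
    finally show ?thesis .
  qed
  have "((\<lambda>e. ennreal (gmean J (\<lambda>j. c j + e))) \<longlongrightarrow> ennreal (gmean J c)) (at_right 0)"
    by (intro tendsto_ennrealI tendsto_gmean_add J c)
  then show ?thesis
    by (rule tendsto_lowerbound) (use * in \<open>auto simp: eventually_at_filter\<close>)
qed

context sigma_finite_measure
begin

interpretation MM: pair_sigma_finite M M ..

text \<open>The geometric mean of a constant is that constant, so the weight
  \<open>cmod (f y) * cmod (g x)\<close> can be handed to every factor, and Hoelder on the product
  space bounds the form of \<open>b\<close> by the mean of the forms.\<close>

lemma kbound_gmean:
  assumes J: "finite J" "J \<noteq> {}" and a: "\<And>j. j \<in> J \<Longrightarrow> kbound M (a j) (C j)" and b: "kernel M b"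
    and le: "AE x in M. AE y in M. b x y \<le> gmean J (\<lambda>j. a j x y)"
  shows "kbound M b (gmean J C)"
  unfolding kbound_def
proof (intro conjI allI impI b gmean_nonneg)
  fix f g assume f: "L2 M f" and g: "L2 M g"
  note [measurable] = kernel_measurable[OF b] kernel_measurable[OF kbound_kernel[OF a]] L2_measurable[OF f] L2_measurable[OF g]
  have nn: "0 \<le> b x y" "j \<in> J \<Longrightarrow> 0 \<le> a j x y" for x y j
    using kernel_nonneg[OF b] kernel_nonneg[OF kbound_kernel[OF a]] by auto
  have form: "(\<integral>\<^sup>+x. kabs M k f x * ennreal (cmod (g x)) \<partial>M) = (\<integral>\<^sup>+x. \<integral>\<^sup>+y. ennreal (k x y * (cmod (f y) * cmod (g x))) \<partial>M \<partial>M)"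
    if k: "kernel M k" for k
  proof -
    note [measurable] = kernel_measurable[OF k]
    show ?thesis unfolding kabs_def
      using kernel_nonneg[OF k]
      by (intro nn_integral_cong) (simp add: nn_integral_multc[symmetric] ennreal_mult mult.assoc)
  qed
  let ?w = "\<lambda>j z. a j (fst z) (snd z) * (cmod (f (snd z)) * cmod (g (fst z)))"
  have "(\<integral>\<^sup>+x. kabs M b f x * ennreal (cmod (g x)) \<partial>M) \<le> (\<integral>\<^sup>+x. \<integral>\<^sup>+y. ennreal (gmean J (\<lambda>j. ?w j (x, y))) \<partial>M \<partial>M)"
    unfolding form[OF b]
  proof (rule nn_integral_mono_AE, use le in eventually_elim)
    fix x assume x: "AE y in M. b x y \<le> gmean J (\<lambda>j. a j x y)"
    show "(\<integral>\<^sup>+y. ennreal (b x y * (cmod (f y) * cmod (g x))) \<partial>M) \<le> (\<integral>\<^sup>+y. ennreal (gmean J (\<lambda>j. ?w j (x, y))) \<partial>M)"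
    proof (rule nn_integral_mono_AE, use x in eventually_elim)
      fix y assume "b x y \<le> gmean J (\<lambda>j. a j x y)"
      then have "b x y * (cmod (f y) * cmod (g x)) \<le> gmean J (\<lambda>j. a j x y) * gmean J (\<lambda>j. cmod (f y) * cmod (g x))"
        by (simp add: gmean_const[OF J] mult_right_mono)
      also have "\<dots> = gmean J (\<lambda>j. ?w j (x, y))" using nn by (simp add: gmean_mult)
      finally show "ennreal (b x y * (cmod (f y) * cmod (g x))) \<le> ennreal (gmean J (\<lambda>j. ?w j (x, y)))"
        by (rule ennreal_leI)
    qed
  qed
  also have "\<dots> = (\<integral>\<^sup>+z. ennreal (gmean J (\<lambda>j. ?w j z)) \<partial>(M \<Otimes>\<^sub>M M))"
  proof (rule nn_integral_fst)
    have "(\<lambda>z. gmean J (\<lambda>j. ?w j z)) \<in> borel_measurable (M \<Otimes>\<^sub>M M)"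
      unfolding gmean_def
    proof (rule borel_measurable_prod)
      fix j assume j: "j \<in> J"
      note [measurable] = kernel_measurable[OF kbound_kernel[OF a[OF j]]]
      show "(\<lambda>z. ?w j z powr (1 / card J)) \<in> borel_measurable (M \<Otimes>\<^sub>M M)" by measurable
    qed
    then show "(\<lambda>z. ennreal (gmean J (\<lambda>j. ?w j z))) \<in> borel_measurable (M \<Otimes>\<^sub>M M)" by measurable
  qed
  also have "\<dots> \<le> ennreal (gmean J (\<lambda>j. C j * nrm M f * nrm M g))"
  proof (rule nn_integral_gmean_le[OF J])
    fix j assume j: "j \<in> J"
    note [measurable] = kernel_measurable[OF kbound_kernel[OF a[OF j]]]
    show m: "?w j \<in> borel_measurable (M \<Otimes>\<^sub>M M)" by measurable
    show "0 \<le> C j * nrm M f * nrm M g" using kbound_nonneg[OF a[OF j]] by simp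
    show "0 \<le> ?w j x" for x using nn j by simp
    have "(\<integral>\<^sup>+z. ennreal (?w j z) \<partial>(M \<Otimes>\<^sub>M M)) = (\<integral>\<^sup>+x. \<integral>\<^sup>+y. ennreal (?w j (x, y)) \<partial>M \<partial>M)"
      by (rule nn_integral_fst[symmetric]) (use m in measurable)
    also have "\<dots> = (\<integral>\<^sup>+x. kabs M (a j) f x * ennreal (cmod (g x)) \<partial>M)"
      using form[OF kbound_kernel[OF a[OF j]]] by simp
    also have "\<dots> \<le> ennreal (C j * nrm M f * nrm M g)" by (rule kboundD[OF a[OF j] f g])
    finally show "(\<integral>\<^sup>+z. ennreal (?w j z) \<partial>(M \<Otimes>\<^sub>M M)) \<le> ennreal (C j * nrm M f * nrm M g)" .
  qed
  also have "gmean J (\<lambda>j. C j * nrm M f * nrm M g) = gmean J C * nrm M f * nrm M g"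
    using kbound_nonneg[OF a] by (simp add: gmean_mult gmean_const[OF J])
  finally show "(\<integral>\<^sup>+x. kabs M b f x * ennreal (cmod (g x)) \<partial>M) \<le> ennreal (gmean J C * nrm M f * nrm M g)" .
qed

subsection \<open>Truncation\<close>

text \<open>\<open>U\<close> is the region removed. With the negation of \<open>U\<close> in its
  place the same definition gives the head, supported in \<open>U\<close>.\<close>

definition tail :: "('a \<Rightarrow> 'a \<Rightarrow> bool) \<Rightarrow> 'a kernel \<Rightarrow> 'a kernel" where
  "tail U a = (\<lambda>x y. if U x y then 0 else a x y)"

text \<open>One exhaustion for all kernels of the family at once, so that their tails can be
  compared with each other. Eventual membership makes the tails tend to 0; the box and the height
  \<open>n\<close> make the heads compact.\<close>

definition truncation :: "'i set \<Rightarrow> ('i \<Rightarrow> 'a kernel) \<Rightarrow> (nat \<Rightarrow> 'a \<Rightarrow> 'a \<Rightarrow> bool) \<Rightarrow> bool" where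
  "truncation J a U \<longleftrightarrow> (\<forall>n. Measurable.pred (M \<Otimes>\<^sub>M M) (case_prod (U n))) \<and>
     (\<forall>x\<in>space M. \<forall>y\<in>space M. \<forall>\<^sub>F n in sequentially. U n x y) \<and>
     (\<forall>n. \<exists>E. E \<in> sets M \<and> emeasure M E < \<infinity> \<and>
        (\<forall>x y. U n x y \<longrightarrow> (x, y) \<in> E \<times> E \<and> (\<forall>j\<in>J. a j x y \<le> real n)))"

lemma truncation_ex:
  assumes J: "finite J" and a: "\<And>j. j \<in> J \<Longrightarrow> kernel M (a j)"
  shows "\<exists>U. truncation J a U"
proof -
  obtain X :: "nat \<Rightarrow> 'a set" where X: "range X \<subseteq> sets M" "(\<Union>i. X i) = space M"
    "\<And>i. emeasure M (X i) \<noteq> \<infinity>" "incseq X"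
    using sigma_finite_incseq by blast
  have [measurable]: "X n \<in> sets M" for n using X by auto
  define U where "U n x y \<longleftrightarrow> x \<in> X n \<and> y \<in> X n \<and> (\<forall>j\<in>J. a j x y \<le> real n)" for n x y
  have "Measurable.pred (M \<Otimes>\<^sub>M M) (case_prod (U n))" for n
  proof -
    have "Measurable.pred (M \<Otimes>\<^sub>M M) (\<lambda>z. \<forall>j\<in>J. a j (fst z) (snd z) \<le> real n)"
    proof (rule pred_intros_finite(3)[OF J])
      fix j assume "j \<in> J"
      note [measurable] = kernel_measurable[OF a[OF this]]
      show "Measurable.pred (M \<Otimes>\<^sub>M M) (\<lambda>z. a j (fst z) (snd z) \<le> real n)" by measurable
    qed
    note [measurable] = this
    have "Measurable.pred (M \<Otimes>\<^sub>M M) (\<lambda>z. fst z \<in> X n \<and> snd z \<in> X n \<and> (\<forall>j\<in>J. a j (fst z) (snd z) \<le> real n))"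
      by measurable
    then show ?thesis by (simp add: U_def case_prod_beta')
  qed
  moreover have "\<forall>\<^sub>F n in sequentially. U n x y" if x: "x \<in> space M" and y: "y \<in> space M" for x y
  proof -
    have *: "\<forall>\<^sub>F n in sequentially. w \<in> X n" if w: "w \<in> space M" for w
    proof -
      obtain N where "w \<in> X N" using X(2) w by auto
      then show ?thesis
        using incseqD[OF X(4)] by (auto simp: eventually_sequentially intro!: exI[of _ N])
    qed
    have "\<forall>\<^sub>F n in sequentially. \<forall>j\<in>J. a j x y \<le> real n"
    proof (rule eventually_ball_finite[OF J], intro ballI)
      fix j
      show "\<forall>\<^sub>F n in sequentially. a j x y \<le> real n"
        using filterlim_real_sequentially by (auto simp: filterlim_at_top)
    qed
    with *[OF x] *[OF y] show ?thesis unfolding U_def by eventually_elim simp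
  qed
  moreover have "\<exists>E. E \<in> sets M \<and> emeasure M E < \<infinity> \<and>
        (\<forall>x y. U n x y \<longrightarrow> (x, y) \<in> E \<times> E \<and> (\<forall>j\<in>J. a j x y \<le> real n))" for n
    by (rule exI[of _ "X n"]) (use X(3)[of n] in \<open>auto simp: U_def less_top\<close>)
  ultimately show ?thesis unfolding truncation_def by blast
qed

lemma truncation_box:
  assumes "truncation J a U"
  obtains E where "E \<in> sets M" "emeasure M E < \<infinity>" "\<And>x y. U n x y \<Longrightarrow> (x, y) \<in> E \<times> E"
    "\<And>x y j. U n x y \<Longrightarrow> j \<in> J \<Longrightarrow> a j x y \<le> real n"
proof -
  have "\<exists>E. E \<in> sets M \<and> emeasure M E < \<infinity> \<and>
        (\<forall>x y. U n x y \<longrightarrow> (x, y) \<in> E \<times> E \<and> (\<forall>j\<in>J. a j x y \<le> real n))"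
    using assms by (simp add: truncation_def)
  then obtain E where E: "E \<in> sets M" "emeasure M E < \<infinity>"
    "\<forall>x y. U n x y \<longrightarrow> (x, y) \<in> E \<times> E \<and> (\<forall>j\<in>J. a j x y \<le> real n)" by (elim exE conjE)
  show thesis by (rule that[OF E(1,2)]) (use E(3) in simp_all)
qed

lemma kernel_tail:
  assumes U: "truncation J a U" and b: "kernel M b"
  shows "kernel M (tail (U n) b)" "kernel M (tail (\<lambda>x y. \<not> U n x y) b)"
proof -
  note [measurable] = kernel_measurable[OF b]
  have [measurable]: "Measurable.pred (M \<Otimes>\<^sub>M M) (\<lambda>z. U n (fst z) (snd z))"
    using U by (simp add: truncation_def case_prod_beta')
  have "(\<lambda>z. if U n (fst z) (snd z) then 0 else b (fst z) (snd z)) \<in> borel_measurable (M \<Otimes>\<^sub>M M)"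
    "(\<lambda>z. if \<not> U n (fst z) (snd z) then 0 else b (fst z) (snd z)) \<in> borel_measurable (M \<Otimes>\<^sub>M M)"
    by measurable
  then show "kernel M (tail (U n) b)" "kernel M (tail (\<lambda>x y. \<not> U n x y) b)"
    using kernel_nonneg[OF b] by (simp_all add: kernel_def tail_def case_prod_beta')
qed

lemma tail_tendsto_0:
  assumes U: "truncation J a U" and "x \<in> space M" "y \<in> space M"
  shows "(\<lambda>n. tail (U n) b x y) \<longlonglongrightarrow> 0"
proof (rule tendsto_eventually)
  have "\<forall>\<^sub>F n in sequentially. U n x y" using assms by (simp add: truncation_def)
  then show "\<forall>\<^sub>F n in sequentially. tail (U n) b x y = 0"
    by eventually_elim (simp add: tail_def)
qed

lemma tail_le: "kernel M b \<Longrightarrow> tail U b x y \<le> b x y"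
  using kernel_nonneg[of M b] by (simp add: tail_def)

lemma kbound_tail:
  assumes U: "truncation J a U" and b: "kbound M b C" and e: "e > 0"
  shows "\<forall>\<^sub>F n in sequentially. kbound M (tail (U n) b) (gamma_op M (kop M b) + e)"
proof (rule kbound_dominated_null[OF b _ _ _ _ e])
  show "kernel M (tail (U n) b)" for n by (rule kernel_tail(1)[OF U kbound_kernel[OF b]])
  show "AE y in M. AE x in M. (\<lambda>n. tail (U n) b x y) \<longlonglongrightarrow> 0"
    by (intro AE_I2 tail_tendsto_0[OF U])
qed (simp_all add: tail_le[OF kbound_kernel[OF b]])

text \<open>The head is bounded and supported in a box of finite measure, hence compact, so only the
  norm of the tail contributes to \<open>gamma_op\<close>.\<close>

lemma gamma_le_tail:
  assumes U: "truncation J a U" and b: "kernel M b" and t: "kbound M (tail (U n) b) c"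
    and bnd: "\<And>x y. U n x y \<Longrightarrow> b x y \<le> real K"
  shows "gamma_op M (kop M b) \<le> c" "\<exists>C. kbound M b C"
proof -
  obtain E where E: "E \<in> sets M" "emeasure M E < \<infinity>" "\<And>x y. U n x y \<Longrightarrow> (x, y) \<in> E \<times> E"
    using truncation_box[OF U] by metis
  let ?h = "tail (\<lambda>x y. \<not> U n x y) b"
  have h: "kcompact ?h"
  proof (rule kcompact_box[OF kernel_tail(2)[OF U b] E(1,2)])
    fix x y
    show "?h x y \<le> real K * indicator (E \<times> E) (x, y)"
    proof (cases "U n x y")
      case True
      then show ?thesis using bnd[OF True] E(3)[OF True] by (simp add: tail_def)
    qed (simp add: tail_def)
  qed
  then obtain D where D: "kbound M ?h D" by (auto simp: kcompact_def)
  have eq: "b = (\<lambda>x y. ?h x y + tail (U n) b x y)"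
    by (auto simp: tail_def fun_eq_iff)
  show "\<exists>C. kbound M b C" using kbound_add[OF D t] eq by auto
  have "gamma_op M (kop M b) \<le> gamma_op M (kop M ?h) + gamma_op M (kop M (tail (U n) b))"
    using gamma_kop_add[OF D t] eq by simp
  then show "gamma_op M (kop M b) \<le> c"
    using h gamma_kop_le[OF t] by (simp add: kcompact_def)
qed

text \<open>Realises \<open>gamma_op\<close> as an operator norm up to a compact summand, which is
  the input that the Neumann series asks for.\<close>

lemma ess_norm_decomposition:
  assumes b: "kbound M b C" and c: "gamma_op M (kop M b) < c"
  shows "\<exists>p q. kcompact p \<and> kbound M q c \<and> b = (\<lambda>x y. p x y + q x y)"
proof -
  obtain U where U: "truncation {b} id U"
    using truncation_ex[of "{b}" id] kbound_kernel[OF b] by auto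
  have "\<forall>\<^sub>F n in sequentially. kbound M (tail (U n) b) (gamma_op M (kop M b) + (c - gamma_op M (kop M b)))"
    by (rule kbound_tail[OF U b]) (use c in simp)
  then obtain n where n: "kbound M (tail (U n) b) c"
    using eventually_happens'[OF sequentially_bot] by fastforce
  obtain E where E: "E \<in> sets M" "emeasure M E < \<infinity>" "\<And>x y. U n x y \<Longrightarrow> (x, y) \<in> E \<times> E"
    "\<And>x y. U n x y \<Longrightarrow> b x y \<le> real n"
    using truncation_box[OF U, of n thesis] by (metis id_apply insertI1)
  let ?h = "tail (\<lambda>x y. \<not> U n x y) b"
  have h: "kcompact ?h"
  proof (rule kcompact_box[OF kernel_tail(2)[OF U kbound_kernel[OF b]] E(1,2)])
    fix x y
    show "?h x y \<le> real n * indicator (E \<times> E) (x, y)"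
    proof (cases "U n x y")
      case True
      then show ?thesis using E(3,4)[OF True] by (simp add: tail_def)
    qed (simp add: tail_def)
  qed
  have eq: "b = (\<lambda>x y. ?h x y + tail (U n) b x y)"
    by (auto simp: tail_def fun_eq_iff)
  show ?thesis using h n eq by blast
qed

lemma powr_inverse_le:
  assumes "0 \<le> t" "t \<le> real n" "k \<ge> 1"
  shows "t powr (1 / real k) \<le> real (Suc n)"
proof -
  have "t powr (1 / real k) \<le> real (Suc n) powr (1 / real k)"
    using assms by (intro powr_mono2) auto
  also have "\<dots> \<le> real (Suc n) powr 1"
    using assms by (intro powr_mono) auto
  finally show ?thesis by simp
qed

text \<open>With a common truncation, the tail of the mean is dominated by the mean of the tails, so
  the operator norm inequality \<open>kbound_gmean\<close>, applied to tails, becomes an inequality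
  for \<open>gamma_op\<close>.\<close>

theorem gamma_gmean:
  assumes J: "finite J" "J \<noteq> {}" and a: "\<And>j. j \<in> J \<Longrightarrow> kbound M (a j) (C j)" and b: "kernel M b"
    and le: "AE x in M. AE y in M. b x y \<le> gmean J (\<lambda>j. a j x y)"
  shows "gamma_op M (kop M b) \<le> gmean J (\<lambda>j. gamma_op M (kop M (a j)))"
proof -
  \<comment> \<open>The domination of \<open>b\<close> holds only almost everywhere; this version
    satisfies it everywhere, so that the truncation region of the \<open>a j\<close> bounds it
    pointwise.\<close>
  define b' where "b' x y = min (b x y) (gmean J (\<lambda>j. a j x y))" for x y
  have card: "card J \<ge> 1" using J by (simp add: Suc_le_eq card_gt_0_iff)
  have nna: "0 \<le> a j x y" if "j \<in> J" for j x y using kernel_nonneg[OF kbound_kernel[OF a[OF that]]] .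
  have b'k: "kernel M b'"
  proof -
    note [measurable] = kernel_measurable[OF b]
    have [measurable]: "(\<lambda>z. gmean J (\<lambda>j. a j (fst z) (snd z))) \<in> borel_measurable (M \<Otimes>\<^sub>M M)"
      unfolding gmean_def
    proof (rule borel_measurable_prod)
      fix j assume j: "j \<in> J"
      note [measurable] = kernel_measurable[OF kbound_kernel[OF a[OF j]]]
      show "(\<lambda>z. a j (fst z) (snd z) powr (1 / card J)) \<in> borel_measurable (M \<Otimes>\<^sub>M M)" by measurable
    qed
    have "(\<lambda>z. min (b (fst z) (snd z)) (gmean J (\<lambda>j. a j (fst z) (snd z)))) \<in> borel_measurable (M \<Otimes>\<^sub>M M)"
      by measurable
    then show ?thesis using kernel_nonneg[OF b] by (simp add: kernel_def b'_def case_prod_beta' gmean_nonneg)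
  qed
  have b'C: "kbound M b' (gmean J C)"
    by (rule kbound_gmean[OF J a b'k]) (simp_all add: b'_def)
  have bC: "kbound M b (gmean J C)" by (rule kbound_gmean[OF J a b le])
  have bb': "AE x in M. AE y in M. b x y = b' x y"
    using le by (auto simp: b'_def elim!: eventually_mono)
  have "gamma_op M (kop M b) = gamma_op M (kop M b')"
    by (rule gamma_op_cong[OF blin_kop[OF bC] blin_kop[OF b'C]])
      (rule kop_cong_kernel[OF kernel_measurable[OF b] kernel_measurable[OF b'k] bb' L2_measurable])
  also have "\<dots> \<le> gmean J (\<lambda>j. gamma_op M (kop M (a j)))"
  proof -
    have "\<exists>U. truncation J a U"
      by (rule truncation_ex[OF J(1)]) (rule kbound_kernel[OF a])
    then obtain U where U: "truncation J a U" by blast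
    have *: "gamma_op M (kop M b') \<le> gmean J (\<lambda>j. gamma_op M (kop M (a j)) + e)" if e: "e > 0" for e
    proof -
      have "\<forall>\<^sub>F n in sequentially. \<forall>j\<in>J. kbound M (tail (U n) (a j)) (gamma_op M (kop M (a j)) + e)"
        by (intro eventually_ball_finite J ballI kbound_tail[OF U a e])
      then obtain n where n: "\<And>j. j \<in> J \<Longrightarrow> kbound M (tail (U n) (a j)) (gamma_op M (kop M (a j)) + e)"
        using eventually_happens'[OF sequentially_bot] by blast
      have t: "kbound M (tail (U n) b') (gmean J (\<lambda>j. gamma_op M (kop M (a j)) + e))"
        by (rule kbound_gmean[OF J n kernel_tail(1)[OF U b'k]])
          (simp_all add: tail_def b'_def gmean_zero[OF J])
      have bnd: "b' x y \<le> real (Suc n ^ card J)" if "U n x y" for x y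
      proof -
        have "a j x y \<le> real n" if "j \<in> J" for j
          by (rule truncation_box[OF U, of n]) (use \<open>U n x y\<close> that in blast)
        then have "(\<Prod>j\<in>J. a j x y powr (1 / card J)) \<le> (\<Prod>j\<in>J. real (Suc n))"
          using nna card by (intro prod_mono conjI powr_inverse_le) auto
        then show ?thesis by (simp add: b'_def gmean_def min_le_iff_disj)
      qed
      show ?thesis by (rule gamma_le_tail(1)[OF U b'k t bnd])
    qed
    have "((\<lambda>e. gmean J (\<lambda>j. gamma_op M (kop M (a j)) + e)) \<longlongrightarrow> gmean J (\<lambda>j. gamma_op M (kop M (a j)))) (at_right 0)"
      by (intro tendsto_gmean_add J gamma_kop_nonneg[OF a])
    then show ?thesis
      by (rule tendsto_lowerbound) (use * in \<open>auto simp: eventually_at_filter\<close>)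
  qed
  finally show ?thesis .
qed

text \<open>A tail and its transpose have the same norm bound, and transposing a tail amounts to
  reflecting the truncation region.\<close>

lemma gamma_ktrans_le:
  assumes a: "kbound M a C"
  shows "gamma_op M (kop M (ktrans a)) \<le> gamma_op M (kop M a)"
proof (rule field_le_epsilon)
  fix e :: real assume e: "e > 0"
  \<comment> \<open>Both \<open>a\<close> and its transpose are listed because reflecting
    \<open>U\<close> exchanges their height conditions; so the reflection \<open>?V\<close> is again
    a truncation.\<close>
  have "\<exists>U. truncation {0::nat, 1} (\<lambda>i. if i = 0 then a else ktrans a) U"
    by (rule truncation_ex) (auto intro: kbound_kernel[OF a] kernel_ktrans)
  then obtain U where U: "truncation {0::nat, 1} (\<lambda>i. if i = 0 then a else ktrans a) U" by blast
  let ?V = "\<lambda>n x y. U n y x"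
  have V: "truncation {0::nat, 1} (\<lambda>i. if i = 0 then a else ktrans a) ?V"
    unfolding truncation_def
  proof (intro conjI allI ballI)
    fix n
    have "Measurable.pred (M \<Otimes>\<^sub>M M) (case_prod (U n))" using U by (simp add: truncation_def)
    from measurable_pair_swap[OF this]
    show "Measurable.pred (M \<Otimes>\<^sub>M M) (\<lambda>(x, y). U n y x)" by (simp add: case_prod_beta')
    obtain E where E: "E \<in> sets M" "emeasure M E < \<infinity>"
      "\<forall>x y. U n x y \<longrightarrow> (x, y) \<in> E \<times> E \<and> (\<forall>i\<in>{0::nat, 1}. (if i = 0 then a else ktrans a) x y \<le> real n)"
      using U unfolding truncation_def by blast
    show "\<exists>E. E \<in> sets M \<and> emeasure M E < \<infinity> \<and> (\<forall>x y. U n y x \<longrightarrow> (x, y) \<in> E \<times> E \<and>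
        (\<forall>i\<in>{0::nat, 1}. (if i = 0 then a else ktrans a) x y \<le> real n))"
      using E by (intro exI[of _ E]) (auto simp: ktrans_def)
  qed (use U in \<open>auto simp: truncation_def\<close>)
  obtain n where n: "kbound M (tail (U n) a) (gamma_op M (kop M a) + e)"
    using kbound_tail[OF U a e] eventually_happens'[OF sequentially_bot] by blast
  have t: "kbound M (tail (?V n) (ktrans a)) (gamma_op M (kop M a) + e)"
    using kbound_ktrans[OF n] by (simp add: tail_def ktrans_def)
  have "ktrans a x y \<le> real n" if "?V n x y" for x y
  proof -
    have "\<forall>j\<in>{0::nat, 1}. (if j = 0 then a else ktrans a) x y \<le> real n"
      using V that unfolding truncation_def by blast
    then show ?thesis by simp
  qed
  then show "gamma_op M (kop M (ktrans a)) \<le> gamma_op M (kop M a) + e"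
    by (rule gamma_le_tail(1)[OF V kernel_ktrans[OF kbound_kernel[OF a]] t])
qed

theorem gamma_ktrans:
  assumes a: "kbound M a C"
  shows "gamma_op M (kop M (ktrans a)) = gamma_op M (kop M a)"
  using gamma_ktrans_le[OF a] gamma_ktrans_le[OF kbound_ktrans[OF a]] by simp

subsection \<open>The C*-identity for the essential norm\<close>

lemma kbound_sqrt:
  assumes r: "kbound M r D" and c: "kbound M (kcomp M (ktrans r) r) c"
  shows "kbound M r (sqrt c)"
proof (rule kboundI_kabs[OF kbound_kernel[OF r]])
  have c0: "0 \<le> c" by (rule kbound_nonneg[OF c])
  then show "0 \<le> sqrt c" by simp
  fix f assume f: "L2 M f"
  note r' = kbound_ktrans[OF r]
  have h: "L2 M (kmap r f)" by (rule kmap(2)[OF r f])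
  have "(\<integral>\<^sup>+x. (kabs M r f x)\<^sup>2 \<partial>M) = (\<integral>\<^sup>+x. kabs M r f x * ennreal (cmod (kmap r f x)) \<partial>M)"
    using kmap(4)[OF r f] by (intro nn_integral_cong_AE) (auto elim!: eventually_mono simp: power2_eq_square)
  also have "\<dots> = (\<integral>\<^sup>+x. kabs M (ktrans r) (kmap r f) x * ennreal (cmod (f x)) \<partial>M)"
    by (rule kform_ktrans[OF kbound_kernel[OF r] L2_measurable[OF f] L2_measurable[OF h], symmetric])
  also have "\<dots> = (\<integral>\<^sup>+x. kabs M (kcomp M (ktrans r) r) f x * ennreal (cmod (f x)) \<partial>M)"
  proof (rule nn_integral_cong_AE, use kcomp_finite[OF r' r] AE_space in eventually_elim)
    fix x assume x: "AE z in M. (\<integral>\<^sup>+y. ennreal (ktrans r x y * r y z) \<partial>M) < \<infinity>" "x \<in> space M"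
    have "kabs M (ktrans r) (kmap r f) x = (\<integral>\<^sup>+z. (\<integral>\<^sup>+y. ennreal (ktrans r x y * r y z) \<partial>M) * ennreal (cmod (f z)) \<partial>M)"
      by (rule kcomp_Tonelli(1)[OF kbound_kernel[OF r'] r f x(2), symmetric])
    also have "\<dots> = kabs M (kcomp M (ktrans r) r) f x"
      unfolding kabs_def using x(1)
      by (intro nn_integral_cong_AE) (auto elim!: eventually_mono simp: kcomp_def ennreal_mult)
    finally show "kabs M (ktrans r) (kmap r f) x * ennreal (cmod (f x)) = kabs M (kcomp M (ktrans r) r) f x * ennreal (cmod (f x))"
      by simp
  qed
  also have "\<dots> \<le> ennreal (c * nrm M f * nrm M f)" by (rule kboundD[OF c f f])
  also have "c * nrm M f * nrm M f = (sqrt c * nrm M f)\<^sup>2"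
    unfolding power_mult_distrib real_sqrt_pow2[OF c0] by (simp add: power2_eq_square)
  finally show "(\<integral>\<^sup>+x. (kabs M r f x)\<^sup>2 \<partial>M) \<le> ennreal ((sqrt c * nrm M f)\<^sup>2)" .
qed

text \<open>Let \<open>?R n\<close> be the tails of \<open>a\<close> and \<open>?s n\<close> the
  adjoint of \<open>?R n\<close> times \<open>?R n\<close>. These products are dominated by
  \<open>?t\<close> and tend to 0 almost everywhere, so their norms are eventually at most
  \<open>gamma_op M (kop M ?t) + e\<close> by \<open>kbound_dominated_null\<close>. Hence
  \<open>?R n\<close> has norm at most the square root of that, and this bounds
  \<open>gamma_op\<close> of \<open>a\<close>.\<close>

theorem gamma_square_le:
  assumes a: "kbound M a C"
  shows "(gamma_op M (kop M a))\<^sup>2 \<le> gamma_op M (kop M (kcomp M (ktrans a) a))"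
proof (rule field_le_epsilon)
  fix e :: real assume e: "e > 0"
  note ka = kbound_kernel[OF a] and a' = kbound_ktrans[OF a]
  let ?t = "kcomp M (ktrans a) a"
  note t = kbound_kcomp[OF a' a]
  obtain U where U: "truncation {a} id U"
    using truncation_ex[of "{a}" id] ka by auto
  let ?R = "\<lambda>n. tail (U n) a"
  let ?s = "\<lambda>n. kcomp M (ktrans (?R n)) (?R n)"
  have Rk: "kernel M (?R n)" for n by (rule kernel_tail(1)[OF U ka])
  have R: "kbound M (?R n) C" for n
    by (rule kbound_mono[OF a Rk]) (simp add: tail_le[OF ka])
  have nn: "0 \<le> a x y" "0 \<le> tail (U n) a x y" for n x y using kernel_nonneg[OF ka] kernel_nonneg[OF Rk] by auto
  have fin: "AE x in M. AE z in M. (\<integral>\<^sup>+y. ennreal (a y x * a y z) \<partial>M) < \<infinity>"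
    using kcomp_finite[OF a' a] by (simp add: ktrans_def)
  have mono: "(\<integral>\<^sup>+y. ennreal (?R n y x * ?R n y z) \<partial>M) \<le> (\<integral>\<^sup>+y. ennreal (a y x * a y z) \<partial>M)" for n x z
    using tail_le[OF ka] nn by (intro nn_integral_mono ennreal_leI mult_mono) auto
  have le: "AE x in M. AE z in M. ?s n x z \<le> ?t x z" for n
    using fin
  proof eventually_elim
    fix x assume "AE z in M. (\<integral>\<^sup>+y. ennreal (a y x * a y z) \<partial>M) < \<infinity>"
    then show "AE z in M. ?s n x z \<le> ?t x z"
      by eventually_elim (use mono in \<open>simp add: kcomp_def ktrans_def enn2real_mono\<close>)
  qed
  \<comment> \<open>\<open>kbound_dominated_null\<close> asks for estimates with either order of the
    variables; symmetry yields one from the other.\<close>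
  have sym: "?s n x z = ?s n z x" "?t x z = ?t z x" for n x z
    by (simp_all add: kcomp_def ktrans_def mult.commute)
  have lim: "AE x in M. AE z in M. (\<lambda>n. ?s n x z) \<longlonglongrightarrow> 0"
    using fin AE_space
  proof eventually_elim
    fix x assume x: "AE z in M. (\<integral>\<^sup>+y. ennreal (a y x * a y z) \<partial>M) < \<infinity>" "x \<in> space M"
    show "AE z in M. (\<lambda>n. ?s n x z) \<longlonglongrightarrow> 0"
      using x(1) AE_space
    proof eventually_elim
      fix z assume z: "(\<integral>\<^sup>+y. ennreal (a y x * a y z) \<partial>M) < \<infinity>" "z \<in> space M"
      note [measurable] = kernel_measurable[OF ka] kernel_measurable[OF Rk] x(2) z(2)
      have "(\<lambda>n. \<integral>\<^sup>+y. ennreal (?R n y x * ?R n y z) \<partial>M) \<longlonglongrightarrow> (\<integral>\<^sup>+y. 0 \<partial>M)"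
      proof (rule nn_integral_dominated_convergence[where w = "\<lambda>y. ennreal (a y x * a y z)"])
        show "AE y in M. ennreal (?R n y x * ?R n y z) \<le> ennreal (a y x * a y z)" for n
          using tail_le[OF ka] nn by (intro AE_I2 ennreal_leI mult_mono) auto
        show "AE y in M. (\<lambda>n. ennreal (?R n y x * ?R n y z)) \<longlonglongrightarrow> 0"
        proof (rule AE_I2)
          fix y assume y: "y \<in> space M"
          have "(\<lambda>n. ?R n y x * ?R n y z) \<longlonglongrightarrow> 0 * 0"
            by (intro tendsto_mult tail_tendsto_0[OF U] y x z)
          from tendsto_ennrealI[OF this] show "(\<lambda>n. ennreal (?R n y x * ?R n y z)) \<longlonglongrightarrow> 0" by simp
        qed
      qed (use z in simp_all)
      then have "(\<lambda>n. \<integral>\<^sup>+y. ennreal (?R n y x * ?R n y z) \<partial>M) \<longlonglongrightarrow> ennreal 0" by simp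
      from tendsto_enn2real[OF this] show "(\<lambda>n. ?s n x z) \<longlonglongrightarrow> 0"
        by (simp add: kcomp_def ktrans_def)
    qed
  qed
  have sk: "kernel M (?s n)" for n by (rule kernel_kcomp[OF kernel_ktrans[OF Rk] Rk])
  have "\<forall>\<^sub>F n in sequentially. kbound M (?s n) (gamma_op M (kop M ?t) + e)"
  proof (rule kbound_dominated_null[OF t sk le _ _ e])
    show "AE z in M. AE x in M. ?s n x z \<le> ?t x z" for n
      using le[of n] by (subst sym(1), subst sym(2))
    show "AE z in M. AE x in M. (\<lambda>n. ?s n x z) \<longlonglongrightarrow> 0"
      using lim by (subst sym(1))
  qed
  then obtain n where n: "kbound M (?s n) (gamma_op M (kop M ?t) + e)"
    using eventually_happens'[OF sequentially_bot] by blast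
  have g0: "0 \<le> gamma_op M (kop M ?t) + e" using gamma_kop_nonneg[OF t] e by simp
  have "a x y \<le> real n" if "U n x y" for x y
    by (rule truncation_box[OF U, of n]) (use that in force)
  then have "gamma_op M (kop M a) \<le> sqrt (gamma_op M (kop M ?t) + e)"
    by (rule gamma_le_tail(1)[OF U ka kbound_sqrt[OF R n]])
  then have "(gamma_op M (kop M a))\<^sup>2 \<le> (sqrt (gamma_op M (kop M ?t) + e))\<^sup>2"
    by (intro power_mono gamma_kop_nonneg[OF a])
  then show "(gamma_op M (kop M a))\<^sup>2 \<le> gamma_op M (kop M ?t) + e"
    using g0 by simp
qed

end

subsection \<open>Submultiplicative sequences\<close>

locale submultiplicative =
  fixes x :: "nat \<Rightarrow> real"
  assumes nonneg: "0 \<le> x n"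
    and submult: "m > 0 \<Longrightarrow> n > 0 \<Longrightarrow> x (m + n) \<le> x m * x n"
begin

definition rate :: real where
  "rate = (INF n\<in>{0<..}. x n powr (1 / real n))"

lemma rate_le: "n > 0 \<Longrightarrow> rate \<le> x n powr (1 / real n)"
  unfolding rate_def by (intro cINF_lower bdd_belowI[of _ 0]) auto

lemma rate_nonneg: "0 \<le> rate"
  unfolding rate_def by (intro cINF_greatest) auto

lemma rate_power_le:
  assumes n: "n > 0"
  shows "rate ^ n \<le> x n"
proof -
  have "rate ^ n \<le> (x n powr (1 / real n)) ^ n"
    by (intro power_mono rate_le n rate_nonneg)
  also have "\<dots> = x n"
    using n nonneg[of n] by (cases "x n = 0") (auto simp: powr_realpow[symmetric] powr_powr)
  finally show ?thesis .
qed

lemma growth: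
  assumes u: "u > rate"
  shows "\<exists>C. 0 \<le> C \<and> (\<forall>n>0. x n \<le> C * u ^ n)"
proof -
  have u0: "u > 0" using u rate_nonneg by linarith
  have "\<exists>k\<in>{0<..}. x k powr (1 / real k) < u"
    using u unfolding rate_def by (subst (asm) cINF_less_iff) (auto intro: bdd_belowI[of _ 0])
  then obtain k :: nat where k: "k > 0" "x k powr (1 / real k) < u" by auto
  have xk: "x k \<le> u ^ k"
  proof -
    have "x k = (x k powr (1 / real k)) ^ k"
      using k nonneg[of k] by (cases "x k = 0") (auto simp: powr_realpow[symmetric] powr_powr)
    also have "\<dots> \<le> u ^ k" using k by (intro power_mono) auto
    finally show ?thesis .
  qed
  \<comment> \<open>Subtracting \<open>k\<close> repeatedly ends at an index between 1 and
    \<open>k\<close>; the sum dominates \<open>x r / u ^ r\<close> for each of them.\<close>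
  define C where "C = (\<Sum>r\<in>{1..k}. x r / u ^ r)"
  have C0: "0 \<le> C" unfolding C_def using nonneg u0 by (intro sum_nonneg) auto
  have "x n \<le> C * u ^ n" if "n > 0" for n
    using that
  proof (induction n rule: less_induct)
    case (less n)
    show ?case
    proof (cases "n \<le> k")
      case True
      then have "x n / u ^ n \<le> C"
        unfolding C_def using nonneg u0 less.prems by (intro member_le_sum) auto
      then show ?thesis using u0 by (simp add: divide_le_eq)
    next
      case False
      then have "x n \<le> x k * x (n - k)" using submult[of k "n - k"] k(1) by simp
      also have "\<dots> \<le> u ^ k * (C * u ^ (n - k))"
        using False k xk nonneg u0 by (intro mult_mono less.IH) auto
      also have "\<dots> = C * u ^ n" using False by (simp flip: power_add)
      finally show ?thesis .
    qed
  qed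
  with C0 show ?thesis by blast
qed

text \<open>Fekete's lemma. It is needed because \<open>rho_hat_ess_set\<close> is defined with
  \<open>lim\<close>, which says nothing before convergence is known.\<close>

lemma rate_LIMSEQ: "(\<lambda>n. x (Suc n) powr (1 / real (Suc n))) \<longlonglongrightarrow> rate"
proof (rule LIMSEQ_I)
  fix e :: real assume e: "e > 0"
  define u where "u = rate + e / 2"
  have u: "u > rate" "u > 0" using e rate_nonneg by (auto simp: u_def add_nonneg_pos)
  obtain C0 where C0: "0 \<le> C0" "\<And>n. n > 0 \<Longrightarrow> x n \<le> C0 * u ^ n" using growth[OF u(1)] by blast
  \<comment> \<open>Positive, so that the roots of the constant tend to 1.\<close>
  define C where "C = max C0 1"
  have C: "C > 0" by (simp add: C_def)
  have up: "x (Suc n) powr (1 / real (Suc n)) \<le> C powr (1 / real (Suc n)) * u" for n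
  proof -
    have "x (Suc n) \<le> C * u ^ Suc n"
      using C0(2)[of "Suc n"] u(2) by (intro order_trans[OF C0(2)] mult_right_mono) (auto simp: C_def)
    then have "x (Suc n) powr (1 / real (Suc n)) \<le> (C * u ^ Suc n) powr (1 / real (Suc n))"
      using nonneg by (intro powr_mono2) auto
    also have "\<dots> = C powr (1 / real (Suc n)) * (u ^ Suc n) powr (1 / real (Suc n))"
      using C u(2) by (simp add: powr_mult del: power_Suc)
    also have "(u ^ Suc n) powr (1 / real (Suc n)) = u"
      using u(2) by (simp add: powr_realpow[symmetric] powr_powr del: power_Suc of_nat_Suc)
    finally show ?thesis .
  qed
  have "(\<lambda>n. C powr (1 / real (Suc n)) * u) \<longlonglongrightarrow> C powr 0 * u"
    using C by (intro tendsto_intros LIMSEQ_Suc[OF lim_1_over_n]) auto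
  then have "\<forall>\<^sub>F n in sequentially. C powr (1 / real (Suc n)) * u < rate + e"
    by (rule order_tendstoD) (use C e in \<open>simp add: u_def\<close>)
  then obtain N where N: "\<And>n. n \<ge> N \<Longrightarrow> C powr (1 / real (Suc n)) * u < rate + e"
    by (auto simp: eventually_sequentially)
  show "\<exists>N. \<forall>n\<ge>N. norm (x (Suc n) powr (1 / real (Suc n)) - rate) < e"
  proof (intro exI allI impI)
    fix n assume "n \<ge> N"
    then show "norm (x (Suc n) powr (1 / real (Suc n)) - rate) < e"
      using N[of n] up[of n] rate_le[of "Suc n"] by simp
  qed
qed

end

lemma power_growth_le:
  fixes s t :: real
  assumes s: "0 \<le> s" and t: "0 < t" and le: "\<And>n. n > 0 \<Longrightarrow> s ^ n \<le> C * t ^ n"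
  shows "s \<le> t"
proof (rule ccontr)
  assume "\<not> s \<le> t"
  then have st: "s / t > 1" using t by simp
  obtain n where n: "C < (s / t) ^ n" using real_arch_pow[OF st] by blast
  have "C < (s / t) ^ Suc n"
    using n st power_increasing[of n "Suc n" "s / t"] by linarith
  then have "C * t ^ Suc n < s ^ Suc n"
    using t by (simp add: power_divide pos_less_divide_eq del: power_Suc)
  then show False using le[of "Suc n"] by simp
qed

context sigma_finite_measure
begin

subsection \<open>The essential spectral radius of a positive kernel operator\<close>

lemma represents_power:
  assumes T: "represents T a"
  shows "\<exists>b. represents (T ^^ Suc n) b"
proof (induction n)
  case 0
  have "T ^^ Suc 0 = T" by simp
  with T show ?case by metis
next
  case (Suc n)
  then obtain b where "represents (T ^^ Suc n) b" by blast
  from represents_comp[OF T this] show ?case by (metis funpow.simps(2))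
qed

lemma gamma_power_submultiplicative:
  assumes T: "blin M T"
  shows "submultiplicative (\<lambda>n. gamma_op M (T ^^ n))"
proof
  show "0 \<le> gamma_op M (T ^^ n)" for n by (rule gamma_op_nonneg[OF blin_power[OF T]])
  show "gamma_op M (T ^^ (m + n)) \<le> gamma_op M (T ^^ m) * gamma_op M (T ^^ n)" for m n
    using gamma_op_comp[OF blin_power[OF T, of m] blin_power[OF T, of n]]
    by (simp add: funpow_add o_def)
qed

text \<open>Otherwise \<open>T^n\<close> would be a compact operator plus one of norm below
  \<open>cmod l ^ n\<close>, and a Neumann series would remove \<open>l\<close> from the essential
  spectrum. The case \<open>n = 1\<close> also gives the boundedness that the real supremum in
  \<open>rho_ess\<close> relies on.\<close>

lemma ess_spec_power_le:
  assumes T: "represents T a" and l: "l \<in> ess_spec M T" and n: "n > 0"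
  shows "cmod l ^ n \<le> gamma_op M (T ^^ n)"
proof (rule ccontr)
  assume "\<not> cmod l ^ n \<le> gamma_op M (T ^^ n)"
  then obtain c where c: "gamma_op M (T ^^ n) < c" "c < cmod l ^ n"
    using dense[of "gamma_op M (T ^^ n)" "cmod l ^ n"] by auto
  obtain b where b: "represents (T ^^ n) b"
    using represents_power[OF T, of "n - 1"] n by auto
  obtain C where bC: "kbound M b C" using b by (auto simp: represents_def)
  have "gamma_op M (kop M b) < c" using c represents_gamma[OF b] by simp
  then obtain p q where pq: "kcompact p" "kbound M q c" "b = (\<lambda>x y. p x y + q x y)"
    using ess_norm_decomposition[OF bC] by blast
  obtain D where p: "kbound M p D" using pq by (auto simp: kcompact_def)
  note bT = represents_blin[OF T]
  have "gamma_op M (\<lambda>f x. (T ^^ n) f x - kop M q f x) = gamma_op M (kop M p)"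
  proof (rule gamma_op_cong[OF blin_diff[OF blin_power[OF bT] blin_kop[OF pq(2)]] blin_kop[OF p]])
    fix f assume f: "L2 M f"
    have "AE x in M. (T ^^ n) f x = kop M b f x" using b f by (simp add: represents_def)
    then show "AE x in M. (T ^^ n) f x - kop M q f x = kop M p f x"
      using kop_add[OF p pq(2) f] unfolding pq(3) by eventually_elim simp
  qed
  then have "calkin_eq M (T ^^ n) (kop M q)"
    by (intro calkin_eqI blin_power bT blin_kop[OF pq(2)]) (use pq(1) in \<open>simp add: kcompact_def\<close>)
  then have "l \<notin> ess_spec M T"
    by (rule not_ess_spec_power_bound[OF bT blin_kop[OF pq(2)] _ n kbound_nonneg[OF pq(2)] c(2)])
      (rule kop_bound(2)[OF pq(2)])
  with l show False by simp
qed

lemma ess_spec_bounded: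
  assumes T: "represents T a"
  shows "bdd_above (insert 0 (cmod ` ess_spec M T))"
  using ess_spec_power_le[OF T, of _ 1] gamma_op_nonneg[OF represents_blin[OF T]]
  by (intro bdd_aboveI[of _ "gamma_op M T"]) auto

lemma rho_ess_upper: "represents T a \<Longrightarrow> l \<in> ess_spec M T \<Longrightarrow> cmod l \<le> rho_ess M T"
  unfolding rho_ess_def by (intro cSup_upper ess_spec_bounded) auto

lemma rho_ess_nonneg: "represents T a \<Longrightarrow> 0 \<le> rho_ess M T"
  unfolding rho_ess_def by (intro cSup_upper ess_spec_bounded) auto

lemma rho_ess_least: "(\<And>l. l \<in> ess_spec M T \<Longrightarrow> cmod l \<le> c) \<Longrightarrow> 0 \<le> c \<Longrightarrow> rho_ess M T \<le> c"
  unfolding rho_ess_def by (intro cSup_least) auto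

lemma rho_ess_le_gamma: "represents T a \<Longrightarrow> rho_ess M T \<le> gamma_op M T"
  using ess_spec_power_le[of T a _ 1] gamma_op_nonneg[OF represents_blin]
  by (intro rho_ess_least) auto

text \<open>The growth rate cannot exceed \<open>rho_ess\<close>: for a radius \<open>t'\<close>
  strictly in between, \<open>ess_spec_not_in_disc\<close> yields a point of the essential spectrum
  of modulus at least \<open>t'\<close>.\<close>

theorem gamma_power_growth:
  assumes T: "represents T a" and t: "rho_ess M T < t"
  shows "\<exists>C. 0 \<le> C \<and> (\<forall>n>0. gamma_op M (T ^^ n) \<le> C * t ^ n)"
proof -
  note bT = represents_blin[OF T]
  interpret sm: submultiplicative "\<lambda>n. gamma_op M (T ^^ n)"
    by (rule gamma_power_submultiplicative[OF bT])
  have "sm.rate < t"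
  proof (rule ccontr)
    assume "\<not> sm.rate < t"
    then obtain t' where t': "rho_ess M T < t'" "t' < sm.rate"
      using dense[of "rho_ess M T" "sm.rate"] t by auto
    have "\<exists>l\<in>ess_spec M T. t' \<le> cmod l"
    proof (rule ess_spec_not_in_disc[OF bT _ t'(2)])
      show "0 < t'" using rho_ess_nonneg[OF T] t'(1) by simp
      show "sm.rate ^ n \<le> gamma_op M (T ^^ n)" if "n > 0" for n by (rule sm.rate_power_le[OF that])
      show "\<exists>C. \<forall>n>0. gamma_op M (T ^^ n) \<le> C * u ^ n" if "u > sm.rate" for u
        using sm.growth[OF that] by blast
    qed
    then show False using rho_ess_upper[OF T] t'(1) by fastforce
  qed
  then show ?thesis by (rule sm.growth)
qed

subsection \<open>Adjoint pairs\<close>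

text \<open>Adjointness is recorded by transposed kernels, which pass through products, instead of
  by inner products.\<close>

definition adjpair :: "'a op \<Rightarrow> 'a op \<Rightarrow> bool" where
  "adjpair T T' \<longleftrightarrow> (\<exists>a. represents T a \<and> represents T' (ktrans a))"

lemma adjpair_sym:
  assumes "adjpair T T'"
  shows "adjpair T' T"
proof -
  obtain a where "represents T a" "represents T' (ktrans a)" using assms by (auto simp: adjpair_def)
  then show ?thesis unfolding adjpair_def by (intro exI[of _ "ktrans a"]) simp
qed

lemma adjpair_comp:
  assumes "adjpair S S'" "adjpair T T'"
  shows "adjpair (S \<circ> T) (T' \<circ> S')"
proof -
  obtain a b where a: "represents S a" "represents S' (ktrans a)" and b: "represents T b" "represents T' (ktrans b)"
    using assms by (auto simp: adjpair_def)
  have "represents (T' \<circ> S') (ktrans (kcomp M a b))"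
    unfolding ktrans_kcomp by (rule represents_comp[OF b(2) a(2)])
  with represents_comp[OF a(1) b(1)] show ?thesis by (auto simp: adjpair_def)
qed

lemma adjpair_gamma:
  assumes "adjpair T T'"
  shows "gamma_op M T = gamma_op M T'"
proof -
  obtain a where a: "represents T a" "represents T' (ktrans a)" using assms by (auto simp: adjpair_def)
  obtain C where C: "kbound M a C" using a by (auto simp: represents_def)
  show ?thesis using gamma_ktrans[OF C] represents_gamma[OF a(1)] represents_gamma[OF a(2)] by simp
qed

lemma adjpair_gamma_square: "adjpair T T' \<Longrightarrow> (gamma_op M T)\<^sup>2 \<le> gamma_op M (T' \<circ> T)"
proof -
  assume "adjpair T T'"
  then obtain a where a: "represents T a" "represents T' (ktrans a)" by (auto simp: adjpair_def)
  obtain C where C: "kbound M a C" using a by (auto simp: represents_def)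
  show ?thesis
    using gamma_square_le[OF C] represents_gamma[OF a(1)] represents_gamma[OF represents_comp[OF a(2,1)]] by simp
qed

lemma adjpair_power: "adjpair T T' \<Longrightarrow> adjpair (T ^^ Suc n) (T' ^^ Suc n)"
proof (induction n)
  case 0
  then show ?case by simp
next
  case (Suc n)
  then have "adjpair (T \<circ> T ^^ Suc n) (T' ^^ Suc n \<circ> T')" by (intro adjpair_comp)
  moreover have "T' ^^ Suc n \<circ> T' = T' ^^ Suc (Suc n)" by (simp only: funpow_Suc_right)
  ultimately show ?case by (simp only: funpow.simps(2)[of "Suc n" T])
qed

text \<open>Compared through growth rates and not through resolvents: powers of adjoint operators
  have equal \<open>gamma_op\<close>, and the growth rate determines the radius from both
  sides.\<close>

lemma adjpair_rho_ess_le: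
  assumes "adjpair T T'"
  shows "rho_ess M T \<le> rho_ess M T'"
proof -
  obtain a where a: "represents T a" "represents T' (ktrans a)" using assms by (auto simp: adjpair_def)
  show ?thesis
  proof (rule rho_ess_least[OF _ rho_ess_nonneg[OF a(2)]])
    fix l assume l: "l \<in> ess_spec M T"
    show "cmod l \<le> rho_ess M T'"
    proof (rule field_le_epsilon)
      fix e :: real assume e: "e > 0"
      obtain C where C: "\<And>n. n > 0 \<Longrightarrow> gamma_op M (T' ^^ n) \<le> C * (rho_ess M T' + e) ^ n"
        using gamma_power_growth[OF a(2), of "rho_ess M T' + e"] e by auto
      show "cmod l \<le> rho_ess M T' + e"
      proof (rule power_growth_le)
        show "0 < rho_ess M T' + e" using rho_ess_nonneg[OF a(2)] e by simp
        fix n :: nat assume n: "n > 0"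
        have "gamma_op M (T ^^ n) = gamma_op M (T' ^^ n)"
          using adjpair_gamma[OF adjpair_power[OF assms, of "n - 1"]] n by simp
        then show "cmod l ^ n \<le> C * (rho_ess M T' + e) ^ n"
          using ess_spec_power_le[OF a(1) l n] C[OF n] by simp
      qed simp
    qed
  qed
qed

lemma adjpair_rho_ess: "adjpair T T' \<Longrightarrow> rho_ess M T = rho_ess M T'"
  using adjpair_rho_ess_le adjpair_sym by (intro antisym) blast+

subsection \<open>Bounded sets of positive kernel operators\<close>

definition bset :: "'a op set \<Rightarrow> real \<Rightarrow> bool" where
  "bset S C \<longleftrightarrow> 0 \<le> C \<and> (\<forall>T\<in>S. \<exists>a. represents T a \<and> kbound M a C)"

lemma bset_represents: "bset S C \<Longrightarrow> T \<in> S \<Longrightarrow> \<exists>a. represents T a"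
  by (auto simp: bset_def)

lemma bset_gamma:
  assumes "bset S C" "T \<in> S"
  shows "gamma_op M T \<le> C"
proof -
  obtain a where a: "represents T a" "kbound M a C" using assms by (auto simp: bset_def)
  show ?thesis using represents_gamma[OF a(1)] gamma_kop_le[OF a(2)] by simp
qed

lemma bset_setprod:
  assumes S: "bset S C" and T: "bset T D"
  shows "bset (setprod S T) (C * D)"
  unfolding bset_def
proof (intro conjI ballI)
  show "0 \<le> C * D" using S T by (simp add: bset_def)
  fix U assume "U \<in> setprod S T"
  then obtain A B where AB: "U = A \<circ> B" "A \<in> S" "B \<in> T" by (auto simp: setprod_def)
  obtain a where a: "represents A a" "kbound M a C" using S AB by (auto simp: bset_def)
  obtain b where b: "represents B b" "kbound M b D" using T AB by (auto simp: bset_def)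
  show "\<exists>c. represents U c \<and> kbound M c (C * D)"
    using represents_comp[OF a(1) b(1)] kbound_kcomp[OF a(2) b(2)] AB(1) by blast
qed

lemma setprod_id: "setprod S {id} = S"
  by (auto simp: setprod_def)

lemma id_setprod: "setprod {id} S = S"
  by (auto simp: setprod_def)

lemma setprod_assoc: "setprod (setprod S T) U = setprod S (setprod T U)"
proof (intro equalityI subsetI)
  fix f assume "f \<in> setprod (setprod S T) U"
  then obtain A B D where "f = A \<circ> B \<circ> D" "A \<in> S" "B \<in> T" "D \<in> U" by (auto simp: setprod_def)
  then show "f \<in> setprod S (setprod T U)" unfolding setprod_def comp_assoc by blast
next
  fix f assume "f \<in> setprod S (setprod T U)"
  then obtain A B D where "f = A \<circ> (B \<circ> D)" "A \<in> S" "B \<in> T" "D \<in> U" by (auto simp: setprod_def)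
  then show "f \<in> setprod (setprod S T) U" unfolding setprod_def comp_assoc[symmetric] by blast
qed

lemma setpow_add: "setpow S (m + n) = setprod (setpow S m) (setpow S n)"
  by (induction m) (simp_all add: id_setprod setprod_assoc)

lemma setpow_Suc_right: "setpow S (Suc n) = setprod (setpow S n) S"
  using setpow_add[of S n 1] by (simp add: setprod_id)

lemma bset_setpow: "bset S C \<Longrightarrow> bset (setpow S (Suc n)) (C ^ Suc n)"
proof (induction n)
  case 0
  then show ?case by (simp add: setprod_id)
next
  case (Suc n)
  then show ?case using bset_setprod[of S C "setpow S (Suc n)" "C ^ Suc n"] by simp
qed

lemma bset_setpow_pos:
  assumes "bset S C" "n > 0"
  shows "bset (setpow S n) (C ^ n)"
  using bset_setpow[OF assms(1), of "n - 1"] by (simp only: Suc_diff_1[OF assms(2)])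

lemma funpow_in_setpow: "T \<in> S \<Longrightarrow> T ^^ n \<in> setpow S n"
proof (induction n)
  case (Suc n)
  then have "T \<circ> T ^^ n \<in> setprod S (setpow S n)" unfolding setprod_def by blast
  then show ?case by (simp only: funpow.simps setpow.simps)
qed simp

lemma gamma_set_bdd:
  assumes S: "bset S C"
  shows "bdd_above (insert 0 (gamma_op M ` S))"
proof (rule bdd_aboveI[of _ C])
  fix v assume "v \<in> insert 0 (gamma_op M ` S)"
  then show "v \<le> C" using bset_gamma[OF S] S unfolding bset_def by blast
qed

lemma gamma_set_upper: "bset S C \<Longrightarrow> T \<in> S \<Longrightarrow> gamma_op M T \<le> gamma_set M S"
  unfolding gamma_set_def by (intro cSup_upper gamma_set_bdd) auto

lemma gamma_set_nonneg: "bset S C \<Longrightarrow> 0 \<le> gamma_set M S"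
  unfolding gamma_set_def by (intro cSup_upper gamma_set_bdd) auto

lemma gamma_set_least: "(\<And>T. T \<in> S \<Longrightarrow> gamma_op M T \<le> c) \<Longrightarrow> 0 \<le> c \<Longrightarrow> gamma_set M S \<le> c"
  unfolding gamma_set_def by (intro cSup_least) auto

lemma gamma_set_setprod:
  assumes S: "bset S C" and T: "bset T D"
  shows "gamma_set M (setprod S T) \<le> gamma_set M S * gamma_set M T"
proof (rule gamma_set_least)
  fix U assume "U \<in> setprod S T"
  then obtain A B where AB: "U = A \<circ> B" "A \<in> S" "B \<in> T" by (auto simp: setprod_def)
  have bl: "blin M A" "blin M B"
    using bset_represents[OF S AB(2)] bset_represents[OF T AB(3)] by (auto dest: represents_blin)
  have "gamma_op M U \<le> gamma_op M A * gamma_op M B"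
    using gamma_op_comp[OF bl] AB(1) by (simp add: o_def)
  also have "\<dots> \<le> gamma_set M S * gamma_set M T"
    by (intro mult_mono gamma_set_upper[OF S] gamma_set_upper[OF T] AB gamma_set_nonneg[OF S] gamma_op_nonneg bl)
  finally show "gamma_op M U \<le> gamma_set M S * gamma_set M T" .
qed (use gamma_set_nonneg[OF S] gamma_set_nonneg[OF T] in simp)

text \<open>The power at 0 is \<open>{id}\<close>, and the identity has in general no kernel; the
  sequence therefore takes the dummy value 0 there, and submultiplicativity concerns positive
  indices.\<close>

lemma gamma_setpow_submultiplicative:
  assumes S: "bset S C"
  shows "submultiplicative (\<lambda>n. if n = 0 then 0 else gamma_set M (setpow S n))"
proof
  note b = bset_setpow_pos[OF S]
  show "0 \<le> (if n = 0 then 0 else gamma_set M (setpow S n))" for n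
    using gamma_set_nonneg[OF b[of n]] by (cases "n > 0") simp_all
  fix m n :: nat assume m: "m > 0" and n: "n > 0"
  have "gamma_set M (setpow S (m + n)) \<le> gamma_set M (setpow S m) * gamma_set M (setpow S n)"
    unfolding setpow_add by (rule gamma_set_setprod[OF b[OF m] b[OF n]])
  with m n show "(if m + n = 0 then 0 else gamma_set M (setpow S (m + n)))
      \<le> (if m = 0 then 0 else gamma_set M (setpow S m)) * (if n = 0 then 0 else gamma_set M (setpow S n))"
    by simp
qed

lemma rho_hat_ess_set_eq:
  assumes S: "bset S C"
  shows "rho_hat_ess_set M S = submultiplicative.rate (\<lambda>n. if n = 0 then 0 else gamma_set M (setpow S n))"
proof -
  interpret sm: submultiplicative "\<lambda>n. if n = 0 then 0 else gamma_set M (setpow S n)"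
    by (rule gamma_setpow_submultiplicative[OF S])
  show ?thesis
    unfolding rho_hat_ess_set_def using sm.rate_LIMSEQ by (intro limI) simp
qed

lemma rho_ess_set_bdd:
  assumes S: "bset S C"
  shows "bdd_above (insert 0 {(Sup (insert 0 (rho_ess M ` setpow S m))) powr (1 / real m) | m. m \<ge> 1})"
proof (rule bdd_aboveI[of _ C])
  fix v assume "v \<in> insert 0 {(Sup (insert 0 (rho_ess M ` setpow S m))) powr (1 / real m) | m. m \<ge> 1}"
  then consider "v = 0" | m where "m \<ge> 1" "v = (Sup (insert 0 (rho_ess M ` setpow S m))) powr (1 / real m)" by auto
  then show "v \<le> C"
  proof cases
    case 1
    then show ?thesis using S by (simp add: bset_def)
  next
    case (2 m)
    have C: "0 \<le> C" using S by (simp add: bset_def)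
    have b: "bset (setpow S m) (C ^ m)" by (rule bset_setpow_pos[OF S]) (use 2(1) in simp)
    have le: "rho_ess M T \<le> C ^ m" if T: "T \<in> setpow S m" for T
    proof -
      obtain a where "represents T a" using bset_represents[OF b T] by blast
      from rho_ess_le_gamma[OF this] bset_gamma[OF b T] show ?thesis by simp
    qed
    have s: "Sup (insert 0 (rho_ess M ` setpow S m)) \<le> C ^ m"
      using le C by (intro cSup_least) auto
    have s0: "0 \<le> Sup (insert 0 (rho_ess M ` setpow S m))"
      using le C by (intro cSup_upper bdd_aboveI[of _ "C ^ m"]) auto
    have "v \<le> (C ^ m) powr (1 / real m)"
      unfolding 2(2) using s s0 by (intro powr_mono2) auto
    also have "\<dots> = C"
      using C 2(1) by (cases "C = 0") (auto simp: powr_realpow[symmetric] powr_powr power_0_left)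
    finally show ?thesis .
  qed
qed

text \<open>This is the term \<open>m = 1\<close> of the supremum; the bounds are there because a
  real \<open>Sup\<close> means nothing on an unbounded set.\<close>

lemma rho_ess_le_rho_ess_set:
  assumes S: "bset S C" and T: "T \<in> S"
  shows "rho_ess M T \<le> rho_ess_set M S"
proof -
  have le: "rho_ess M T \<le> C" if T: "T \<in> S" for T
  proof -
    obtain a where "represents T a" using bset_represents[OF S T] by blast
    from rho_ess_le_gamma[OF this] bset_gamma[OF S T] show ?thesis by simp
  qed
  have C: "0 \<le> C" using S by (simp add: bset_def)
  have bdd: "bdd_above (insert 0 (rho_ess M ` S))"
    using le C by (intro bdd_aboveI[of _ C]) auto
  have S1: "setpow S 1 = S" by (simp add: setprod_id)
  have "Sup (insert 0 (rho_ess M ` S)) \<in> {(Sup (insert 0 (rho_ess M ` setpow S m))) powr (1 / real m) | m. m \<ge> 1}"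
  proof (rule CollectI, rule exI[of _ 1], intro conjI)
    have "0 \<le> Sup (insert 0 (rho_ess M ` S))" by (rule cSup_upper[OF insertI1 bdd])
    then show "Sup (insert 0 (rho_ess M ` S)) = Sup (insert 0 (rho_ess M ` setpow S 1)) powr (1 / real 1)"
      unfolding S1 by simp
  qed simp
  then have "Sup (insert 0 (rho_ess M ` S)) \<le> rho_ess_set M S"
    unfolding rho_ess_set_def by (intro cSup_upper[OF insertI2 rho_ess_set_bdd[OF S]])
  moreover have "rho_ess M T \<le> Sup (insert 0 (rho_ess M ` S))"
    by (rule cSup_upper[OF insertI2[OF imageI[OF T]] bdd])
  ultimately show ?thesis by simp
qed

text \<open>The only property of \<open>r\<close> that the inequalities use; it holds for both radii.\<close>
theorem radius_growth:
  assumes r: "r \<in> {rho_ess_set M, rho_hat_ess_set M}" and S: "bset S C"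
  shows "0 \<le> r S" "T \<in> S \<Longrightarrow> r S < t \<Longrightarrow> \<exists>D. 0 \<le> D \<and> (\<forall>n>0. gamma_op M (T ^^ n) \<le> D * t ^ n)"
proof -
  interpret sm: submultiplicative "\<lambda>n. if n = 0 then 0 else gamma_set M (setpow S n)"
    by (rule gamma_setpow_submultiplicative[OF S])
  have "0 \<le> rho_ess_set M S"
    unfolding rho_ess_set_def by (intro cSup_upper rho_ess_set_bdd[OF S]) auto
  moreover have "0 \<le> rho_hat_ess_set M S"
    unfolding rho_hat_ess_set_eq[OF S] by (rule sm.rate_nonneg)
  ultimately show "0 \<le> r S" using r by (elim insertE emptyE) simp_all
  show "\<exists>D. 0 \<le> D \<and> (\<forall>n>0. gamma_op M (T ^^ n) \<le> D * t ^ n)" if T: "T \<in> S" and t: "r S < t"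
  proof (cases "r = rho_ess_set M")
    case True
    obtain a where a: "represents T a" using bset_represents[OF S T] by blast
    have "rho_ess M T < t" using rho_ess_le_rho_ess_set[OF S T] t True by simp
    from gamma_power_growth[OF a this] show ?thesis .
  next
    case False
    then have "r = rho_hat_ess_set M" using r by (elim insertE emptyE) simp_all
    then have "sm.rate < t" using t rho_hat_ess_set_eq[OF S] by simp
    from sm.growth[OF this] obtain D where D: "0 \<le> D"
      "\<forall>n>0. (if n = 0 then 0 else gamma_set M (setpow S n)) \<le> D * t ^ n" by (elim exE conjE)
    have "gamma_op M (T ^^ n) \<le> D * t ^ n" if n: "n > 0" for n
    proof -
      from gamma_set_upper[OF bset_setpow_pos[OF S n] funpow_in_setpow[OF T]] D(2)[rule_format, OF n] n show ?thesis by simp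
    qed
    with D(1) show ?thesis by blast
  qed
qed

text \<open>A matching in both directions instead of equality with a set of adjoints, since
  operators are determined only up to null sets.\<close>

definition adjsets :: "'a op set \<Rightarrow> 'a op set \<Rightarrow> bool" where
  "adjsets S S' \<longleftrightarrow> (\<forall>T\<in>S. \<exists>T'\<in>S'. adjpair T T') \<and> (\<forall>T'\<in>S'. \<exists>T\<in>S. adjpair T T')"

lemma setprodI: "A \<in> S \<Longrightarrow> B \<in> T \<Longrightarrow> A \<circ> B \<in> setprod S T"
  unfolding setprod_def by blast

lemma adjsets_setprod:
  assumes S: "adjsets S S'" and T: "adjsets T T'"
  shows "adjsets (setprod S T) (setprod T' S')"
  unfolding adjsets_def
proof (intro conjI ballI)
  fix U assume "U \<in> setprod S T"
  then obtain A B where AB: "U = A \<circ> B" "A \<in> S" "B \<in> T" by (auto simp: setprod_def)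
  obtain A' where A': "A' \<in> S'" "adjpair A A'" using S AB(2) by (auto simp: adjsets_def)
  obtain B' where B': "B' \<in> T'" "adjpair B B'" using T AB(3) by (auto simp: adjsets_def)
  show "\<exists>U'\<in>setprod T' S'. adjpair U U'"
    using setprodI[OF B'(1) A'(1)] adjpair_comp[OF A'(2) B'(2)] AB(1) by blast
next
  fix U assume "U \<in> setprod T' S'"
  then obtain B' A' where AB: "U = B' \<circ> A'" "B' \<in> T'" "A' \<in> S'" by (auto simp: setprod_def)
  obtain A where A: "A \<in> S" "adjpair A A'" using S AB(3) by (auto simp: adjsets_def)
  obtain B where B: "B \<in> T" "adjpair B B'" using T AB(2) by (auto simp: adjsets_def)
  show "\<exists>V\<in>setprod S T. adjpair V U"
    using setprodI[OF A(1) B(1)] adjpair_comp[OF A(2) B(2)] AB(1) by blast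
qed

lemma adjsets_setpow: "adjsets S S' \<Longrightarrow> adjsets (setpow S (Suc n)) (setpow S' (Suc n))"
proof (induction n)
  case 0
  then show ?case by (simp add: setprod_id)
next
  case (Suc n)
  then have "adjsets (setprod S (setpow S (Suc n))) (setprod (setpow S' (Suc n)) S')"
    by (intro adjsets_setprod)
  then show ?case by (simp only: setpow.simps(2)[of S "Suc n"] setpow_Suc_right[of S' "Suc n"])
qed

lemma adjsets_image:
  assumes "adjsets S S'" "\<And>T T'. adjpair T T' \<Longrightarrow> h T = h T'"
  shows "h ` S = h ` S'"
proof (intro equalityI image_subsetI)
  show "h T \<in> h ` S'" if "T \<in> S" for T
    using assms that unfolding adjsets_def by (metis imageI)
  show "h T' \<in> h ` S" if "T' \<in> S'" for T'
    using assms that unfolding adjsets_def by (metis imageI)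
qed

text \<open>Both radii depend only on the sets of values of \<open>rho_ess\<close> or
  \<open>gamma_op\<close> on the powers, and a matching of adjoints preserves these sets.\<close>

theorem radius_adjsets:
  assumes r: "r \<in> {rho_ess_set M, rho_hat_ess_set M}" and S: "adjsets S S'"
  shows "r S = r S'"
proof -
  have p: "adjsets (setpow S m) (setpow S' m)" if "m \<ge> 1" for m
    using adjsets_setpow[OF S, of "m - 1"] that by simp
  have "rho_ess_set M S = rho_ess_set M S'"
  proof -
    have *: "rho_ess M ` setpow S m = rho_ess M ` setpow S' m" if "m \<ge> 1" for m
      by (rule adjsets_image[OF p[OF that] adjpair_rho_ess])
    have "{(Sup (insert 0 (rho_ess M ` setpow S m))) powr (1 / real m) | m. m \<ge> 1}
        = {(Sup (insert 0 (rho_ess M ` setpow S' m))) powr (1 / real m) | m. m \<ge> 1}"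
      by (intro Collect_cong ex_cong1) (auto simp: *)
    then show ?thesis by (simp add: rho_ess_set_def)
  qed
  moreover have "rho_hat_ess_set M S = rho_hat_ess_set M S'"
  proof -
    have "gamma_set M (setpow S (Suc m)) = gamma_set M (setpow S' (Suc m))" for m
      unfolding gamma_set_def using adjsets_image[OF adjsets_setpow[OF S] adjpair_gamma] by simp
    then show ?thesis by (simp only: rho_hat_ess_set_def)
  qed
  ultimately show ?thesis using r by auto
qed

end

subsection \<open>Words of operators\<close>

primrec oword :: "(nat \<Rightarrow> 'a op) \<Rightarrow> nat \<Rightarrow> 'a op" where
  "oword w 0 = id"
| "oword w (Suc n) = oword w n \<circ> w n"

text \<open>At \<open>n\<close> the chain has \<open>n + 1\<close> factors, since an empty product
  would be the identity, which need not have a kernel; so it matches \<open>oword\<close> at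
  \<open>Suc n\<close>.\<close>

primrec kchain :: "'a measure \<Rightarrow> (nat \<Rightarrow> 'a kernel) \<Rightarrow> nat \<Rightarrow> 'a kernel" where
  "kchain M w 0 = w 0"
| "kchain M w (Suc n) = kcomp M (kchain M w n) (w (Suc n))"

lemma oword_add: "oword w (m + n) = oword w m \<circ> oword (\<lambda>i. w (m + i)) n"
  by (induction n) (simp_all add: comp_assoc)

lemma oword_periodic:
  assumes "\<And>i. w (N + i) = w i"
  shows "oword w (N * k) = oword w N ^^ k"
proof (induction k)
  case (Suc k)
  have "oword w (N * Suc k) = oword w N \<circ> oword w (N * k)"
    by (simp only: mult_Suc_right oword_add assms)
  then show ?case by (simp only: Suc funpow.simps)
qed simp

lemma periodic_mult:
  fixes w :: "nat \<Rightarrow> 'b"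
  assumes "\<And>i. w (N + i) = w i"
  shows "w (N * k + i) = w i"
  by (induction k) (simp_all only: mult_Suc_right add.assoc assms mult_0_right add_0)

lemma blin_oword: "(\<And>i. blin M (w i)) \<Longrightarrow> blin M (oword w n)"
proof (induction n)
  case (Suc n)
  have "blin M (\<lambda>f. oword w n (w n f))"
    by (rule blin_comp[OF Suc.IH[OF Suc.prems] Suc.prems])
  then show ?case by (simp add: o_def)
qed (simp add: id_def)

lemma prodlist_Cons: "prodlist (L # Ls) = setprod L (prodlist Ls)"
  by (simp add: prodlist_def)

lemma oword_prodlist:
  "(\<And>i. i < length Ls \<Longrightarrow> w i \<in> Ls ! i) \<Longrightarrow> oword w (length Ls) \<in> prodlist Ls"
proof (induction Ls arbitrary: w)
  case Nil
  then show ?case by (simp add: prodlist_def id_def)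
next
  case (Cons L Ls)
  have "oword (\<lambda>i. w (1 + i)) (length Ls) \<in> prodlist Ls"
  proof (rule Cons.IH)
    fix i assume "i < length Ls"
    then show "w (1 + i) \<in> Ls ! i" using Cons.prems[of "Suc i"] by simp
  qed
  moreover have "w 0 \<in> L" using Cons.prems[of 0] by simp
  moreover have "oword w (length (L # Ls)) = w 0 \<circ> oword (\<lambda>i. w (1 + i)) (length Ls)"
    using oword_add[of w 1 "length Ls"] by simp
  ultimately have "oword w (length (L # Ls)) \<in> setprod L (prodlist Ls)"
    unfolding setprod_def by blast
  then show ?case by (simp only: prodlist_Cons)
qed

text \<open>Reading \<open>k + 1\<close> periods from position \<open>s\<close> gives the last
  \<open>N - s\<close> letters of a period, then \<open>k\<close> full periods, then
  \<open>s\<close> letters. The two ends do not depend on \<open>k\<close> and go into the constant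
  \<open>B\<close>.\<close>

lemma shifted_word_gamma:
  assumes V: "\<And>i. V (N + i) = V i" and s: "s \<le> N" and bl: "\<And>i. blin M (V i)"
  shows "\<exists>B\<ge>0. \<forall>k. gamma_op M (oword (\<lambda>i. V (s + i)) (N * Suc k)) \<le> B * gamma_op M (oword V N ^^ k)"
proof -
  let ?W = "\<lambda>i. V (s + i)"
  have bW: "blin M (oword ?W n)" "blin M (oword V n)" for n by (intro blin_oword bl)+
  define B where "B = gamma_op M (oword ?W (N - s)) * gamma_op M (oword V s)"
  have B0: "0 \<le> B" unfolding B_def by (intro mult_nonneg_nonneg gamma_op_nonneg bW)
  moreover have "gamma_op M (oword ?W (N * Suc k)) \<le> B * gamma_op M (oword V N ^^ k)" for k
  proof -
    have mid: "oword V (N * k) = oword V N ^^ k" by (rule oword_periodic[of V N, OF V])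
    have "N * Suc k = (N - s) + (N * k + s)" using s by simp
    then have "oword ?W (N * Suc k) = oword ?W (N - s) \<circ> oword (\<lambda>i. V (s + (N - s + i))) (N * k + s)"
      by (simp only: oword_add)
    also have "(\<lambda>i. V (s + (N - s + i))) = V"
      using s V by (simp flip: add.assoc)
    also have "oword V (N * k + s) = oword V (N * k) \<circ> oword (\<lambda>i. V (N * k + i)) s"
      by (rule oword_add)
    also have "(\<lambda>i. V (N * k + i)) = V" using periodic_mult[of V N, OF V] by simp
    finally have eq: "oword ?W (N * Suc k) = (\<lambda>f. oword ?W (N - s) (oword V (N * k) (oword V s f)))"
      by (simp add: o_def)
    have "gamma_op M (\<lambda>f. oword ?W (N - s) (oword V (N * k) (oword V s f)))
        \<le> gamma_op M (oword ?W (N - s)) * gamma_op M (\<lambda>f. oword V (N * k) (oword V s f))"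
      by (rule gamma_op_comp[OF bW(1) blin_comp[OF bW(2) bW(2)]])
    also have "\<dots> \<le> gamma_op M (oword ?W (N - s)) * (gamma_op M (oword V (N * k)) * gamma_op M (oword V s))"
      by (rule mult_left_mono[OF gamma_op_comp[OF bW(2) bW(2)] gamma_op_nonneg[OF bW(1)]])
    finally show ?thesis unfolding eq B_def mid by (simp only: mult_ac)
  qed
  ultimately show ?thesis by blast
qed

text \<open>Lets each factor of the alternating product list the letters of the mean in its own
  rotated order.\<close>

lemma prod_mod_shift:
  fixes f :: "nat \<Rightarrow> 'b::comm_monoid_mult"
  assumes m: "m > 0"
  shows "(\<Prod>s<m. f ((s + i) mod m)) = (\<Prod>s<m. f s)"
proof (induction i arbitrary: f)
  case 0
  show ?case by (rule prod.cong) auto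
next
  case (Suc i)
  obtain k where k: "m = Suc k" using m by (cases m) auto
  have "(\<Prod>s<m. f ((s + Suc i) mod m)) = (\<Prod>s<m. f ((Suc s mod m + i) mod m))"
    by (simp add: mod_simps)
  also have "\<dots> = (\<Prod>s<k. f ((Suc s mod m + i) mod m)) * f (i mod m)"
    by (simp add: k)
  also have "(\<Prod>s<k. f ((Suc s mod m + i) mod m)) = (\<Prod>s<k. f ((Suc s + i) mod m))"
    by (intro prod.cong) (auto simp: k)
  also have "\<dots> * f (i mod m) = (\<Prod>s<m. f ((s + i) mod m))"
    unfolding k by (subst prod.lessThan_Suc_shift) (simp add: mult.commute)
  finally show ?case using Suc by simp
qed

lemma gmean_power:
  assumes "finite J" "J \<noteq> {}" "\<And>j. j \<in> J \<Longrightarrow> 0 \<le> t j"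
  shows "gmean J (\<lambda>j. t j ^ n) = gmean J t ^ n"
  by (induction n) (simp_all add: gmean_const[OF assms(1,2)] gmean_mult assms(3))

lemma gmean_alternate:
  fixes m :: nat and A B :: real
  assumes m: "even m" "m > 0" and A: "0 \<le> A" and B: "0 \<le> B"
  shows "gmean {..<m} (\<lambda>s. if even s then A else B) = (A * B) powr (1 / 2)"
proof -
  obtain l where l: "m = 2 * l" using m(1) by (elim evenE)
  have pr: "(\<Prod>s<2 * l. if even s then a else b) = (a * b) ^ l" for a b :: real and l :: nat
    by (induction l) (simp_all add: mult_ac)
  have "gmean {..<m} (\<lambda>s. if even s then A else B)
      = (\<Prod>s<m. if even s then A powr (1 / real m) else B powr (1 / real m))"
    unfolding gmean_def by (intro prod.cong) auto
  also have "\<dots> = ((A * B) powr (1 / real m)) ^ l"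
    unfolding l pr by (simp add: powr_mult A B)
  also have "\<dots> = (A * B) powr (1 / 2)"
  proof (cases "A * B = 0")
    case True
    then show ?thesis using m l by (auto simp: power_0_left)
  next
    case False
    then have "A * B > 0" using A B by (simp add: less_le)
    then have "((A * B) powr (1 / real m)) ^ l = ((A * B) powr (1 / real m)) powr real l"
      by (intro powr_realpow[symmetric]) (use False in simp)
    also have "\<dots> = (A * B) powr (1 / 2)" unfolding powr_powr using m(2) l by simp
    finally show ?thesis .
  qed
  finally show ?thesis .
qed

section \<open>Chains of kernels and powers of the mean\<close>

context sigma_finite_measure
begin

lemma represents_oword:
  assumes "\<And>i. represents (w i) (k i)"
  shows "represents (oword w (Suc n)) (kchain M k n)"
proof (induction n)
  case 0
  then show ?case using assms[of 0] by simp
next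
  case (Suc n)
  from represents_comp[OF this assms[of "Suc n"]] show ?case
    by (simp only: oword.simps(2)[of w "Suc n"] kchain.simps)
qed

lemma kbound_kchain:
  assumes "\<And>i. \<exists>C. kbound M (w i) C"
  shows "\<exists>C. kbound M (kchain M w n) C"
proof (induction n)
  case (Suc n)
  then show ?case using assms[of "Suc n"] kbound_kcomp by (metis kchain.simps(2))
qed (simp add: assms)

lemma kernel_kchain: "(\<And>i. kernel M (w i)) \<Longrightarrow> kernel M (kchain M w n)"
  by (induction n) (simp_all add: kernel_kcomp)

text \<open>Each composition is one application of Hoelder in the intermediate variable. Finiteness
  of the composite integrals matters, because \<open>enn2real\<close> would turn an infinite
  right-hand side into 0.\<close>

lemma kchain_gmean:
  assumes J: "finite J" "J \<noteq> {}" and w: "\<And>j i. j \<in> J \<Longrightarrow> \<exists>C. kbound M (w j i) C"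
    and d: "\<And>i. kernel M (d i)" and le: "\<And>i x y. d i x y \<le> gmean J (\<lambda>j. w j i x y)"
  shows "AE x in M. AE y in M. kchain M d n x y \<le> gmean J (\<lambda>j. kchain M (w j) n x y)"
proof (induction n)
  case 0
  show ?case by (simp add: le)
next
  case (Suc n)
  let ?D = "kchain M d n" and ?W = "\<lambda>j. kchain M (w j) n"
  have kW: "\<exists>C. kbound M (?W j) C" if "j \<in> J" for j by (rule kbound_kchain[OF w[OF that]])
  have kerW: "kernel M (?W j)" and kerw: "kernel M (w j i)" if "j \<in> J" for j i
    using kW[OF that] w[OF that] kbound_kernel by blast+
  have kerD: "kernel M ?D" by (rule kernel_kchain[OF d])
  have "AE x in M. AE z in M. (\<integral>\<^sup>+y. ennreal (?W j x y * w j (Suc n) y z) \<partial>M) < \<infinity>" if j: "j \<in> J" for j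
  proof -
    obtain C where C: "kbound M (?W j) C" using kW[OF j] by blast
    obtain C' where C': "kbound M (w j (Suc n)) C'" using w[OF j] by blast
    show ?thesis by (rule kcomp_finite[OF C C'])
  qed
  then have fin: "AE x in M. \<forall>j\<in>J. AE z in M. (\<integral>\<^sup>+y. ennreal (?W j x y * w j (Suc n) y z) \<partial>M) < \<infinity>"
    by (intro AE_finite_allI J)
  show ?case
    using Suc fin AE_space
  proof eventually_elim
    fix x assume IH: "AE y in M. ?D x y \<le> gmean J (\<lambda>j. ?W j x y)"
      and fx: "\<forall>j\<in>J. AE z in M. (\<integral>\<^sup>+y. ennreal (?W j x y * w j (Suc n) y z) \<partial>M) < \<infinity>" and x: "x \<in> space M"
    have "AE z in M. \<forall>j\<in>J. (\<integral>\<^sup>+y. ennreal (?W j x y * w j (Suc n) y z) \<partial>M) < \<infinity>"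
      by (intro AE_finite_allI J) (use fx in blast)
    then show "AE z in M. kchain M d (Suc n) x z \<le> gmean J (\<lambda>j. kchain M (w j) (Suc n) x z)"
      using AE_space
    proof eventually_elim
      fix z assume fz: "\<forall>j\<in>J. (\<integral>\<^sup>+y. ennreal (?W j x y * w j (Suc n) y z) \<partial>M) < \<infinity>" and z: "z \<in> space M"
      have nn: "0 \<le> ?W j x y" "0 \<le> w j (Suc n) y z" if "j \<in> J" for j y
        using kernel_nonneg[OF kerW[OF that]] kernel_nonneg[OF kerw[OF that]] by auto
      have "(\<integral>\<^sup>+y. ennreal (?D x y * d (Suc n) y z) \<partial>M)
          \<le> (\<integral>\<^sup>+y. ennreal (gmean J (\<lambda>j. ?W j x y * w j (Suc n) y z)) \<partial>M)"
      proof (rule nn_integral_mono_AE, use IH in eventually_elim)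
        fix y assume "?D x y \<le> gmean J (\<lambda>j. ?W j x y)"
        then have "?D x y * d (Suc n) y z \<le> gmean J (\<lambda>j. ?W j x y) * gmean J (\<lambda>j. w j (Suc n) y z)"
          by (rule mult_mono[OF _ le gmean_nonneg kernel_nonneg[OF d]])
        also have "\<dots> = gmean J (\<lambda>j. ?W j x y * w j (Suc n) y z)"
          by (rule gmean_mult[symmetric]) (use nn in auto)
        finally show "ennreal (?D x y * d (Suc n) y z) \<le> ennreal (gmean J (\<lambda>j. ?W j x y * w j (Suc n) y z))"
          by (rule ennreal_leI)
      qed
      also have "\<dots> \<le> ennreal (gmean J (\<lambda>j. kchain M (w j) (Suc n) x z))"
      proof (rule nn_integral_gmean_le[OF J])
        fix j assume j: "j \<in> J"
        note [measurable] = kernel_measurable[OF kerW[OF j]] kernel_measurable[OF kerw[OF j]] x z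
        show "(\<lambda>y. ?W j x y * w j (Suc n) y z) \<in> borel_measurable M" by measurable
        show "0 \<le> ?W j x y * w j (Suc n) y z" for y using nn[OF j] by simp
        show "0 \<le> kchain M (w j) (Suc n) x z" by (simp add: kcomp_def)
        show "(\<integral>\<^sup>+y. ennreal (?W j x y * w j (Suc n) y z) \<partial>M) \<le> ennreal (kchain M (w j) (Suc n) x z)"
          using bspec[OF fz j] by (simp add: kcomp_def)
      qed
      finally show "kchain M d (Suc n) x z \<le> gmean J (\<lambda>j. kchain M (w j) (Suc n) x z)"
        by (simp only: kchain.simps(2)[of M d] kcomp_def) (rule enn2real_leI[OF gmean_nonneg])
    qed
  qed
qed

lemma gamma_funpow_le: "blin M T \<Longrightarrow> gamma_op M (T ^^ n) \<le> gamma_op M T ^ n"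
proof (induction n)
  case 0
  then show ?case using gamma_op_id_le by (simp add: id_def)
next
  case (Suc n)
  have "gamma_op M (T ^^ Suc n) \<le> gamma_op M T * gamma_op M (T ^^ n)"
    using gamma_op_comp[OF Suc.prems blin_power[OF Suc.prems, of n]] by (simp add: o_def)
  also have "\<dots> \<le> gamma_op M T * gamma_op M T ^ n"
    by (rule mult_left_mono[OF Suc.IH[OF Suc.prems] gamma_op_nonneg[OF Suc.prems]])
  finally show ?case by (simp only: power_Suc)
qed

text \<open>For exponents that are powers of 2 this iterates \<open>gamma_square_le\<close>. A
  general \<open>n\<close> is padded up to \<open>2 ^ n\<close>: submultiplicativity bounds the
  padding by \<open>gamma(S)^(2^n - n)\<close>, and that factor cancels.\<close>

theorem gamma_selfadjoint_power:
  assumes S: "adjpair S S" and n: "n > 0"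
  shows "gamma_op M S ^ n \<le> gamma_op M (S ^^ n)"
proof (cases "gamma_op M S = 0")
  case False
  have bS: "blin M S" using S represents_blin by (auto simp: adjpair_def)
  have g: "gamma_op M S > 0" using gamma_op_nonneg[OF bS] False by simp
  have dyadic: "gamma_op M S ^ (2 ^ k) \<le> gamma_op M (S ^^ (2 ^ k))" for k :: nat
  proof (induction k)
    case (Suc k)
    have "adjpair (S ^^ (2 ^ k)) (S ^^ (2 ^ k))"
      using adjpair_power[OF S, of "2 ^ k - 1"] by (simp only: Suc_diff_1 zero_less_power zero_less_numeral)
    from adjpair_gamma_square[OF this]
    have sq: "(gamma_op M (S ^^ (2 ^ k)))\<^sup>2 \<le> gamma_op M (S ^^ (2 ^ Suc k))"
      by (simp only: power_Suc mult_2 funpow_add)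
    have "gamma_op M S ^ (2 ^ Suc k) = (gamma_op M S ^ (2 ^ k))\<^sup>2"
      by (simp only: power_Suc power_mult[symmetric] mult.commute)
    also have "\<dots> \<le> (gamma_op M (S ^^ (2 ^ k)))\<^sup>2"
      by (intro power_mono Suc) (use g in simp)
    finally show ?case using sq by simp
  qed simp
  have le: "n \<le> 2 ^ n" by (simp add: less_imp_le)
  have "gamma_op M S ^ n * gamma_op M S ^ (2 ^ n - n) = gamma_op M S ^ (2 ^ n)"
    using le by (simp flip: power_add)
  also have "\<dots> \<le> gamma_op M (S ^^ (2 ^ n))" by (rule dyadic)
  also have "\<dots> = gamma_op M (\<lambda>f. (S ^^ n) ((S ^^ (2 ^ n - n)) f))"
  proof -
    have "S ^^ (2 ^ n) = S ^^ n \<circ> S ^^ (2 ^ n - n)" using le by (simp flip: funpow_add)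
    then show ?thesis by (simp add: o_def)
  qed
  also have "\<dots> \<le> gamma_op M (S ^^ n) * gamma_op M (S ^^ (2 ^ n - n))"
    by (rule gamma_op_comp[OF blin_power[OF bS] blin_power[OF bS]])
  also have "\<dots> \<le> gamma_op M (S ^^ n) * gamma_op M S ^ (2 ^ n - n)"
    by (rule mult_left_mono[OF gamma_funpow_le[OF bS] gamma_op_nonneg[OF blin_power[OF bS]]])
  finally show ?thesis using g by simp
next
  case True
  obtain a where "represents S a" using S by (auto simp: adjpair_def)
  from gamma_op_nonneg[OF blin_power[OF represents_blin[OF this]], of n] True n
  show ?thesis by (simp add: power_0_left)
qed

text \<open>Write \<open>A A* A A* \<dots>\<close> with the \<open>i\<close>-th factor listing the letters of the mean rotated by \<open>i\<close>.
In slot \<open>s\<close> one then reads the letters \<open>s, s + 1, \<dots>\<close> cyclically, which up to a bounded prefix and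
suffix is a power of the word \<open>V s\<close> of length \<open>N\<close>.\<close>
theorem gamma_hadamard_power:
  fixes c :: "nat \<Rightarrow> bool \<Rightarrow> 'a kernel" and ol :: "nat \<Rightarrow> bool \<Rightarrow> 'a op"
  assumes m: "m > 0" and N: "even N" "N > 0"
    and h: "represents T h"
    and heq: "\<And>i e x y. (if e then ktrans h else h) x y = gmean {..<m} (\<lambda>s. c (s + i) e x y)"
    and ol: "\<And>i e. represents (ol i e) (c i e)"
    and V: "\<And>s i. s < m \<Longrightarrow> ol (s + i) (odd i) = V s (\<sigma> s + i)"
    and per: "\<And>s i. s < m \<Longrightarrow> V s (N + i) = V s i" and \<sigma>: "\<And>s. s < m \<Longrightarrow> \<sigma> s \<le> N"
    and Vb: "\<And>s i. s < m \<Longrightarrow> blin M (V s i)"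
    and \<rho>: "\<And>s. s < m \<Longrightarrow> 0 \<le> \<rho> s"
    and growth: "\<And>s t. s < m \<Longrightarrow> \<rho> s < t \<Longrightarrow>
      \<exists>D. 0 \<le> D \<and> (\<forall>n>0. gamma_op M (oword (V s) N ^^ n) \<le> D * t ^ n)"
  shows "gamma_op M T ^ N \<le> gmean {..<m} \<rho>"
proof -
  let ?J = "{..<m}" and ?x = "gamma_op M T"
  have J: "finite ?J" "?J \<noteq> {}" using m by auto
  obtain Ch where hb: "kbound M h Ch" using h by (auto simp: represents_def)
  define A where "A e = kop M (if e then ktrans h else h)" for e :: bool
  have Ab: "represents (A e) (if e then ktrans h else h)" for e
    unfolding A_def by (cases e) (auto intro: represents_kop hb kbound_ktrans)
  have adjA: "adjpair (A True) (A False)" "adjpair (A False) (A True)"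
    using Ab[of True] Ab[of False] adjpair_sym by (auto simp: adjpair_def)
  define S where "S = A False \<circ> A True"
  have SS: "adjpair S S" unfolding S_def by (rule adjpair_comp[OF adjA(2,1)])
  have x: "?x = gamma_op M (A False)" "0 \<le> ?x"
    using represents_gamma[OF h] gamma_op_nonneg[OF represents_blin[OF h]] by (auto simp: A_def)
  \<comment> \<open>\<open>S\<close> is \<open>A\<close> times its adjoint, whereas the square bound
    carries the adjoint on the left; so it is applied to the adjoint, which has the same
    \<open>gamma_op\<close>.\<close>
  have x2: "?x\<^sup>2 \<le> gamma_op M S"
    using adjpair_gamma_square[OF adjA(1)] adjpair_gamma[OF adjA(1)] x by (simp add: S_def)
  have step: "?x ^ (N * k) \<le> gmean ?J (\<lambda>s. gamma_op M (oword (\<lambda>i. ol (s + i) (odd i)) (N * k)))"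
    if k: "k > 0" for k
  proof -
    obtain l where l: "N = 2 * l" using N(1) by (elim evenE)
    have lk: "l * k > 0" using l N(2) k by simp
    have "?x ^ (N * k) = (?x\<^sup>2) ^ (l * k)" by (simp add: l power_mult[symmetric] mult.assoc)
    also have "\<dots> \<le> gamma_op M S ^ (l * k)" by (intro power_mono x2) simp
    also have "\<dots> \<le> gamma_op M (S ^^ (l * k))" by (rule gamma_selfadjoint_power[OF SS lk])
    \<comment> \<open>Since \<open>N\<close> is even, a word of length \<open>N * k\<close> consists
      of complete pairs and is a power of \<open>S\<close>.\<close>
    also have "S ^^ (l * k) = oword (\<lambda>i. A (odd i)) (N * k)"
    proof -
      have "oword (\<lambda>i. A (odd i)) 2 = S" by (simp add: S_def numeral_2_eq_2)
      moreover have "oword (\<lambda>i. A (odd i)) (2 * (l * k)) = oword (\<lambda>i. A (odd i)) 2 ^^ (l * k)"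
        by (rule oword_periodic) simp
      ultimately show ?thesis by (simp add: l mult.assoc)
    qed
    also have "gamma_op M (oword (\<lambda>i. A (odd i)) (N * k)) \<le> gmean ?J (\<lambda>s. gamma_op M (oword (\<lambda>i. ol (s + i) (odd i)) (N * k)))"
    proof -
      obtain q where q: "N * k = Suc q" using N(2) k by (metis gr0_conv_Suc nat_0_less_mult_iff)
      let ?d = "\<lambda>i. if odd i then ktrans h else h"
      let ?w = "\<lambda>s i. c (s + i) (odd i)"
      have rd: "represents (oword (\<lambda>i. A (odd i)) (Suc q)) (kchain M ?d q)"
        by (rule represents_oword[OF Ab])
      have rw: "represents (oword (\<lambda>i. ol (s + i) (odd i)) (Suc q)) (kchain M (?w s) q)" for s
        by (rule represents_oword[OF ol])
      have wb: "\<exists>C. kbound M (?w s i) C" for s i using ol by (simp add: represents_def)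
      have dk: "kernel M (?d i)" for i
        using kbound_kernel[OF hb] kernel_ktrans[OF kbound_kernel[OF hb]] by simp
      have le: "AE x in M. AE y in M. kchain M ?d q x y \<le> gmean ?J (\<lambda>s. kchain M (?w s) q x y)"
        by (rule kchain_gmean[OF J wb dk], rule eq_refl, rule heq)
      have "\<exists>C. \<forall>s. kbound M (kchain M (?w s) q) (C s)"
        by (rule choice, rule allI, rule kbound_kchain, rule wb)
      then obtain C where C: "\<And>s. kbound M (kchain M (?w s) q) (C s)" by blast
      have "gamma_op M (kop M (kchain M ?d q)) \<le> gmean ?J (\<lambda>s. gamma_op M (kop M (kchain M (?w s) q)))"
        by (rule gamma_gmean[OF J C kernel_kchain[OF dk] le])
      then show ?thesis
        unfolding q represents_gamma[OF rd] represents_gamma[OF rw] .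
    qed
    finally show ?thesis .
  qed
  have *: "?x ^ N \<le> gmean ?J (\<lambda>s. \<rho> s + e)" if e: "e > 0" for e
  proof -
    let ?t = "\<lambda>s. \<rho> s + e"
    have t: "0 < ?t s" if "s \<in> ?J" for s using \<rho>[of s] e that by simp
    have "\<exists>E. 0 \<le> E \<and> (\<forall>k>0. gamma_op M (oword (\<lambda>i. ol (s + i) (odd i)) (N * Suc k)) \<le> E * ?t s ^ k)"
      if s: "s \<in> ?J" for s
    proof -
      have sm: "s < m" using s by simp
      obtain B where B: "0 \<le> B" "\<And>k. gamma_op M (oword (\<lambda>i. V s (\<sigma> s + i)) (N * Suc k)) \<le> B * gamma_op M (oword (V s) N ^^ k)"
        using shifted_word_gamma[of "V s" N "\<sigma> s" M, OF per[OF sm] \<sigma>[OF sm] Vb[OF sm]] by blast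
      obtain D where D: "0 \<le> D" "\<And>n. n > 0 \<Longrightarrow> gamma_op M (oword (V s) N ^^ n) \<le> D * ?t s ^ n"
        using growth[OF sm, of "?t s"] e by auto
      have "gamma_op M (oword (\<lambda>i. ol (s + i) (odd i)) (N * Suc k)) \<le> (B * D) * ?t s ^ k" if "k > 0" for k
      proof -
        have "gamma_op M (oword (\<lambda>i. ol (s + i) (odd i)) (N * Suc k)) \<le> B * gamma_op M (oword (V s) N ^^ k)"
          using B(2)[of k] V[OF sm] by simp
        also have "\<dots> \<le> B * (D * ?t s ^ k)" by (intro mult_left_mono D(2) B(1) that)
        finally show ?thesis by (simp only: mult.assoc)
      qed
      then show ?thesis using B(1) D(1) by (intro exI[of _ "B * D"]) simp
    qed
    then have "\<exists>E. \<forall>s\<in>?J. 0 \<le> E s \<and> (\<forall>k>0. gamma_op M (oword (\<lambda>i. ol (s + i) (odd i)) (N * Suc k)) \<le> E s * ?t s ^ k)"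
      by (intro bchoice ballI)
    then obtain E where E: "\<And>s. s \<in> ?J \<Longrightarrow> 0 \<le> E s"
      "\<And>s k. s \<in> ?J \<Longrightarrow> k > 0 \<Longrightarrow> gamma_op M (oword (\<lambda>i. ol (s + i) (odd i)) (N * Suc k)) \<le> E s * ?t s ^ k"
      by (elim exE) blast
    have T0: "gmean ?J ?t > 0"
      unfolding gmean_def
    proof (rule prod_pos)
      fix s assume "s \<in> ?J"
      from t[OF this] show "0 < ?t s powr (1 / real (card ?J))" by simp
    qed
    \<comment> \<open>A rotated word of \<open>n\<close> periods contains only \<open>n - 1\<close>
      full periods that the growth bound controls, hence the division by
      \<open>?t s\<close>.\<close>
    let ?K = "gmean ?J (\<lambda>s. E s / ?t s)"
    show ?thesis
    \<comment> \<open>The second summand of the constant covers \<open>n = 1\<close>, where no full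
      period is left and the growth bound is silent.\<close>
    proof (rule power_growth_le[OF _ T0, where C = "?K + ?x ^ N / gmean ?J ?t"])
      show "0 \<le> ?x ^ N" using x(2) by simp
      fix n :: nat assume n: "n > 0"
      show "(?x ^ N) ^ n \<le> (?K + ?x ^ N / gmean ?J ?t) * gmean ?J ?t ^ n"
      proof (cases "n = 1")
        case True
        then show ?thesis using T0 gmean_nonneg[of ?J "\<lambda>s. E s / ?t s"] by (simp add: distrib_right)
      next
        case False
        then obtain k where k: "n = Suc k" "k > 0" using n by (cases n) auto
        have "(?x ^ N) ^ n = ?x ^ (N * n)" by (simp add: power_mult)
        also have "\<dots> \<le> gmean ?J (\<lambda>s. gamma_op M (oword (\<lambda>i. ol (s + i) (odd i)) (N * n)))" by (rule step[OF n])
        also have "\<dots> \<le> gmean ?J (\<lambda>s. (E s / ?t s) * ?t s ^ n)"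
        proof (rule gmean_mono)
          fix s assume s: "s \<in> ?J"
          show "0 \<le> gamma_op M (oword (\<lambda>i. ol (s + i) (odd i)) (N * n))"
            by (intro gamma_op_nonneg blin_oword represents_blin[OF ol])
          show "gamma_op M (oword (\<lambda>i. ol (s + i) (odd i)) (N * n)) \<le> (E s / ?t s) * ?t s ^ n"
            using E(2)[OF s k(2)] t[OF s] by (simp add: k(1))
        qed
        also have "\<dots> = ?K * gmean ?J (\<lambda>s. ?t s ^ n)"
          by (rule gmean_mult) (use E(1) t in \<open>auto intro!: divide_nonneg_nonneg zero_le_power simp: less_imp_le\<close>)
        also have "\<dots> = ?K * gmean ?J ?t ^ n"
          using t by (subst gmean_power[OF J]) (auto simp: less_imp_le)
        also have "\<dots> \<le> (?K + ?x ^ N / gmean ?J ?t) * gmean ?J ?t ^ n"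
          using T0 x(2) by (intro mult_right_mono) simp_all
        finally show ?thesis .
      qed
    qed
  qed
  have "((\<lambda>e. gmean ?J (\<lambda>s. \<rho> s + e)) \<longlongrightarrow> gmean ?J \<rho>) (at_right 0)"
    by (intro tendsto_gmean_add J \<rho>) simp
  then show ?thesis
    by (rule tendsto_lowerbound) (use * in \<open>auto simp: eventually_at_filter\<close>)
qed

end

subsection \<open>Hadamard means of bounded sets\<close>

context sigma_finite_measure
begin

lemma bset_prodlist:
  assumes "Ls \<noteq> []" "\<And>L. L \<in> set Ls \<Longrightarrow> \<exists>C. bset L C"
  shows "\<exists>C. bset (prodlist Ls) C"
  using assms
proof (induction Ls rule: list_nonempty_induct)
  case (single L)
  have "prodlist [L] = L" by (simp only: prodlist_def foldr.simps o_def id_def setprod_id[unfolded id_def])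
  with single show ?case by simp
next
  case (cons L Ls)
  obtain C where C: "bset L C" using cons.prems[of L] by auto
  obtain D where D: "bset (prodlist Ls) D" using cons.IH cons.prems by (meson list.set_intros(2))
  show ?case unfolding prodlist_Cons using bset_setprod[OF C D] by (rule exI)
qed

lemma prodlist_snoc: "prodlist (Ls @ [L]) = setprod (prodlist Ls) (L :: 'a op set)"
proof (induction Ls)
  case Nil
  have "prodlist [] = ({id} :: 'a op set)" by (simp add: prodlist_def)
  then show ?case by (simp only: append_Nil prodlist_Cons setprod_id id_setprod)
next
  case (Cons K Ls)
  then show ?case by (simp only: append_Cons prodlist_Cons setprod_assoc)
qed

lemma adjsets_prodlist:
  assumes "js \<noteq> []" "\<And>j. j \<in> set js \<Longrightarrow> adjsets (F j) (G j)"
  shows "adjsets (prodlist (map F js)) (prodlist (map G (rev js)))"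
  using assms
proof (induction js rule: list_nonempty_induct)
  case (single j)
  have "prodlist [L] = L" for L :: "'a op set"
    using prodlist_snoc[of "[]" L] by (simp add: prodlist_def id_setprod)
  with single show ?case by simp
next
  case (cons j js)
  have "adjsets (F j) (G j)" using cons.prems[of j] by simp
  moreover have "adjsets (prodlist (map F js)) (prodlist (map G (rev js)))"
    using cons.IH cons.prems by simp
  ultimately have "adjsets (setprod (F j) (prodlist (map F js))) (setprod (prodlist (map G (rev js))) (G j))"
    by (rule adjsets_setprod)
  then show ?case by (simp only: list.map rev.simps map_append prodlist_Cons prodlist_snoc)
qed

lemma bdd_pko_set_bound:
  assumes "bdd_pko_set M P"
  obtains C where "0 \<le> C" "\<And>a. a \<in> P \<Longrightarrow> pos_kernel_op M a"
    "\<And>a f. a \<in> P \<Longrightarrow> L2 M f \<Longrightarrow> nrm M (kop M a f) \<le> C * nrm M f"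
proof -
  obtain C where C: "\<And>a f. a \<in> P \<Longrightarrow> L2 M f \<Longrightarrow> nrm M (kop M a f) \<le> C * nrm M f"
    and P: "\<And>a. a \<in> P \<Longrightarrow> pos_kernel_op M a"
    using assms unfolding bdd_pko_set_def by blast
  have "nrm M (kop M a f) \<le> max C 0 * nrm M f" if "a \<in> P" "L2 M f" for a f
    using C[OF that] mult_right_mono[of C "max C 0" "nrm M f"] by simp
  with P show thesis by (intro that[of "max C 0"]) simp_all
qed

lemma bset_ops:
  assumes "bdd_pko_set M P"
  shows "\<exists>C. bset (ops M P) C" "\<exists>C. bset (adj_ops M P) C"
proof -
  obtain C where C: "0 \<le> C" "\<And>a. a \<in> P \<Longrightarrow> pos_kernel_op M a"
    "\<And>a f. a \<in> P \<Longrightarrow> L2 M f \<Longrightarrow> nrm M (kop M a f) \<le> C * nrm M f"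
    using bdd_pko_set_bound[OF assms] by blast
  have *: "represents (kop M a) (kplus a)" "represents (kop M (\<lambda>x y. a y x)) (ktrans (kplus a))" "kbound M (kplus a) C"
    if a: "a \<in> P" for a
    using pos_kernel_op_represents[OF C(2)[OF a] C(1) C(3)[OF a]] pos_kernel_op_kbound[OF C(2)[OF a] C(1) C(3)[OF a]] by auto
  have "bset (ops M P) C"
    unfolding bset_def ops_def using * C(1) by blast
  then show "\<exists>C. bset (ops M P) C" by (rule exI)
  have "bset (adj_ops M P) C"
    unfolding bset_def adj_ops_def using * kbound_ktrans C(1) by blast
  then show "\<exists>C. bset (adj_ops M P) C" by (rule exI)
qed

lemma adjsets_ops:
  assumes "bdd_pko_set M P"
  shows "adjsets (ops M P) (adj_ops M P)" "adjsets (adj_ops M P) (ops M P)"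
proof -
  obtain C where C: "0 \<le> C" "\<And>a. a \<in> P \<Longrightarrow> pos_kernel_op M a"
    "\<And>a f. a \<in> P \<Longrightarrow> L2 M f \<Longrightarrow> nrm M (kop M a f) \<le> C * nrm M f"
    using bdd_pko_set_bound[OF assms] by blast
  have *: "adjpair (kop M a) (kop M (\<lambda>x y. a y x))" if a: "a \<in> P" for a
    unfolding adjpair_def using pos_kernel_op_represents[OF C(2)[OF a] C(1) C(3)[OF a]] by blast
  have **: "adjpair (kop M (\<lambda>x y. a y x)) (kop M a)" if a: "a \<in> P" for a
    by (rule adjpair_sym[OF *[OF a]])
  show "adjsets (ops M P) (adj_ops M P)"
    unfolding adjsets_def ops_def adj_ops_def ball_simps bex_simps using * by blast
  show "adjsets (adj_ops M P) (ops M P)"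
    unfolding adjsets_def ops_def adj_ops_def ball_simps bex_simps using ** by blast
qed

text \<open>Letters are numbered from \<open>0\<close>, so \<open>letter a m i\<close> belongs to \<open>Psi (i mod m + 1)\<close>.\<close>
definition letter :: "(nat \<Rightarrow> 'a kernel) \<Rightarrow> nat \<Rightarrow> nat \<Rightarrow> bool \<Rightarrow> 'a op" where
  "letter a m i e = (if e then kop M (\<lambda>x y. a (i mod m + 1) y x) else kop M (a (i mod m + 1)))"

lemma letter_represents:
  assumes m: "m > 0" and a: "\<And>j. j \<in> {1..m} \<Longrightarrow> pos_kernel_op M (a j)"
  shows "represents (letter a m i e)
    (if e then ktrans (kplus (a (i mod m + 1))) else kplus (a (i mod m + 1)))"
proof -
  have j: "i mod m + 1 \<in> {1..m}" using m by (simp add: Suc_le_eq)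
  obtain C where C: "\<And>f. L2 M f \<Longrightarrow> nrm M (kop M (a (i mod m + 1)) f) \<le> C * nrm M f"
    using a[OF j] unfolding pos_kernel_op_def by blast
  have "nrm M (kop M (a (i mod m + 1)) f) \<le> max C 0 * nrm M f" if "L2 M f" for f
    using C[OF that] mult_right_mono[of C "max C 0" "nrm M f"] by simp
  from pos_kernel_op_represents[OF a[OF j] _ this] show ?thesis by (simp add: letter_def)
qed

text \<open>Transfers \<open>gamma_hadamard_power\<close> to the kernels as given: they are
  nonnegative only almost everywhere, so the mean of their positive parts serves as representing
  kernel.\<close>

theorem gamma_hadamard_mean:
  assumes m: "m > 0" and a: "\<And>j. j \<in> {1..m} \<Longrightarrow> pos_kernel_op M (a j)"
    and N: "even N" "N > 0"
    and V: "\<And>s i. s < m \<Longrightarrow> letter a m (s + i) (odd i) = V s (\<sigma> s + i)"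
    and per: "\<And>s i. s < m \<Longrightarrow> V s (N + i) = V s i" and \<sigma>: "\<And>s. s < m \<Longrightarrow> \<sigma> s \<le> N"
    and Vb: "\<And>s i. s < m \<Longrightarrow> blin M (V s i)"
    and \<rho>: "\<And>s. s < m \<Longrightarrow> 0 \<le> \<rho> s"
    and growth: "\<And>s t. s < m \<Longrightarrow> \<rho> s < t \<Longrightarrow>
      \<exists>D. 0 \<le> D \<and> (\<forall>n>0. gamma_op M (oword (V s) N ^^ n) \<le> D * t ^ n)"
  shows "0 \<le> gamma_op M (kop M (\<lambda>x y. \<Prod>j\<in>{1..m}. a j x y powr (1 / real m)))"
    "gamma_op M (kop M (\<lambda>x y. \<Prod>j\<in>{1..m}. a j x y powr (1 / real m))) ^ N \<le> gmean {..<m} \<rho>"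
proof -
  let ?J = "{..<m}"
  let ?k = "\<lambda>x y. \<Prod>j\<in>{1..m}. a j x y powr (1 / real m)"
  have J: "finite ?J" "?J \<noteq> {}" using m by auto
  define P where "P i = kplus (a (i mod m + 1))" for i
  define c where "c i e = (if e then ktrans (P i) else P i)" for i and e :: bool
  define h where "h = (\<lambda>x y. gmean ?J (\<lambda>s. P s x y))"
  have lr: "represents (letter a m i e) (c i e)" for i e
    unfolding c_def P_def by (rule letter_represents[where a = a, OF m a])
  have "\<exists>C. kbound M (P i) C" for i
    using lr[of i False] by (simp add: represents_def c_def)
  then obtain C where C: "\<And>i. kbound M (P i) (C i)" by metis
  have am: "case_prod (a j) \<in> borel_measurable (M \<Otimes>\<^sub>M M)" if "j \<in> {1..m}" for j
    by (rule pos_kernel_op_measurable[OF a[OF that]])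
  have hk: "kernel M h"
  proof -
    have "(\<lambda>z. gmean ?J (\<lambda>s. P s (fst z) (snd z))) \<in> borel_measurable (M \<Otimes>\<^sub>M M)"
      unfolding gmean_def
    proof (rule borel_measurable_prod)
      fix s
      note [measurable] = kernel_measurable[OF kbound_kernel[OF C[of s]]]
      show "(\<lambda>z. P s (fst z) (snd z) powr (1 / real (card ?J))) \<in> borel_measurable (M \<Otimes>\<^sub>M M)" by measurable
    qed
    then show ?thesis by (simp add: kernel_def h_def case_prod_beta' gmean_nonneg)
  qed
  have hb: "kbound M h (gmean ?J C)"
    by (rule kbound_gmean[OF J C hk]) (simp add: h_def)
  have km: "case_prod ?k \<in> borel_measurable (M \<Otimes>\<^sub>M M)"
  proof -
    have "(\<lambda>z. \<Prod>j\<in>{1..m}. a j (fst z) (snd z) powr (1 / real m)) \<in> borel_measurable (M \<Otimes>\<^sub>M M)"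
    proof (rule borel_measurable_prod)
      fix j assume "j \<in> {1..m}"
      note [measurable] = am[OF this]
      show "(\<lambda>z. a j (fst z) (snd z) powr (1 / real m)) \<in> borel_measurable (M \<Otimes>\<^sub>M M)" by measurable
    qed
    then show ?thesis by (simp add: case_prod_beta')
  qed
  have "AE x in M. \<forall>j\<in>{1..m}. AE y in M. a j x y = kplus (a j) x y"
    by (intro AE_finite_allI finite_atLeastAtMost pos_kernel_op_AE(1) a)
  then have kh: "AE x in M. AE y in M. ?k x y = h x y"
  proof eventually_elim
    fix x assume "\<forall>j\<in>{1..m}. AE y in M. a j x y = kplus (a j) x y"
    then have "AE y in M. \<forall>j\<in>{1..m}. a j x y = kplus (a j) x y"
      by (intro AE_finite_allI finite_atLeastAtMost) blast
    then show "AE y in M. ?k x y = h x y"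
    proof eventually_elim
      fix y assume y: "\<forall>j\<in>{1..m}. a j x y = kplus (a j) x y"
      have "?k x y = (\<Prod>j\<in>{1..m}. kplus (a j) x y powr (1 / real m))"
        using y by (intro prod.cong) auto
      also have "\<dots> = (\<Prod>s<m. kplus (a (Suc s)) x y powr (1 / real m))"
        by (simp add: prod.atLeast1_atMost_eq)
      also have "\<dots> = h x y"
        unfolding h_def gmean_def P_def by (intro prod.cong) auto
      finally show "?k x y = h x y" .
    qed
  qed
  have rep: "represents (kop M ?k) h" by (rule represents_cong_kernel[OF hb km kh])
  show "0 \<le> gamma_op M (kop M ?k)" by (rule gamma_op_nonneg[OF represents_blin[OF rep]])
  \<comment> \<open>The mean does not depend on the order of its factors, so the letters may be
    rotated by \<open>i\<close>.\<close>
  have heq: "(if e then ktrans h else h) x y = gmean ?J (\<lambda>s. c (s + i) e x y)" for i e x y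
  proof -
    define f where "f s = (if e then P s y x else P s x y) powr (1 / real m)" for s
    have "(if e then ktrans h else h) x y = (\<Prod>s<m. f s)"
      by (cases e) (simp_all add: h_def ktrans_def gmean_def f_def)
    also have "\<dots> = (\<Prod>s<m. f ((s + i) mod m))" by (rule prod_mod_shift[OF m, symmetric])
    also have "\<dots> = gmean ?J (\<lambda>s. c (s + i) e x y)"
      by (cases e) (simp_all add: gmean_def f_def c_def ktrans_def P_def)
    finally show ?thesis .
  qed
  show "gamma_op M (kop M ?k) ^ N \<le> gmean ?J \<rho>"
    by (rule gamma_hadamard_power[where V = V and \<sigma> = \<sigma> and ol = "letter a m" and c = c,
          OF m N rep heq lr V per \<sigma> Vb \<rho> growth])
qed

end

section \<open>The two parities of \<open>m\<close>\<close>

theorem theorem5p4: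
  fixes M :: "'a measure" and m :: nat and Psi :: "nat \<Rightarrow> 'a kernel set"
    and r :: "'a op set \<Rightarrow> real"
  assumes "sigma_finite_measure M"
    and "m \<ge> 1"
    and "\<forall>j\<in>{1..m}. bdd_pko_set M (Psi j)"
    and "r \<in> {rho_ess_set M, rho_hat_ess_set M}"
  shows
    "(even m \<longrightarrow>
       gamma_set M (hadamard_mean_set M m Psi)
         \<le> (r (prodlist (map (\<lambda>j. if odd j then adj_ops M (Psi j) else ops M (Psi j)) [1..<m+1]))
            * r (prodlist (map (\<lambda>j. if odd j then ops M (Psi j) else adj_ops M (Psi j)) [1..<m+1])))
           powr (1 / real (2 * m))
     \<and> (r (prodlist (map (\<lambda>j. if odd j then adj_ops M (Psi j) else ops M (Psi j)) [1..<m+1]))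
            * r (prodlist (map (\<lambda>j. if odd j then ops M (Psi j) else adj_ops M (Psi j)) [1..<m+1])))
           powr (1 / real (2 * m))
       = (r (prodlist (map (\<lambda>j. if odd j then adj_ops M (Psi j) else ops M (Psi j)) [1..<m+1]))
            * r (prodlist (map (\<lambda>j. if odd j then adj_ops M (Psi j) else ops M (Psi j)) (rev [1..<m+1]))))
           powr (1 / real (2 * m)))
   \<and> (odd m \<longrightarrow>
       gamma_set M (hadamard_mean_set M m Psi)
         \<le> (r (prodlist (map (\<lambda>p. if even p then adj_ops M (Psi ((p - 1) mod m + 1))
                                   else ops M (Psi ((p - 1) mod m + 1))) [1..<2*m+1])))
           powr (1 / real (2 * m)))"
proof -
  interpret sigma_finite_measure M by (rule assms(1))
  have m: "m > 0" using assms(2) by simp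
  have Psi: "bdd_pko_set M (Psi j)" if "j \<in> {1..m}" for j using assms(3) that by blast
  have pos: "pos_kernel_op M k" if "j \<in> {1..m}" "k \<in> Psi j" for j k
    using Psi[OF that(1)] that(2) by (simp add: bdd_pko_set_def)
  have bop: "\<exists>C. bset (ops M (Psi j)) C" "\<exists>C. bset (adj_ops M (Psi j)) C" if "j \<in> {1..m}" for j
    using bset_ops[OF Psi[OF that]] by blast+
  let ?F = "\<lambda>j. if odd j then adj_ops M (Psi j) else ops M (Psi j)"
  let ?G = "\<lambda>j. if odd j then ops M (Psi j) else adj_ops M (Psi j)"
  let ?H = "\<lambda>p. if even p then adj_ops M (Psi ((p - 1) mod m + 1)) else ops M (Psi ((p - 1) mod m + 1))"
  let ?LF = "map ?F [1..<m+1]" and ?LG = "map ?G [1..<m+1]" and ?LH = "map ?H [1..<2*m+1]"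
  have bF: "\<exists>C. bset (prodlist ?LF) C"
    by (rule bset_prodlist) (use m bop in \<open>auto simp: less_Suc_eq_le\<close>)
  have bG: "\<exists>C. bset (prodlist ?LG) C"
    by (rule bset_prodlist) (use m bop in \<open>auto simp: less_Suc_eq_le\<close>)
  have bH: "\<exists>C. bset (prodlist ?LH) C"
  proof (rule bset_prodlist)
    fix L assume "L \<in> set ?LH"
    then obtain p where p: "L = ?H p" unfolding set_map by (rule imageE)
    have "(p - 1) mod m + 1 \<in> {1..m}" using m by (simp add: Suc_le_eq)
    from bop[OF this] show "\<exists>C. bset L C" unfolding p by simp
  qed (use m in simp)
  note letter = letter_represents[OF m]
  have elem: "\<exists>a. (\<forall>j\<in>{1..m}. a j \<in> Psi j) \<and> T = kop M (\<lambda>x y. \<Prod>j\<in>{1..m}. a j x y powr (1 / real m))"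
    if "T \<in> hadamard_mean_set M m Psi" for T
    using that unfolding hadamard_mean_set_def by blast
  have in_ops: "letter a m i e \<in> (if e then adj_ops M (Psi (i mod m + 1)) else ops M (Psi (i mod m + 1)))"
    if a: "\<forall>j\<in>{1..m}. a j \<in> Psi j" for a i e
  proof -
    have "i mod m + 1 \<in> {1..m}" using m by (simp add: Suc_le_eq)
    then have "a (i mod m + 1) \<in> Psi (i mod m + 1)" using a by blast
    then show ?thesis by (simp add: letter_def ops_def adj_ops_def)
  qed
  have evenpart: "gamma_set M (hadamard_mean_set M m Psi) \<le> (r (prodlist ?LF) * r (prodlist ?LG)) powr (1 / real (2 * m))"
    if ev: "even m"
  proof (rule gamma_set_least)
    let ?f = "r (prodlist ?LF)" and ?g = "r (prodlist ?LG)"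
    have f0: "0 \<le> ?f" using radius_growth(1)[OF assms(4)] bF by blast
    have g0: "0 \<le> ?g" using radius_growth(1)[OF assms(4)] bG by blast
    fix T assume "T \<in> hadamard_mean_set M m Psi"
    from elem[OF this] obtain a where a: "\<forall>j\<in>{1..m}. a j \<in> Psi j"
      and T: "T = kop M (\<lambda>x y. \<Prod>j\<in>{1..m}. a j x y powr (1 / real m))" by blast
    have pa: "pos_kernel_op M (a j)" if "j \<in> {1..m}" for j using pos[OF that] a that by blast
    \<comment> \<open>The parity of the slot decides which of the two words is read. At position
      \<open>s + i\<close> the two occurrences of \<open>s\<close> cancel and leave the parity of
      \<open>i\<close>; evenness of \<open>m\<close> makes the word periodic with period
      \<open>m\<close>.\<close>
    define V where "V s i = letter a m i (odd (s + i))" for s i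
    let ?\<rho> = "\<lambda>s. if even s then ?g else ?f"
    have word: "oword (V s) m \<in> prodlist (if even s then ?LG else ?LF)" for s
    proof -
      have "oword (V s) (length (if even s then ?LG else ?LF)) \<in> prodlist (if even s then ?LG else ?LF)"
      proof (rule oword_prodlist)
        fix i assume "i < length (if even s then ?LG else ?LF)"
        then have i: "i < m" by (simp split: if_splits)
        \<comment> \<open>Letters count from 0 and the lists from \<open>j = 1\<close>, so an even
          \<open>i\<close> stands for an odd \<open>j\<close>; even slots start without an adjoint
          and read \<open>?LG\<close>.\<close>
        then have "(if even s then ?LG else ?LF) ! i = (if odd (s + i) then adj_ops M (Psi (i mod m + 1)) else ops M (Psi (i mod m + 1)))"
          by (auto simp: nth_append simp del: upt_Suc)
        then show "V s i \<in> (if even s then ?LG else ?LF) ! i"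
          using in_ops[OF a, of i "odd (s + i)"] by (simp only: V_def)
      qed
      moreover have "length (if even s then ?LG else ?LF) = m" by simp
      ultimately show ?thesis by (simp only:)
    qed
    have main: "gamma_op M (kop M (\<lambda>x y. \<Prod>j\<in>{1..m}. a j x y powr (1 / real m))) ^ m \<le> gmean {..<m} ?\<rho>"
      "0 \<le> gamma_op M (kop M (\<lambda>x y. \<Prod>j\<in>{1..m}. a j x y powr (1 / real m)))"
    proof -
      have 1: "letter a m (s + i) (odd i) = V s (s + i)" for s i
        by (cases "even s"; cases "even i") (simp_all add: V_def)
      have 2: "V s (m + i) = V s i" for s i
        using ev by (simp add: V_def letter_def)
      have 3: "blin M (V s i)" for s i
        unfolding V_def by (rule represents_blin[OF letter[where a = a, OF pa]])
      have 4: "0 \<le> ?\<rho> s" for s using f0 g0 by simp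
      have 5: "\<exists>D. 0 \<le> D \<and> (\<forall>n>0. gamma_op M (oword (V s) m ^^ n) \<le> D * t ^ n)" if t: "?\<rho> s < t" for s t
      proof (cases "even s")
        case True
        obtain C where "bset (prodlist ?LG) C" using bG by blast
        from radius_growth(2)[OF assms(4) this] word[of s] t True show ?thesis by simp
      next
        case False
        obtain C where "bset (prodlist ?LF) C" using bF by blast
        from radius_growth(2)[OF assms(4) this] word[of s] t False show ?thesis by simp
      qed
      show "gamma_op M (kop M (\<lambda>x y. \<Prod>j\<in>{1..m}. a j x y powr (1 / real m))) ^ m \<le> gmean {..<m} ?\<rho>"
        "0 \<le> gamma_op M (kop M (\<lambda>x y. \<Prod>j\<in>{1..m}. a j x y powr (1 / real m)))"
        using gamma_hadamard_mean[where a = a and N = m and V = V and \<sigma> = "\<lambda>s. s" and \<rho> = ?\<rho>,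
            OF m pa ev m 1 2 less_imp_le 3 4 5] by blast+
    qed
    have "gmean {..<m} ?\<rho> = (?f * ?g) powr (1 / 2)"
      using gmean_alternate[OF ev m g0 f0] by (simp add: mult.commute)
    with main have le: "gamma_op M T ^ m \<le> (?f * ?g) powr (1 / 2)" and nn: "0 \<le> gamma_op M T"
      by (simp_all add: T)
    have "gamma_op M T = (gamma_op M T ^ m) powr (1 / real m)"
      using nn m by (cases "gamma_op M T = 0") (simp_all add: powr_powr flip: powr_realpow)
    also have "\<dots> \<le> ((?f * ?g) powr (1 / 2)) powr (1 / real m)"
      by (intro powr_mono2 le) (use nn in simp_all)
    also have "\<dots> = (?f * ?g) powr (1 / real (2 * m))" by (simp add: powr_powr)
    finally show "gamma_op M T \<le> (?f * ?g) powr (1 / real (2 * m))" .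
  qed simp
  have oddpart: "gamma_set M (hadamard_mean_set M m Psi) \<le> (r (prodlist ?LH)) powr (1 / real (2 * m))"
    if od: "odd m"
  proof (rule gamma_set_least)
    let ?f = "r (prodlist ?LH)"
    have f0: "0 \<le> ?f" using radius_growth(1)[OF assms(4)] bH by blast
    fix T assume "T \<in> hadamard_mean_set M m Psi"
    from elem[OF this] obtain a where a: "\<forall>j\<in>{1..m}. a j \<in> Psi j"
      and T: "T = kop M (\<lambda>x y. \<Prod>j\<in>{1..m}. a j x y powr (1 / real m))" by blast
    have pa: "pos_kernel_op M (a j)" if "j \<in> {1..m}" for j using pos[OF that] a that by blast
    \<comment> \<open>One word for all slots: the residue modulo \<open>m\<close> and the parity of
      a position together have period \<open>2 * m\<close> when \<open>m\<close> is odd.\<close>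
    define V where "V s i = letter a m i (odd i)" for s i :: nat
    \<comment> \<open>An odd slot has to start at letter \<open>s\<close> with the opposite parity;
      moving on by the odd number \<open>m\<close> flips the parity and keeps the letter.\<close>
    define \<sigma> where "\<sigma> s = (if even s then s else s + m)" for s
    have word: "oword (V s) (2 * m) \<in> prodlist ?LH" for s
    proof -
      have "oword (V s) (length ?LH) \<in> prodlist ?LH"
      proof (rule oword_prodlist)
        fix i assume "i < length ?LH"
        then have i: "i < 2 * m" by (simp del: upt_Suc)
        then have "?LH ! i = (if odd i then adj_ops M (Psi (i mod m + 1)) else ops M (Psi (i mod m + 1)))"
          by (auto simp: nth_append simp del: upt_Suc)
        then show "V s i \<in> ?LH ! i"
          using in_ops[OF a, of i "odd i"] by (simp only: V_def)
      qed
      moreover have "length ?LH = 2 * m" by (simp del: upt_Suc)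
      ultimately show ?thesis by (simp only:)
    qed
    have main: "gamma_op M (kop M (\<lambda>x y. \<Prod>j\<in>{1..m}. a j x y powr (1 / real m))) ^ (2 * m) \<le> gmean {..<m} (\<lambda>s. ?f)"
      "0 \<le> gamma_op M (kop M (\<lambda>x y. \<Prod>j\<in>{1..m}. a j x y powr (1 / real m)))"
    proof -
      have 1: "letter a m (s + i) (odd i) = V s (\<sigma> s + i)" for s i
      proof -
        have "(s + m + i) mod m = (s + i) mod m"
          using mod_add_self2[of "s + i" m] by (simp add: ac_simps)
        then show ?thesis
          using od by (cases "even s"; cases "even i") (simp_all add: V_def \<sigma>_def letter_def)
      qed
      have 2: "V s (2 * m + i) = V s i" for s i
        by (simp add: V_def letter_def)
      have 3: "blin M (V s i)" for s i
        unfolding V_def by (rule represents_blin[OF letter[where a = a, OF pa]])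
      have 4: "\<sigma> s \<le> 2 * m" if "s < m" for s using that by (simp add: \<sigma>_def)
      have 5: "\<exists>D. 0 \<le> D \<and> (\<forall>n>0. gamma_op M (oword (V s) (2 * m) ^^ n) \<le> D * t ^ n)" if t: "?f < t" for s t
      proof -
        obtain C where "bset (prodlist ?LH) C" using bH by blast
        from radius_growth(2)[OF assms(4) this word t] show ?thesis .
      qed
      have 6: "even (2 * m)" "2 * m > 0" using m by simp_all
      show "gamma_op M (kop M (\<lambda>x y. \<Prod>j\<in>{1..m}. a j x y powr (1 / real m))) ^ (2 * m) \<le> gmean {..<m} (\<lambda>s. ?f)"
        "0 \<le> gamma_op M (kop M (\<lambda>x y. \<Prod>j\<in>{1..m}. a j x y powr (1 / real m)))"
        using gamma_hadamard_mean[where a = a and N = "2 * m" and V = V and \<sigma> = \<sigma> and \<rho> = "\<lambda>s. ?f",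
            OF m pa 6 1 2 4 3 f0 5] by blast+
    qed
    have "gmean {..<m} (\<lambda>s. ?f) = ?f"
      by (rule gmean_const) (use m f0 in auto)
    with main have le: "gamma_op M T ^ (2 * m) \<le> ?f" and nn: "0 \<le> gamma_op M T"
      by (simp_all add: T)
    have "gamma_op M T = (gamma_op M T ^ (2 * m)) powr (1 / real (2 * m))"
      using nn m by (cases "gamma_op M T = 0") (simp_all add: powr_powr flip: powr_realpow)
    also have "\<dots> \<le> ?f powr (1 / real (2 * m))"
      by (intro powr_mono2 le) (use nn in simp_all)
    finally show "gamma_op M T \<le> ?f powr (1 / real (2 * m))" .
  qed simp
  \<comment> \<open>Taking adjoints reverses the product and exchanges \<open>ops\<close> with
    \<open>adj_ops\<close>, so the second word turns into the reversed first pattern.\<close>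
  have "adjsets (prodlist ?LG) (prodlist (map ?F (rev [1..<m+1])))"
  proof (rule adjsets_prodlist)
    fix j assume "j \<in> set [1..<m+1]"
    then have "j \<in> {1..m}" by auto
    from adjsets_ops[OF Psi[OF this]] show "adjsets (?G j) (?F j)" by simp
  qed (use m in simp)
  from radius_adjsets[OF assms(4) this]
  have eq: "r (prodlist ?LG) = r (prodlist (map ?F (rev [1..<m+1])))" .
  show ?thesis
    using evenpart oddpart eq by (intro conjI impI) simp_all
qed

end
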